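(* Let $Q$ be a finite quiver without oriented cycles and $\beta\in\mathbb Z_{\ge 0}^{Q_0}$ a dimension vector. For an effective weight $\sigma\in C(Q,\beta)$ define the GIT-cone $$C(\sigma)=\{\sigma'\in C(Q,\beta)\mid \operatorname{Rep}(Q,\beta)^{ss}_{\sigma}\subseteq \operatorname{Rep}(Q,\beta)^{ss}_{\sigma'}\}.$$ Then: (1) for every effective weight $\sigma\in C(Q,\beta)$, $C(\sigma)$ is a rational convex polyhedral cone whose relative interior is the GIT-class $\langle\sigma\rangle$ of $\sigma$; (2) the cones $C(\sigma)$, $\sigma\in C(Q,\beta)$, form a finite fan covering $C(Q,\beta)$. Consequently, there is a finite number of open subsets of $\operatorname{Rep}(Q,\beta)$ which can be realized as sets $\operatorname{Rep}(Q,\beta)^{ss}_{\sigma}$ of $\sigma$-semi-stable representations for some effective weights $\sigma$.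
   Context: The ground field is $\mathbb C$. A quiver $Q=(Q_0,Q_1,t,h)$ has vertex set $Q_0$, arrow set $Q_1$, and each arrow $a$ has tail $ta$ and head $ha$. A representation $V$ assigns a finite-dimensional $\mathbb C$-vector space $V(x)$ to each $x\in Q_0$ and a linear map $V(a):V(ta)\to V(ha)$ to each $a\in Q_1$; its dimension vector is $\underline d_V\in\mathbb Z^{Q_0}$, $\underline d_V(x)=\dim_{\mathbb C}V(x)$. A subrepresentation $W'\subseteq W$ consists of subspaces $W'(x)\subseteq W(x)$ with $W(a)(W'(ta))\subseteq W'(ha)$ and $W'(a)$ the restriction of $W(a)$. The representation space is $\operatorname{Rep}(Q,\beta)=\bigoplus_{a\in Q_1}\operatorname{Hom}(\mathbb C^{\beta(ta)},\mathbb C^{\beta(ha)})$, with its Zariski topology. Weights are elements $\sigma\in\mathbb R^{Q_0}$, and $\sigma(\gamma)=\sum_{x\in Q_0}\sigma(x)\gamma(x)$ for $\gamma\in\mathbb Z^{Q_0}$. Write $\beta_1\hookrightarrow\beta$ if every $\beta$-dimensional representation has a subrepresentation of dimension vector $\beta_1$. The cone of effective weights is $$C(Q,\beta)=\{\sigma\in\mathbb R^{Q_0}\mid \sigma(\beta)=0,\ \sigma(\beta_1)\le 0\text{ for all }\beta_1\hookrightarrow\beta\},$$ and its elements are called effective weights. For $\sigma\in\mathbb R^{Q_0}$, the set of $\sigma$-semi-stable $\beta$-dimensional representations is $$\operatorname{Rep}(Q,\beta)^{ss}_\sigma=\{W\in\operatorname{Rep}(Q,\beta)\mid \sigma(\underline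 d_W)=0,\ \sigma(\underline d_{W'})\le 0\text{ for all subrepresentations }W'\subseteq W\}.$$ Two effective weights $\sigma_1,\sigma_2$ are GIT-equivalent ($\sigma_1\sim\sigma_2$) if $\operatorname{Rep}(Q,\beta)^{ss}_{\sigma_1}=\operatorname{Rep}(Q,\beta)^{ss}_{\sigma_2}$; the GIT-class $\langle\sigma\rangle$ of $\sigma\in C(Q,\beta)$ is its equivalence class in $C(Q,\beta)$. A finite fan covering $C(Q,\beta)$ is a finite collection of rational convex polyhedral cones in $\mathbb R^{Q_0}$ with union $C(Q,\beta)$ such that every face of a cone of the collection belongs to the collection, and the intersection of any two cones of the collection is a common face of both (hence also belongs to the collection). Faces are nonempty and include the cone itself; cones are not required to be pointed. *)

theory Defs
  imports
    "HOL-Analysis.Analysis"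
    "Graph_Theory.Graph_Theory"
    "Jordan_Normal_Form.VS_Connect"
begin

text \<open>
  Quivers are the (multi-)digraphs of Graph_Theory. Dimension vectors have type
  \<open>'v \<Rightarrow> nat\<close>, weights type \<open>real ^ 'v\<close>, so the definitions that mention
  weights are meant for quivers with \<open>verts Q = UNIV\<close>.
\<close>

section \<open>Representations\<close>

text \<open>
  The product is extensional outside \<open>arcs Q\<close>, so that points of the representation space
  are in bijection with families of matrices indexed by the arrows.
\<close>
definition Rep :: "('v, 'a) pre_digraph \<Rightarrow> ('v \<Rightarrow> nat) \<Rightarrow> ('a \<Rightarrow> complex mat) set" where
  "Rep Q \<beta> = (\<Pi>\<^sub>E a\<in>arcs Q. carrier_mat (\<beta> (head Q a)) (\<beta> (tail Q a)))"

definition subrep ::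
  "('v, 'a) pre_digraph \<Rightarrow> ('v \<Rightarrow> nat) \<Rightarrow> ('a \<Rightarrow> complex mat) \<Rightarrow> ('v \<Rightarrow> complex Matrix.vec set) \<Rightarrow> bool"
  where
  "subrep Q \<beta> W U \<longleftrightarrow>
     (\<forall>x\<in>verts Q. VectorSpace.subspace class_ring (U x) (module_vec TYPE(complex) (\<beta> x))) \<and>
     (\<forall>a\<in>arcs Q. \<forall>u\<in>U (tail Q a). W a *\<^sub>v u \<in> U (head Q a))"

definition subrep_dim :: "('v \<Rightarrow> nat) \<Rightarrow> ('v \<Rightarrow> complex Matrix.vec set) \<Rightarrow> 'v \<Rightarrow> nat" where
  "subrep_dim \<beta> U x =
     vectorspace.dim class_ring ((module_vec TYPE(complex) (\<beta> x))\<lparr>carrier := U x\<rparr>)"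

text \<open>The relation \<open>\<beta>\<^sub>1 \<hookrightarrow> \<beta>\<close>.\<close>
definition generic_sub :: "('v, 'a) pre_digraph \<Rightarrow> ('v \<Rightarrow> nat) \<Rightarrow> ('v \<Rightarrow> nat) \<Rightarrow> bool" where
  "generic_sub Q \<beta>1 \<beta> \<longleftrightarrow>
     (\<forall>W\<in>Rep Q \<beta>. \<exists>U. subrep Q \<beta> W U \<and> (\<forall>x\<in>verts Q. subrep_dim \<beta> U x = \<beta>1 x))"

section \<open>Weights and semi-stability\<close>

definition weight :: "real ^ 'v \<Rightarrow> ('v::finite \<Rightarrow> nat) \<Rightarrow> real" where
  "weight \<sigma> \<gamma> = (\<Sum>x\<in>UNIV. vec_nth \<sigma> x * real (\<gamma> x))"

definition effective_cone :: "('v::finite, 'a) pre_digraph \<Rightarrow> ('v \<Rightarrow> nat) \<Rightarrow> (real ^ 'v) set" where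
  "effective_cone Q \<beta> =
     {\<sigma>. weight \<sigma> \<beta> = 0 \<and> (\<forall>\<beta>1. generic_sub Q \<beta>1 \<beta> \<longrightarrow> weight \<sigma> \<beta>1 \<le> 0)}"

definition Rep_ss ::
  "('v::finite, 'a) pre_digraph \<Rightarrow> ('v \<Rightarrow> nat) \<Rightarrow> real ^ 'v \<Rightarrow> ('a \<Rightarrow> complex mat) set" where
  "Rep_ss Q \<beta> \<sigma> =
     {W\<in>Rep Q \<beta>. weight \<sigma> \<beta> = 0 \<and>
        (\<forall>U. subrep Q \<beta> W U \<longrightarrow> weight \<sigma> (subrep_dim \<beta> U) \<le> 0)}"

definition git_class ::
  "('v::finite, 'a) pre_digraph \<Rightarrow> ('v \<Rightarrow> nat) \<Rightarrow> real ^ 'v \<Rightarrow> (real ^ 'v) set" where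
  "git_class Q \<beta> \<sigma> = {\<sigma>'\<in>effective_cone Q \<beta>. Rep_ss Q \<beta> \<sigma> = Rep_ss Q \<beta> \<sigma>'}"

definition git_cone ::
  "('v::finite, 'a) pre_digraph \<Rightarrow> ('v \<Rightarrow> nat) \<Rightarrow> real ^ 'v \<Rightarrow> (real ^ 'v) set" where
  "git_cone Q \<beta> \<sigma> = {\<sigma>'\<in>effective_cone Q \<beta>. Rep_ss Q \<beta> \<sigma> \<subseteq> Rep_ss Q \<beta> \<sigma>'}"

section \<open>Zariski topology of the representation space\<close>

inductive_set rep_polynomials ::
  "('v, 'a) pre_digraph \<Rightarrow> ('v \<Rightarrow> nat) \<Rightarrow> (('a \<Rightarrow> complex mat) \<Rightarrow> complex) set"
  for Q :: "('v, 'a) pre_digraph" and \<beta> :: "'v \<Rightarrow> nat" where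
  const: "(\<lambda>W. c) \<in> rep_polynomials Q \<beta>"
| coordinate: "\<lbrakk>a \<in> arcs Q; i < \<beta> (head Q a); j < \<beta> (tail Q a)\<rbrakk>
    \<Longrightarrow> (\<lambda>W. W a $$ (i, j)) \<in> rep_polynomials Q \<beta>"
| add: "\<lbrakk>f \<in> rep_polynomials Q \<beta>; g \<in> rep_polynomials Q \<beta>\<rbrakk>
    \<Longrightarrow> (\<lambda>W. f W + g W) \<in> rep_polynomials Q \<beta>"
| mult: "\<lbrakk>f \<in> rep_polynomials Q \<beta>; g \<in> rep_polynomials Q \<beta>\<rbrakk>
    \<Longrightarrow> (\<lambda>W. f W * g W) \<in> rep_polynomials Q \<beta>"

definition zariski_closed ::
  "('v, 'a) pre_digraph \<Rightarrow> ('v \<Rightarrow> nat) \<Rightarrow> ('a \<Rightarrow> complex mat) set \<Rightarrow> bool" where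
  "zariski_closed Q \<beta> Z \<longleftrightarrow>
     (\<exists>F \<subseteq> rep_polynomials Q \<beta>. Z = {W\<in>Rep Q \<beta>. \<forall>f\<in>F. f W = 0})"

definition zariski_open ::
  "('v, 'a) pre_digraph \<Rightarrow> ('v \<Rightarrow> nat) \<Rightarrow> ('a \<Rightarrow> complex mat) set \<Rightarrow> bool" where
  "zariski_open Q \<beta> S \<longleftrightarrow> S \<subseteq> Rep Q \<beta> \<and> zariski_closed Q \<beta> (Rep Q \<beta> - S)"

section \<open>Cones and fans\<close>

definition rational_polyhedral_cone :: "(real ^ 'v::finite) set \<Rightarrow> bool" where
  "rational_polyhedral_cone K \<longleftrightarrow>
     (\<exists>A. finite A \<and> (\<forall>a\<in>A. \<forall>x. vec_nth a x \<in> \<rat>) \<and> K = {\<sigma>. \<forall>a\<in>A. inner a \<sigma> \<le> 0})"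

text \<open>
  The library's \<open>face_of\<close> admits the empty face; here faces are nonempty.
  Cones need not be pointed.
\<close>
definition cone_face :: "(real ^ 'v::finite) set \<Rightarrow> (real ^ 'v) set \<Rightarrow> bool" where
  "cone_face T K \<longleftrightarrow> T face_of K \<and> T \<noteq> {}"

definition finite_fan_covering :: "(real ^ 'v::finite) set set \<Rightarrow> (real ^ 'v) set \<Rightarrow> bool" where
  "finite_fan_covering \<F> C \<longleftrightarrow>
     finite \<F> \<and> (\<forall>K\<in>\<F>. rational_polyhedral_cone K) \<and> \<Union>\<F> = C \<and>
     (\<forall>K\<in>\<F>. \<forall>T. cone_face T K \<longrightarrow> T \<in> \<F>) \<and>
     (\<forall>K\<in>\<F>. \<forall>L\<in>\<F>. cone_face (K \<inter> L) K \<and> cone_face (K \<inter> L) L)"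

end

theory Submission
  imports
    Defs
    "HOL-Computational_Algebra.Field_as_Ring"
    "HOL-Computational_Algebra.Fundamental_Theorem_Algebra"
    "Subresultants.Subresultant_Gcd"
begin

text \<open>
  A representation \<open>W\<close> is \<open>\<sigma>\<close>-semi-stable iff \<open>\<sigma>(\<beta>) = 0\<close> and \<open>\<sigma> \<le> 0\<close> on the set \<open>dims W\<close> of
  dimension vectors of its subrepresentations. These sets lie in the finite box below \<open>\<beta>\<close>, so there
  are only finitely many semi-stable loci, and \<open>C(\<sigma>)\<close> is cut out by \<open>\<tau>(\<beta>) = 0\<close> and by \<open>\<tau>(d) \<le> 0\<close> for
  the \<open>d\<close> that occur in some \<open>\<sigma>\<close>-semi-stable representation. What needs work is that the loci are open
  and nonempty, and that these cones fit together.

  Openness and nonemptiness. For each \<open>d\<close> the representations with a \<open>d\<close>-dimensional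
  subrepresentation form a Zariski closed set (\<open>closed_dims\<close>): subspaces are recorded by their
  Pluecker coordinates, and the homogeneous coordinates are eliminated one by one with resultants.
  As the representation space is irreducible, some representation avoids all the proper ones among
  these finitely many closed sets (\<open>general_representation\<close>); it is semi-stable for all effective weights.

  Flips. Let \<open>W\<close> be \<open>\<tau>\<close>-semi-stable and \<open>B\<close> a subrepresentation with \<open>\<tau>(B) = 0\<close>. A flip of \<open>W\<close> along \<open>B\<close>
  is an extension in which the roles of \<open>B\<close> and \<open>W/B\<close> are exchanged: \<open>W/B\<close> is the subrepresentation and
  \<open>B\<close> the quotient. A subrepresentation \<open>U\<close> of a flip is made of its image \<open>S \<subseteq> B\<close> and of the preimage
  \<open>P \<supseteq> B\<close> in \<open>W\<close> of its part in \<open>W/B\<close>, both subrepresentations of \<open>W\<close>, with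
  \<open>dim U + dim B = dim S + dim P\<close>. Hence flips preserve \<open>\<tau>\<close>-semi-stability. As \<open>B\<close> and
  \<open>W/B\<close> both occur as subrepresentations, any \<open>\<tau>'\<close> in \<open>C(\<tau>)\<close> satisfies \<open>\<tau>'(B) = 0\<close>
  (\<open>git_cone_vanishing\<close>), so that \<open>\<tau>\<close> is strictly negative on all inequalities that are not equations on
  \<open>C(\<tau>)\<close>, that is, \<open>\<tau>\<close> is in the relative interior of \<open>C(\<tau>)\<close>.

  The main step (\<open>flips_reach_semistable\<close>) plays the role of properness of the morphisms between the
  quotients. For an effective \<open>\<sigma>\<close>, every nonempty class of \<open>\<tau>\<close>-semi-stable representations that
  is closed under flips contains one in which \<open>\<tau>(d) = 0\<close> implies \<open>\<sigma>(d) \<le> 0\<close>. If not, take in the class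
  a representation with the smallest maximum of \<open>\<sigma>\<close> on the subrepresentations with \<open>\<tau> = 0\<close> and then
  with the largest minimal size of a maximiser \<open>B\<close>. Extremality forces all flips along \<open>B\<close> to split,
  which says that all classes in \<open>Ext(B, W/B)\<close> vanish. Then \<open>B\<close> deforms to first order
  in every direction, and looking at lowest order Taylor terms one finds that a polynomial vanishing on the
  representations with a subrepresentation of dimension \<open>dim B\<close> is zero (\<open>vanishing_if_split\<close>). So
  \<open>dim B\<close> is a general dimension vector with \<open>\<sigma>(dim B) > 0\<close>, against effectiveness of \<open>\<sigma>\<close>.

  Comparing semi-stable loci. The condition that \<open>W\<close> is \<open>\<tau>'\<close>-semi-stable and \<open>\<tau>'\<close> vanishes wherever
  \<open>\<tau>\<close> does is invariant under flips, so it can be tested on the representations found in the main step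
  (\<open>Rep_ss_subset_if\<close>). This is used first at the first wall met on the way from \<open>\<sigma>\<close> to a point of the
  relative interior of \<open>C(\<sigma>)\<close>, showing that there is none and that the relative interior is the
  GIT-class (\<open>rel_interior_git_cone\<close>), and then at a point \<open>\<tau>\<close> of \<open>C(\<sigma>)\<close>, showing that \<open>C(\<tau>)\<close> is
  the smallest face of \<open>C(\<sigma>)\<close> containing \<open>\<tau>\<close> (\<open>git_cone_inside\<close>, \<open>git_cone_face\<close>). The fan axioms follow
  by choosing \<open>\<tau>\<close> in the relative interior of a face or of an intersection of two cones.
\<close>

section \<open>Forms whose coefficients depend on a parameter\<close>

text \<open>
  Forms of degree \<open>d\<close> in the variables \<open>p s\<close>, \<open>s \<in> S\<close>, with coefficients in a ring \<open>R\<close> of functions of a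
  parameter \<open>W\<close>, represented as functions of both. The degree is part of the data because the zero
  function has every degree.
\<close>
inductive_set forms :: "('w \<Rightarrow> complex) set \<Rightarrow> 'i set \<Rightarrow> (nat \<times> ('w \<Rightarrow> ('i \<Rightarrow> complex) \<Rightarrow> complex)) set"
  for R :: "('w \<Rightarrow> complex) set" and S :: "'i set" where
  zero: "(d, \<lambda>_ _. 0) \<in> forms R S"
| coef: "r \<in> R \<Longrightarrow> (0, \<lambda>W _. r W) \<in> forms R S"
| var: "s \<in> S \<Longrightarrow> (1, \<lambda>_ p. p s) \<in> forms R S"
| add: "(d, f) \<in> forms R S \<Longrightarrow> (d, g) \<in> forms R S \<Longrightarrow> (d, \<lambda>W p. f W p + g W p) \<in> forms R S"
| mult: "(d, f) \<in> forms R S \<Longrightarrow> (e, g) \<in> forms R S \<Longrightarrow> (d + e, \<lambda>W p. f W p * g W p) \<in> forms R S"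

locale coefficient_ring =
  fixes R :: "('w \<Rightarrow> complex) set"
  assumes const: "(\<lambda>_. c) \<in> R"
    and add: "r \<in> R \<Longrightarrow> r' \<in> R \<Longrightarrow> (\<lambda>W. r W + r' W) \<in> R"
    and mult: "r \<in> R \<Longrightarrow> r' \<in> R \<Longrightarrow> (\<lambda>W. r W * r' W) \<in> R"
begin

lemma forms_const: "(0, \<lambda>_ _. c) \<in> forms R S"
  using forms.coef[OF const] .

lemma forms_scale: "(d, f) \<in> forms R S \<Longrightarrow> (d, \<lambda>W p. c * f W p) \<in> forms R S"
  using forms.mult[OF forms_const] by fastforce

lemma forms_sum:
  assumes "finite A" "\<And>a. a \<in> A \<Longrightarrow> (d, f a) \<in> forms R S"
  shows "(d, \<lambda>W p. \<Sum>a\<in>A. f a W p) \<in> forms R S"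
  using assms by (induction A rule: finite_induct) (auto intro: forms.zero forms.add)

lemma forms_prod:
  assumes "finite A" "\<And>a. a \<in> A \<Longrightarrow> (d a, f a) \<in> forms R S"
  shows "(sum d A, \<lambda>W p. \<Prod>a\<in>A. f a W p) \<in> forms R S"
  using assms by (induction A rule: finite_induct) (auto intro: forms_const forms.mult)

lemma forms_cong_vars:
  assumes "(d, f) \<in> forms R S" "\<And>s. s \<in> S \<Longrightarrow> p s = p' s"
  shows "f W p = f W p'"
  using assms by (induction arbitrary: W rule: forms.induct) auto

lemma forms_homogeneous:
  assumes "(d, f) \<in> forms R S"
  shows "f W (\<lambda>s. c * p s) = c ^ d * f W p"
  using assms by (induction arbitrary: W rule: forms.induct) (auto simp: algebra_simps power_add)

lemma forms_eval:
  assumes "(d, f) \<in> forms R S"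
  shows "(\<lambda>W. f W p) \<in> R"
  using assms by (induction rule: forms.induct) (auto intro: const add mult)

text \<open>
  Expansion in powers of one variable, the start of the induction on the number of variables.
\<close>
lemma forms_decompose:
  assumes "(d, f) \<in> forms R (insert s S)"
  shows "\<exists>G. (\<forall>j\<le>d. (d - j, G j) \<in> forms R S) \<and>
    f = (\<lambda>W p. \<Sum>j\<le>d. G j W p * p s ^ j)"
  using assms
proof (induction rule: forms.induct)
  case (zero d)
  show ?case by (intro exI[of _ "\<lambda>_ _ _. 0"]) (auto intro: forms.zero)
next
  case (coef r)
  then show ?case by (intro exI[of _ "\<lambda>_ W _. r W"]) (auto intro: forms.coef)
next
  case (var s')
  have split: "(\<Sum>j\<le>1. G j * x ^ j) = G 0 + G 1 * x" for G :: "nat \<Rightarrow> complex" and x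
    by (simp add: atMost_Suc)
  show ?case
  proof (cases "s' = s")
    case True
    then show ?thesis
      unfolding split
      by (intro exI[of _ "\<lambda>j _ _. if j = 1 then 1 else 0"])
         (auto intro: forms.zero forms_const simp: le_Suc_eq)
  next
    case False
    then have "s' \<in> S" using var by auto
    from forms.var[OF this] show ?thesis
      unfolding split
      by (intro exI[of _ "\<lambda>j _ p. if j = 0 then p s' else 0"])
         (auto intro: forms.zero simp: le_Suc_eq)
  qed
next
  case (add d f g)
  then obtain F G where F: "\<forall>j\<le>d. (d - j, F j) \<in> forms R S" "f = (\<lambda>W p. \<Sum>j\<le>d. F j W p * p s ^ j)"
    and G: "\<forall>j\<le>d. (d - j, G j) \<in> forms R S" "g = (\<lambda>W p. \<Sum>j\<le>d. G j W p * p s ^ j)"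
    by blast
  show ?case
    by (intro exI[of _ "\<lambda>j W p. F j W p + G j W p"])
       (auto intro!: forms.add simp: F G sum.distrib algebra_simps)
next
  case (mult d f e g)
  then obtain F G where F: "\<forall>j\<le>d. (d - j, F j) \<in> forms R S" "f = (\<lambda>W p. \<Sum>j\<le>d. F j W p * p s ^ j)"
    and G: "\<forall>j\<le>e. (e - j, G j) \<in> forms R S" "g = (\<lambda>W p. \<Sum>j\<le>e. G j W p * p s ^ j)"
    by blast
  define A where "A k = {i. i \<le> k \<and> i \<le> d \<and> k - i \<le> e}" for k
  have finA: "finite (A k)" for k unfolding A_def by auto
  define H where "H k W p = (\<Sum>i\<in>A k. F i W p * G (k - i) W p)" for k W p
  have 1: "(d + e - k, H k) \<in> forms R S" if "k \<le> d + e" for k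
  proof -
    have "(d + e - k, \<lambda>W p. F i W p * G (k - i) W p) \<in> forms R S" if i: "i \<in> A k" for i
    proof -
      have "(d - i) + (e - (k - i)) = d + e - k" using i unfolding A_def by auto
      moreover have "(d - i, F i) \<in> forms R S" "(e - (k - i), G (k - i)) \<in> forms R S"
        using F G i unfolding A_def by auto
      ultimately show ?thesis using forms.mult by fastforce
    qed
    from forms_sum[OF finA this] show ?thesis unfolding H_def .
  qed
  have "(\<Sum>i\<le>d. F i W p * p s ^ i) * (\<Sum>j\<le>e. G j W p * p s ^ j) = (\<Sum>k\<le>d + e. H k W p * p s ^ k)"
    for W p
  proof -
    have "(\<Sum>i\<le>d. F i W p * p s ^ i) * (\<Sum>j\<le>e. G j W p * p s ^ j)
      = (\<Sum>(i, j)\<in>{..d} \<times> {..e}. F i W p * G j W p * p s ^ (i + j))"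
      by (simp add: sum_product sum.cartesian_product power_add algebra_simps)
    also have "\<dots> = (\<Sum>(k, i)\<in>Sigma {..d + e} A. F i W p * G (k - i) W p * p s ^ k)"
      by (intro sum.reindex_bij_witness[of _ "\<lambda>(k, i). (i, k - i)" "\<lambda>(i, j). (i + j, i)"])
         (auto simp: A_def)
    also have "\<dots> = (\<Sum>k\<le>d + e. H k W p * p s ^ k)"
      by (simp add: sum.Sigma[symmetric] finA H_def sum_distrib_right)
    finally show ?thesis .
  qed
  then have "(\<lambda>W p. f W p * g W p) = (\<lambda>W p. \<Sum>k\<le>d + e. H k W p * p s ^ k)"
    unfolding F(2) G(2) by presburger
  with 1 show ?case by blast
qed

end

section \<open>Linear systems of binary forms\<close>

text \<open>
  The formal degree is fixed at \<open>d\<close>, so polynomials of degree at most \<open>d\<close> are binary forms and the vanishing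
  of both coefficients at \<open>d\<close> is a common zero at infinity. A finite common zero \<open>u\<close> gives the
  kernel vector of powers of \<open>u\<close>; one at infinity makes the first column zero.
\<close>
lemma sylvester_common_zero:
  fixes p q :: "complex poly"
  assumes d: "0 < d" and deg: "degree p \<le> d" "degree q \<le> d"
    and common: "(poly p u = 0 \<and> poly q u = 0) \<or> (coeff p d = 0 \<and> coeff q d = 0)"
  shows "det (sylvester_mat_sub d d p q) = 0"
proof -
  let ?S = "sylvester_mat_sub d d p q"
  have S: "?S \<in> carrier_mat (d + d) (d + d)" by auto
  consider (root) "poly p u = 0" "poly q u = 0" | (inf) "coeff p d = 0" "coeff q d = 0" 
    using common by blast
  then show ?thesis
  proof cases
    case root
    define v where "v = Matrix.vec (d + d) (\<lambda>j. u ^ (d + d - 1 - j))"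
    have v: "v \<in> carrier_vec (d + d)" unfolding v_def by auto
    have pol: "poly r u = (\<Sum>k\<le>d. coeff r k * u ^ k)" if "degree r \<le> d" for r
    proof -
      have "poly r u = (\<Sum>k\<le>degree r. coeff r k * u ^ k)" by (rule poly_altdef)
      also have "\<dots> = (\<Sum>k\<le>d. coeff r k * u ^ k)"
        using that by (intro sum.mono_neutral_left) (auto simp: coeff_eq_0)
      finally show ?thesis .
    qed
    have "(?S *\<^sub>v v) = 0\<^sub>v (d + d)"
    proof (rule eq_vecI)
      fix i assume "i < dim_vec (0\<^sub>v (d + d) :: complex Matrix.vec)"
      then have i: "i < d + d" by auto
      have "vec_index (?S *\<^sub>v v) i = (\<Sum>j<d + d. ?S $$ (i, j) * u ^ (d + d - 1 - j))"
        using i by (auto simp: v_def scalar_prod_def lessThan_atLeast0 intro!: sum.cong)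
      also have "\<dots> = 0"
      proof (cases "i < d")
        case True
        have "(\<Sum>j<d + d. ?S $$ (i, j) * u ^ (d + d - 1 - j))
          = (\<Sum>j\<in>{i..i + d}. coeff p (d + i - j) * u ^ (d + d - 1 - j))"
          using True i by (intro sum.mono_neutral_cong_right) (auto simp: sylvester_mat_sub_index)
        also have "\<dots> = (\<Sum>k\<le>d. coeff p k * u ^ (k + (d - 1 - i)))"
          using True by (intro sum.reindex_bij_witness[of _ "\<lambda>k. d + i - k" "\<lambda>j. d + i - j"]) auto
        also have "\<dots> = u ^ (d - 1 - i) * poly p u"
          by (simp add: pol[OF deg(1)] sum_distrib_left power_add algebra_simps)
        finally show ?thesis using root by simp
      next
        case False
        have "(\<Sum>j<d + d. ?S $$ (i, j) * u ^ (d + d - 1 - j))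
          = (\<Sum>j\<in>{i - d..i}. coeff q (i - j) * u ^ (d + d - 1 - j))"
          using False i by (intro sum.mono_neutral_cong_right) (auto simp: sylvester_mat_sub_index)
        also have "\<dots> = (\<Sum>k\<le>d. coeff q k * u ^ (k + (d + d - 1 - i)))"
          using False i by (intro sum.reindex_bij_witness[of _ "\<lambda>k. i - k" "\<lambda>j. i - j"]) auto
        also have "\<dots> = u ^ (d + d - 1 - i) * poly q u"
          by (simp add: pol[OF deg(2)] sum_distrib_left power_add algebra_simps)
        finally show ?thesis using root by simp
      qed
      finally show "vec_index (?S *\<^sub>v v) i = vec_index (0\<^sub>v (d + d)) i" using i by simp
    qed auto
    moreover have "vec_index v (d + d - 1) = 1" using d unfolding v_def by auto
    then have "v \<noteq> 0\<^sub>v (d + d)" using d by auto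
    ultimately show ?thesis using det_0_iff_vec_prod_zero_field[OF S] v by blast
  next
    case inf
    have "?S $$ (i, 0) = 0" if "i < d + d" for i
      using that d inf by (auto simp: sylvester_mat_sub_index)
    then have "det ?S = (\<Sum>i<d + d. 0 * cofactor ?S i 0)"
      using laplace_expansion_column[OF S, of 0] d by (auto intro!: sum.cong)
    then show ?thesis by simp
  qed
qed

lemma sylvester_no_common_zero:
  fixes p q :: "complex poly"
  assumes deg: "degree p = d" "degree q = d"
    and none: "\<And>u. poly p u = 0 \<Longrightarrow> poly q u \<noteq> 0" and p: "p \<noteq> 0"
  shows "det (sylvester_mat_sub d d p q) \<noteq> 0"
proof
  assume "det (sylvester_mat_sub d d p q) = 0"
  then have "resultant p q = 0" unfolding resultant_def sylvester_mat_def deg .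
  then have "degree (gcd p q) \<noteq> 0" unfolding resultant_0_gcd .
  then obtain u where "poly (gcd p q) u = 0"
    using fundamental_theorem_of_algebra[of "gcd p q"] by (auto simp: constant_degree)
  then have "poly p u = 0" "poly q u = 0" by (metis dvd_trans gcd_dvd1 gcd_dvd2 poly_eq_0_iff_dvd)+
  with none show False by blast
qed

text \<open>
  One point after the other: adding a multiple of a member that is nonzero at the new point spoils the
  earlier conditions for finitely many multiples only.
\<close>
lemma linear_system_generic_member:
  fixes L :: "complex poly set" and r :: "nat \<Rightarrow> complex"
  assumes lin: "\<And>f g c. f \<in> L \<Longrightarrow> g \<in> L \<Longrightarrow> f + Polynomial.smult c g \<in> L"
    and ne: "h \<in> L" and lead: "coeff h d \<noteq> 0"
    and "finite X" "\<And>x. x \<in> X \<Longrightarrow> \<exists>f\<in>L. poly f x \<noteq> 0"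
  shows "\<exists>g\<in>L. coeff g d \<noteq> 0 \<and> (\<forall>x\<in>X. poly g x \<noteq> 0)"
  using assms(4,5)
proof (induction X rule: finite_induct)
  case empty
  then show ?case using ne lead by auto
next
  case (insert x X)
  then obtain g where g: "g \<in> L" "coeff g d \<noteq> 0" "\<forall>x\<in>X. poly g x \<noteq> 0" by auto
  obtain f where f: "f \<in> L" "poly f x \<noteq> 0" using insert by auto
  define B where "B = insert (- coeff g d / coeff f d) ((\<lambda>y. - poly g y / poly f y) ` insert x X)"
  have "finite B" unfolding B_def using insert by auto
  then obtain c where c: "c \<notin> insert 0 B" using ex_new_if_finite[of "insert 0 B"] infinite_UNIV_char_0 by auto
  have *: "a + c * b \<noteq> 0" if "a \<noteq> 0 \<or> b \<noteq> 0" "c \<noteq> - a / b" "c \<noteq> 0" for a b :: complex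
    using that by (cases "b = 0") (auto simp: field_simps add_eq_0_iff)
  have "g + Polynomial.smult c f \<in> L" using lin g f by auto
  moreover have "coeff (g + Polynomial.smult c f) d \<noteq> 0"
    using *[of "coeff g d" "coeff f d"] c g unfolding B_def by auto
  moreover have "poly (g + Polynomial.smult c f) y \<noteq> 0" if "y \<in> insert x X" for y
    using *[of "poly g y" "poly f y"] c g(3) f that unfolding B_def by auto
  ultimately show ?case by blast
qed

text \<open>
  Pairwise resultants detect a common zero of the whole linear system: if there is none, a member \<open>h\<close> of exact degree
  \<open>d\<close> has finitely many roots, and a generic member avoids them all.
\<close>
lemma linear_system_common_zero_iff:
  fixes L :: "complex poly set"
  assumes d: "0 < d" and deg: "\<And>f. f \<in> L \<Longrightarrow> degree f \<le> d"
    and lin: "\<And>f g c. f \<in> L \<Longrightarrow> g \<in> L \<Longrightarrow> f + Polynomial.smult c g \<in> L"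
  shows "(\<forall>f\<in>L. \<forall>g\<in>L. det (sylvester_mat_sub d d f g) = 0) \<longleftrightarrow>
    (\<exists>u. \<forall>f\<in>L. poly f u = 0) \<or> (\<forall>f\<in>L. coeff f d = 0)"
proof (intro iffI)
  assume "(\<exists>u. \<forall>f\<in>L. poly f u = 0) \<or> (\<forall>f\<in>L. coeff f d = 0)"
  then show "\<forall>f\<in>L. \<forall>g\<in>L. det (sylvester_mat_sub d d f g) = 0"
    using sylvester_common_zero[OF d deg deg] by blast
next
  assume res: "\<forall>f\<in>L. \<forall>g\<in>L. det (sylvester_mat_sub d d f g) = 0"
  show "(\<exists>u. \<forall>f\<in>L. poly f u = 0) \<or> (\<forall>f\<in>L. coeff f d = 0)"
  proof (rule ccontr)
    assume not: "\<not> ?thesis"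
    then obtain h where h: "h \<in> L" "coeff h d \<noteq> 0" by auto
    then have h0: "h \<noteq> 0" by auto
    have fin: "finite {u. poly h u = 0}" using poly_roots_finite[OF h0] .
    obtain g where g: "g \<in> L" "coeff g d \<noteq> 0" "\<forall>x\<in>{u. poly h u = 0}. poly g x \<noteq> 0"
      using linear_system_generic_member[OF lin h fin] not by auto
    have dg: "degree h = d" "degree g = d"
      using deg h g by (auto simp: le_antisym le_degree)
    from sylvester_no_common_zero[OF dg _ h0] g res h show False by auto
  qed
qed

section \<open>The main theorem of elimination theory\<close>

context coefficient_ring
begin

definition form_poly :: "nat \<Rightarrow> (nat \<Rightarrow> 'w \<Rightarrow> ('i \<Rightarrow> complex) \<Rightarrow> complex) \<Rightarrow> 'w \<Rightarrow> ('i \<Rightarrow> complex) \<Rightarrow> complex poly"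
  where "form_poly d G W p = (\<Sum>j\<le>d. Polynomial.monom (G j W p) j)"

lemma coeff_form_poly: "coeff (form_poly d G W p) k = (if k \<le> d then G k W p else 0)"
  unfolding form_poly_def by (auto simp: coeff_sum)

lemma degree_form_poly: "degree (form_poly d G W p) \<le> d"
  by (rule degree_le) (simp add: coeff_form_poly)

lemma poly_form_poly: "poly (form_poly d G W p) u = (\<Sum>j\<le>d. G j W p * u ^ j)"
  unfolding form_poly_def by (simp add: poly_sum poly_monom)

text \<open>
  In the Sylvester matrix of two forms of degree \<open>d\<close>, expanded in one variable, the entry at \<open>(i, j)\<close> is
  homogeneous of degree \<open>j - i\<close> in the upper and \<open>d + j - i\<close> in the lower half, so all nonzero
  terms of the Leibniz formula have the same degree \<open>d * d\<close>.
\<close>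
lemma sylvester_form:
  assumes F: "\<forall>j\<le>d. (d - j, F j) \<in> forms R S" and G: "\<forall>j\<le>d. (d - j, G j) \<in> forms R S"
  shows "(d * d, \<lambda>W p. det (sylvester_mat_sub d d (form_poly d F W p) (form_poly d G W p)))
    \<in> forms R S"
proof -
  let ?S = "\<lambda>W p. sylvester_mat_sub d d (form_poly d F W p) (form_poly d G W p)"
  have perm_term: "(d * d, \<lambda>W p. \<Prod>i = 0..<d + d. ?S W p $$ (i, \<pi> i)) \<in> forms R S"
    if \<pi>: "\<pi> permutes {0..<d + d}" for \<pi>
  proof -
    have lt: "\<pi> i < d + d" if "i < d + d" for i using \<pi> that by (simp add: permutes_nat_less)
    define ok where "ok i \<longleftrightarrow> (if i < d then i \<le> \<pi> i \<and> \<pi> i - i \<le> d else i - d \<le> \<pi> i \<and> \<pi> i \<le> i)" for i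
    define e where "e i = (if i < d then \<pi> i - i else d - (i - \<pi> i))" for i
    show ?thesis
    proof (cases "\<forall>i<d + d. ok i")
      case False
      then obtain i where i: "i < d + d" "\<not> ok i" by auto
      then have "?S W p $$ (i, \<pi> i) = 0" for W p
        using lt[of i] unfolding ok_def by (auto simp: sylvester_mat_sub_index)
      then have "(\<Prod>i = 0..<d + d. ?S W p $$ (i, \<pi> i)) = 0" for W p
        using i by (intro prod_zero bexI[of _ i]) auto
      then show ?thesis by (simp only: forms.zero)
    next
      case True
      have entry: "(e i, \<lambda>W p. ?S W p $$ (i, \<pi> i)) \<in> forms R S" if i: "i < d + d" for i
      proof -
        have oki: "ok i" using True i by auto
        show ?thesis
      proof (cases "i < d")
        case True
        have "?S W p $$ (i, \<pi> i) = F (d - e i) W p" for W p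
          using True i lt[of i] oki
          by (auto simp: sylvester_mat_sub_index coeff_form_poly ok_def e_def)
        moreover have "(d - (d - e i), F (d - e i)) \<in> forms R S" using F by auto
        moreover have "d - (d - e i) = e i" using True i oki unfolding ok_def e_def by auto
        ultimately show ?thesis by (simp only:)
      next
        case False
        have "?S W p $$ (i, \<pi> i) = G (d - e i) W p" for W p
          using False i lt[of i] oki
          by (auto simp: sylvester_mat_sub_index coeff_form_poly ok_def e_def)
        moreover have "(d - (d - e i), G (d - e i)) \<in> forms R S" using G by auto
        moreover have "d - (d - e i) = e i" using False i oki unfolding ok_def e_def by auto
        ultimately show ?thesis by (simp only:)
      qed
      qed
      have "int (e i) = (if i < d then int (\<pi> i) - int i else int d + int (\<pi> i) - int i)"
        if i: "i < d + d" for i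
      proof -
        have "ok i" using True i by auto
        then show ?thesis using i unfolding ok_def e_def by (auto split: if_splits)
      qed
      then have "int (\<Sum>i = 0..<d + d. e i)
        = (\<Sum>i = 0..<d + d. if i < d then int (\<pi> i) - int i else int d + int (\<pi> i) - int i)"
        by (simp add: of_nat_sum)
      also have "\<dots> = (\<Sum>i = 0..<d + d. (int (\<pi> i) - int i) + (if i < d then 0 else int d))"
        by (intro sum.cong) auto
      also have "\<dots> = (\<Sum>i = 0..<d + d. int (\<pi> i)) - (\<Sum>i = 0..<d + d. int i)
          + (\<Sum>i = 0..<d + d. if i < d then 0 else int d)"
        by (simp add: sum.distrib sum_subtractf)
      also have "(\<Sum>i = 0..<d + d. int (\<pi> i)) = (\<Sum>i = 0..<d + d. int i)"
        using sum.permute[OF \<pi>, of int] by (simp add: o_def)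
      also have "(\<Sum>i = 0..<d + d. if i < d then 0 else int d) = (\<Sum>i = d..<d + d. int d)"
        by (intro sum.mono_neutral_cong_right) auto
      finally have "(\<Sum>i = 0..<d + d. e i) = d * d"
        by (simp flip: of_nat_mult del: of_nat_sum)
      with forms_prod[of "{0..<d + d}" e "\<lambda>i W p. ?S W p $$ (i, \<pi> i)" S] entry show ?thesis by auto
    qed
  qed
  have "det (?S W p) = (\<Sum>\<pi>\<in>{\<pi>. \<pi> permutes {0..<d + d}}. signof \<pi> * (\<Prod>i = 0..<d + d. ?S W p $$ (i, \<pi> i)))" for W p
    by (rule det_def') auto
  then show ?thesis
    by (simp only:) (intro forms_sum forms_scale perm_term; auto simp: finite_permutations)
qed

text \<open>
  Projection from the point \<open>e\<close> whose only nonzero coordinate is the one at \<open>s\<close>. The family is enlarged to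
  the linear system \<open>\<G>\<close> of all forms of the same degree vanishing on its common zeros. At a point \<open>p\<close> of the remaining
  variables all resultants of \<open>\<G>\<close> vanish iff there is a common zero above \<open>p\<close> or the leading
  coefficients vanish. The latter are the values at \<open>e\<close>, so then \<open>e\<close> itself is a common zero; and
  when \<open>e\<close> is a common zero, the resultants vanish at every \<open>p\<close>. Either way the
  solvable parameters are the same before and after the projection.
\<close>
theorem elimination:
  fixes S :: "'i set"
  assumes "finite S" "S \<noteq> {}" "0 < d" "\<And>f. f \<in> \<F> \<Longrightarrow> (d, f) \<in> forms R S"
  shows "\<exists>E\<subseteq>R. \<forall>W. (\<exists>p. (\<exists>s\<in>S. p s \<noteq> 0) \<and> (\<forall>f\<in>\<F>. f W p = 0)) \<longleftrightarrow> (\<forall>g\<in>E. g W = 0)"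
  using assms
proof (induction S arbitrary: d \<F> rule: finite_ne_induct)
  case (singleton s)
  let ?e = "\<lambda>t. if t = s then 1 else (0::complex)"
  have eq: "f W p = p s ^ d * f W ?e" if "f \<in> \<F>" for f W p
  proof -
    have "f W p = f W (\<lambda>t. p s * ?e t)"
      by (rule forms_cong_vars[OF singleton(2)[OF that]]) auto
    also have "\<dots> = p s ^ d * f W ?e" using forms_homogeneous[OF singleton(2)[OF that]] .
    finally show ?thesis .
  qed
  have "(\<exists>p. (\<exists>s\<in>{s}. p s \<noteq> 0) \<and> (\<forall>f\<in>\<F>. f W p = 0)) \<longleftrightarrow> (\<forall>f\<in>\<F>. f W ?e = 0)" for W
  proof
    assume "\<exists>p. (\<exists>s\<in>{s}. p s \<noteq> 0) \<and> (\<forall>f\<in>\<F>. f W p = 0)"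
    then obtain p where p: "p s \<noteq> 0" "\<forall>f\<in>\<F>. f W p = 0" by auto
    show "\<forall>f\<in>\<F>. f W ?e = 0"
    proof
      fix f assume f: "f \<in> \<F>"
      from p(2) f have "f W p = 0" by blast
      with eq[OF f, of W p] p(1) show "f W ?e = 0" by (metis mult_eq_0_iff power_not_zero)
    qed
  qed (auto intro!: exI[of _ ?e])
  then show ?case
    using forms_eval[OF singleton(2)]
    by (intro exI[of _ "(\<lambda>f W. f W ?e) ` \<F>"]) auto
next
  case (insert s S)
  \<comment> \<open>pairs of a form and its coefficients with respect to the variable \<open>s\<close>\<close>
  define \<G> where "\<G> = {(f, G). (\<forall>j\<le>d. (d - j, G j) \<in> forms R S) \<and>
      f = (\<lambda>W p. \<Sum>j\<le>d. G j W p * p s ^ j) \<and>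
      (\<forall>W p. (\<forall>h\<in>\<F>. h W p = 0) \<longrightarrow> f W p = 0)}"
  have \<G>_coeff: "(d - j, G j) \<in> forms R S" if "(f, G) \<in> \<G>" "j \<le> d" for f G j
    using that unfolding \<G>_def by blast
  have \<G>_eq: "f = (\<lambda>W p. \<Sum>j\<le>d. G j W p * p s ^ j)" if "(f, G) \<in> \<G>" for f G
    using that unfolding \<G>_def by blast
  have \<G>_van: "f W p = 0" if "(f, G) \<in> \<G>" "\<And>h. h \<in> \<F> \<Longrightarrow> h W p = 0" for f G W p
    using that unfolding \<G>_def by blast
  have \<G>_I: "(f, G) \<in> \<G>" if "\<And>j. j \<le> d \<Longrightarrow> (d - j, G j) \<in> forms R S"
    "f = (\<lambda>W p. \<Sum>j\<le>d. G j W p * p s ^ j)"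
    "\<And>W p. (\<And>h. h \<in> \<F> \<Longrightarrow> h W p = 0) \<Longrightarrow> f W p = 0" for f G
    using that unfolding \<G>_def by blast
  define Res where "Res F G W p = det (sylvester_mat_sub d d (form_poly d F W p) (form_poly d G W p))"
    for F G :: "nat \<Rightarrow> 'w \<Rightarrow> ('i \<Rightarrow> complex) \<Rightarrow> complex" and W p
  define \<R> where "\<R> = (\<lambda>(F, G). Res F G) ` (snd ` \<G> \<times> snd ` \<G>)"
  have "(d * d, r) \<in> forms R S" if "r \<in> \<R>" for r
    using that sylvester_form unfolding \<R>_def Res_def \<G>_def by auto
  moreover have "0 < d * d" using insert.prems by simp
  ultimately obtain E where E: "E \<subseteq> R"
    "\<And>W. (\<exists>p. (\<exists>s\<in>S. p s \<noteq> 0) \<and> (\<forall>f\<in>\<R>. f W p = 0)) \<longleftrightarrow> (\<forall>g\<in>E. g W = 0)"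
    using insert.IH[of "d * d" \<R>] by blast
  have \<F>\<G>: "\<exists>G. (f, G) \<in> \<G>" if f: "f \<in> \<F>" for f
  proof -
    obtain G where "\<forall>j\<le>d. (d - j, G j) \<in> forms R S" "f = (\<lambda>W p. \<Sum>j\<le>d. G j W p * p s ^ j)"
      using forms_decompose[OF insert.prems(2)[OF f]] by blast
    then show ?thesis using f by (intro exI[of _ G] \<G>_I) auto
  qed
  define L where "L W p = {form_poly d G W p | f G. (f, G) \<in> \<G>}" for W p
  have lin: "a + Polynomial.smult c b \<in> L W p" if ab: "a \<in> L W p" "b \<in> L W p" for a b c W p
  proof -
    obtain f F g G where fF: "(f, F) \<in> \<G>" "a = form_poly d F W p"
      and gG: "(g, G) \<in> \<G>" "b = form_poly d G W p" using ab unfolding L_def by auto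
    let ?H = "\<lambda>j W p. F j W p + c * G j W p"
    have "(\<lambda>W p. f W p + c * g W p, ?H) \<in> \<G>"
    proof -
      have "(\<lambda>W p. f W p + c * g W p) = (\<lambda>W p. \<Sum>j\<le>d. ?H j W p * p s ^ j)"
        unfolding \<G>_eq[OF fF(1)] \<G>_eq[OF gG(1)]
        by (simp add: sum.distrib distrib_right sum_distrib_left mult.assoc)
      then show ?thesis
        using \<G>_van[OF fF(1)] \<G>_van[OF gG(1)]
        by (intro \<G>_I forms.add forms_scale \<G>_coeff[OF fF(1)] \<G>_coeff[OF gG(1)]) auto
    qed
    moreover have "a + Polynomial.smult c b = form_poly d ?H W p"
      by (rule poly_eqI) (auto simp: fF gG coeff_form_poly)
    ultimately show ?thesis unfolding L_def by auto
  qed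
  have res: "(\<forall>r\<in>\<R>. r W p = 0) \<longleftrightarrow>
      (\<exists>u. \<forall>f\<in>L W p. poly f u = 0) \<or> (\<forall>f\<in>L W p. coeff f d = 0)" for W p
  proof -
    have "(\<forall>r\<in>\<R>. r W p = 0) \<longleftrightarrow> (\<forall>f\<in>L W p. \<forall>g\<in>L W p. det (sylvester_mat_sub d d f g) = 0)"
      unfolding \<R>_def Res_def L_def by force
    also have "\<dots> \<longleftrightarrow> (\<exists>u. \<forall>f\<in>L W p. poly f u = 0) \<or> (\<forall>f\<in>L W p. coeff f d = 0)"
      using insert.prems(1) lin by (intro linear_system_common_zero_iff) (auto simp: L_def degree_form_poly)
    finally show ?thesis .
  qed
  have val: "poly (form_poly d G W p) u = f W (p(s := u))" if "(f, G) \<in> \<G>" for f G W p u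
  proof -
    have "G j W p = G j W (p(s := u))" if "j \<le> d" for j
      using insert.hyps(3) by (intro forms_cong_vars[OF \<G>_coeff[OF \<open>(f, G) \<in> \<G>\<close> that]]) auto
    then show ?thesis unfolding poly_form_poly \<G>_eq[OF that] by (intro sum.cong) auto
  qed
  have lead: "coeff (form_poly d G W p) d = f W (\<lambda>t. if t = s then 1 else 0)" if fG: "(f, G) \<in> \<G>" for f G W p
  proof -
    let ?e = "\<lambda>t. if t = s then 1 else (0::complex)"
    have G: "(d - j, G j) \<in> forms R S" if "j \<le> d" for j using \<G>_coeff[OF fG that] .
    have "G j W ?e = 0" if "j < d" for j
    proof -
      have "G j W ?e = G j W (\<lambda>t. 0 * ?e t)" 
        using insert.hyps(3) that by (intro forms_cong_vars[OF G]) auto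
      also have "\<dots> = 0" using forms_homogeneous[OF G, of j W 0 ?e] that by simp
      finally show ?thesis .
    qed
    then have "f W ?e = (\<Sum>j\<le>d. if j = d then G d W ?e else 0)"
      unfolding \<G>_eq[OF fG] by (intro sum.cong) auto
    also have "\<dots> = G d W ?e" by simp
    also have "\<dots> = G d W p"
      using forms_homogeneous[OF G[of d], of W 0 p] forms_homogeneous[OF G[of d], of W 0 ?e] by simp
    finally show ?thesis by (simp add: coeff_form_poly)
  qed
  have "(\<exists>p. (\<exists>t\<in>insert s S. p t \<noteq> 0) \<and> (\<forall>f\<in>\<F>. f W p = 0)) \<longleftrightarrow>
      (\<exists>p. (\<exists>t\<in>S. p t \<noteq> 0) \<and> (\<forall>r\<in>\<R>. r W p = 0))" for W
  proof
    assume "\<exists>p. (\<exists>t\<in>insert s S. p t \<noteq> 0) \<and> (\<forall>f\<in>\<F>. f W p = 0)"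
    then obtain p where p: "\<exists>t\<in>insert s S. p t \<noteq> 0" "\<And>f. f \<in> \<F> \<Longrightarrow> f W p = 0" by blast
    have p\<G>: "f W p = 0" if "(f, G) \<in> \<G>" for f G using \<G>_van[OF that] p(2) by auto
    show "\<exists>p. (\<exists>t\<in>S. p t \<noteq> 0) \<and> (\<forall>r\<in>\<R>. r W p = 0)"
    proof (cases "\<exists>t\<in>S. p t \<noteq> 0")
      case True
      have "\<forall>f\<in>L W p. poly f (p s) = 0" unfolding L_def using val p\<G> by fastforce
      then show ?thesis using True res by blast
    next
      case False
      then have ps: "p s \<noteq> 0" using p(1) by auto
      let ?e = "\<lambda>t. if t = s then 1 else (0::complex)"
      have "f W ?e = 0" if fG: "(f, G) \<in> \<G>" for f G
      proof -
        have "(d, f) \<in> forms R (insert s S)"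
        proof -
          have "(d, \<lambda>W p. G j W p * p s ^ j) \<in> forms R (insert s S)" if j: "j \<le> d" for j
          proof -
            have mono: "(k, h) \<in> forms R (insert s S)" if "(k, h) \<in> forms R S" for k h
              using that
            proof (induction rule: forms.induct)
              case (var t)
              then show ?case by (intro forms.var) simp
            qed (blast intro: forms.intros)+
            have "(j, \<lambda>W p. p s ^ j) \<in> forms R (insert s S)"
              using forms_prod[of "{..<j}" "\<lambda>_. 1" "\<lambda>_ _ p. p s" "insert s S"] forms.var[of s "insert s S" R]
              by simp
            moreover have "(d - j, G j) \<in> forms R S" by (rule \<G>_coeff[OF fG j])
            ultimately have "(d - j + j, \<lambda>W p. G j W p * p s ^ j) \<in> forms R (insert s S)"
              using mono by (intro forms.mult)
            then show ?thesis using j by simp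
          qed
          then show ?thesis unfolding \<G>_eq[OF fG] by (intro forms_sum) auto
        qed
        note ff = this
        have "f W p = f W (\<lambda>t. p s * ?e t)"
          using False by (intro forms_cong_vars[OF ff]) auto
        also have "\<dots> = p s ^ d * f W ?e" by (rule forms_homogeneous[OF ff])
        finally show ?thesis using p\<G>[OF fG] ps by simp
      qed
      then have "\<forall>f\<in>L W q. coeff f d = 0" for q unfolding L_def using lead by fastforce
      then have "\<forall>r\<in>\<R>. r W (\<lambda>_. 1) = 0" using res by blast
      then show ?thesis using insert.hyps(2) by (intro exI[of _ "\<lambda>_. 1"]) auto
    qed
  next
    assume "\<exists>p. (\<exists>t\<in>S. p t \<noteq> 0) \<and> (\<forall>r\<in>\<R>. r W p = 0)"
    then obtain p where p: "\<exists>t\<in>S. p t \<noteq> 0" "\<forall>r\<in>\<R>. r W p = 0" by blast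
    from p(2) consider u where "\<forall>f\<in>L W p. poly f u = 0" | "\<forall>f\<in>L W p. coeff f d = 0" using res by blast
    then show "\<exists>p. (\<exists>t\<in>insert s S. p t \<noteq> 0) \<and> (\<forall>f\<in>\<F>. f W p = 0)"
    proof cases
      case 1
      then have "f W (p(s := u)) = 0" if "f \<in> \<F>" for f
        using \<F>\<G>[OF that] val unfolding L_def by fastforce
      moreover have "\<exists>t\<in>insert s S. (p(s := u)) t \<noteq> 0" using p(1) insert.hyps(3) by force
      ultimately show ?thesis by blast
    next
      case 2
      then have "f W (\<lambda>t. if t = s then 1 else 0) = 0" if "f \<in> \<F>" for f
        using \<F>\<G>[OF that] lead unfolding L_def by fastforce
      then show ?thesis by (intro exI[of _ "\<lambda>t. if t = s then 1 else 0"]) auto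
    qed
  qed
  then have "\<forall>W. (\<exists>p. (\<exists>t\<in>insert s S. p t \<noteq> 0) \<and> (\<forall>f\<in>\<F>. f W p = 0)) \<longleftrightarrow> (\<forall>g\<in>E. g W = 0)"
    using E(2) by (intro allI) (erule meta_allE, simp)
  then show ?case by (intro exI[of _ E] conjI E(1))
qed

end

section \<open>Subspaces of coordinate space\<close>

abbreviation vsub :: "nat \<Rightarrow> complex Matrix.vec set \<Rightarrow> bool" where
  "vsub n U \<equiv> VectorSpace.subspace class_ring U (module_vec TYPE(complex) n)"

definition sdim :: "nat \<Rightarrow> complex Matrix.vec set \<Rightarrow> nat" where
  "sdim n U = vectorspace.dim class_ring ((module_vec TYPE(complex) n)\<lparr>carrier := U\<rparr>)"

lemma vec_vs: "vectorspace class_ring (module_vec TYPE(complex) n)"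
proof -
  interpret vec_space "TYPE(complex)" n .
  show ?thesis by (rule vectorspace_axioms)
qed

lemma vec_module: "Module.module class_ring (module_vec TYPE(complex) n)"
  using vec_vs unfolding vectorspace_def by auto

lemma vsub_iff:
  "vsub n U \<longleftrightarrow> U \<subseteq> carrier_vec n \<and> 0\<^sub>v n \<in> U \<and> (\<forall>v\<in>U. \<forall>w\<in>U. v + w \<in> U) \<and>
    (\<forall>c. \<forall>v\<in>U. c \<cdot>\<^sub>v v \<in> U)"
  unfolding VectorSpace.subspace_def submodule_def
  using vec_vs vec_module by (auto simp: module_vec_simps class_ring_simps)

lemma vsubI:
  assumes "U \<subseteq> carrier_vec n" "0\<^sub>v n \<in> U" "\<And>v w. v \<in> U \<Longrightarrow> w \<in> U \<Longrightarrow> v + w \<in> U"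
    "\<And>c v. v \<in> U \<Longrightarrow> c \<cdot>\<^sub>v v \<in> U"
  shows "vsub n U"
  using assms unfolding vsub_iff by auto

lemma vsubD:
  assumes "vsub n U"
  shows "v \<in> U \<Longrightarrow> v \<in> carrier_vec n" "0\<^sub>v n \<in> U" "v \<in> U \<Longrightarrow> w \<in> U \<Longrightarrow> v + w \<in> U"
    "v \<in> U \<Longrightarrow> c \<cdot>\<^sub>v v \<in> U" "v \<in> U \<Longrightarrow> w \<in> U \<Longrightarrow> v - w \<in> U"
proof -
  assume vw: "v \<in> U" "w \<in> U"
  have "v - w = v + (-1) \<cdot>\<^sub>v w" using vw assms unfolding vsub_iff by (intro eq_vecI) auto
  then show "v - w \<in> U" using vw assms unfolding vsub_iff by metis
qed (use assms in \<open>auto simp: vsub_iff\<close>)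

lemma vsub_carrier: "vsub n (carrier_vec n)" by (rule vsubI) auto

lemma vsub_zero: "vsub n {0\<^sub>v n}" by (rule vsubI) auto

lemma vsub_lincomb:
  assumes U: "vsub n U" and "finite J" "\<And>j. j \<in> J \<Longrightarrow> u j \<in> U"
  shows "Matrix.vec n (\<lambda>i. \<Sum>j\<in>J. c j * vec_index (u j) i) \<in> U"
  using assms(2,3)
proof (induction J rule: finite_induct)
  case empty
  have "Matrix.vec n (\<lambda>i. 0) = (0\<^sub>v n :: complex Matrix.vec)" by auto
  then show ?case using vsubD(2)[OF U] by simp
next
  case (insert j J)
  have u: "u j \<in> U" "u j \<in> carrier_vec n" using insert vsubD(1)[OF U] by auto
  have "Matrix.vec n (\<lambda>i. \<Sum>j\<in>insert j J. c j * vec_index (u j) i)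
     = c j \<cdot>\<^sub>v u j + Matrix.vec n (\<lambda>i. \<Sum>j\<in>J. c j * vec_index (u j) i)"
    using insert u by (intro eq_vecI) auto
  then show ?case using insert u vsubD(3,4)[OF U] by auto
qed

lemma mult_mat_vec_index:
  assumes "A \<in> carrier_mat m n" "v \<in> carrier_vec n" "i < m"
  shows "vec_index (A *\<^sub>v v) i = (\<Sum>j<n. A $$ (i, j) * vec_index v j)"
  using assms by (auto simp: scalar_prod_def lessThan_atLeast0 intro!: sum.cong)

text \<open>
  Passage to the abstract vector spaces, so that their rank-nullity theorem becomes available.
\<close>
lemma linear_map_mult_mat_vec:
  assumes A: "A \<in> carrier_mat m n" and U: "vsub n U" and U': "vsub m U'"
    and maps: "\<And>v. v \<in> U \<Longrightarrow> A *\<^sub>v v \<in> U'"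
  shows "linear_map class_ring ((module_vec TYPE(complex) n)\<lparr>carrier := U\<rparr>)
    ((module_vec TYPE(complex) m)\<lparr>carrier := U'\<rparr>) ((*\<^sub>v) A)"
proof -
  have V: "vectorspace class_ring ((module_vec TYPE(complex) n)\<lparr>carrier := U\<rparr>)"
    using vectorspace.subspace_is_vs[OF vec_vs U] .
  have W: "vectorspace class_ring ((module_vec TYPE(complex) m)\<lparr>carrier := U'\<rparr>)"
    using vectorspace.subspace_is_vs[OF vec_vs U'] .
  show ?thesis
    unfolding linear_map_def mod_hom_def mod_hom_axioms_def
    using V W maps vsubD(1)[OF U] A
    by (auto simp: vectorspace_def module_hom_def module_vec_simps class_ring_simps
        mult_add_distrib_mat_vec[OF A] mult_mat_vec[OF A])
qed

text \<open>
  A reduced echelon basis: the coordinates in \<open>J\<close> restrict to coordinates on \<open>U\<close>, and \<open>u\<close> is the dual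
  basis.
\<close>
definition echelon :: "nat \<Rightarrow> complex Matrix.vec set \<Rightarrow> nat set \<Rightarrow> (nat \<Rightarrow> complex Matrix.vec) \<Rightarrow> bool" where
  "echelon n U J u \<longleftrightarrow> J \<subseteq> {..<n} \<and>
     (\<forall>j\<in>J. u j \<in> U \<and> (\<forall>i\<in>J. vec_index (u j) i = (if i = j then 1 else 0))) \<and>
     (\<forall>v\<in>U. (\<forall>j\<in>J. vec_index v j = 0) \<longrightarrow> v = 0\<^sub>v n)"

text \<open>
  Take a smallest set of coordinates that is still injective on \<open>U\<close>. Dropping \<open>j\<close> destroys
  injectivity, which yields a vector of \<open>U\<close> that is zero in all coordinates of \<open>J\<close> except \<open>j\<close>.
\<close>
lemma echelon_exists:
  assumes U: "vsub n U"
  shows "\<exists>J u. echelon n U J u"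
proof -
  define inj where "inj J \<longleftrightarrow> J \<subseteq> {..<n} \<and> (\<forall>v\<in>U. (\<forall>j\<in>J. vec_index v j = 0) \<longrightarrow> v = 0\<^sub>v n)" for J
  have "inj {..<n}" unfolding inj_def using vsubD(1)[OF U] by (auto intro!: eq_vecI)
  then obtain J where J: "inj J" and min: "\<And>J'. inj J' \<Longrightarrow> card J \<le> card J'"
    using ex_has_least_nat[of inj "{..<n}" card] by auto
  have fin: "finite J" using J finite_subset unfolding inj_def by blast
  have "\<exists>v\<in>U. \<forall>i\<in>J. vec_index v i = (if i = j then 1 else 0)" if j: "j \<in> J" for j
  proof -
    have "\<not> inj (J - {j})" using min[of "J - {j}"] card_Diff1_less[OF fin j] by auto
    then obtain v where v: "v \<in> U" "\<forall>i\<in>J - {j}. vec_index v i = 0" "v \<noteq> 0\<^sub>v n"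
      using J unfolding inj_def by auto
    then have vj: "vec_index v j \<noteq> 0" using J unfolding inj_def by (metis DiffI singletonD)
    have "j < n" using J j unfolding inj_def by auto
    have "\<forall>i\<in>J. vec_index ((1 / vec_index v j) \<cdot>\<^sub>v v) i = (if i = j then 1 else 0)"
      using v vj J vsubD(1)[OF U v(1)] unfolding inj_def by auto
    then show ?thesis using vsubD(4)[OF U v(1)] by blast
  qed
  then obtain u where "\<forall>j\<in>J. u j \<in> U \<and> (\<forall>i\<in>J. vec_index (u j) i = (if i = j then 1 else 0))"
    by metis
  then show ?thesis using J unfolding echelon_def inj_def by blast
qed

lemma echelon_expand:
  assumes U: "vsub n U" and ech: "echelon n U J u" and v: "v \<in> U"
  shows "v = Matrix.vec n (\<lambda>i. \<Sum>j\<in>J. vec_index v j * vec_index (u j) i)" (is "v = ?w")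
proof -
  have fin: "finite J" using ech finite_subset unfolding echelon_def by blast
  have w: "?w \<in> U" using ech by (intro vsub_lincomb[OF U fin]) (auto simp: echelon_def)
  have vc: "v \<in> carrier_vec n" using vsubD(1)[OF U v] .
  have "vec_index (v - ?w) i = 0" if i: "i \<in> J" for i
  proof -
    have "i < n" using ech i unfolding echelon_def by auto
    have "(\<Sum>j\<in>J. vec_index v j * vec_index (u j) i) = (\<Sum>j\<in>J. if j = i then vec_index v i else 0)"
      using ech i by (intro sum.cong) (auto simp: echelon_def)
    also have "\<dots> = vec_index v i" using fin i by simp
    finally show ?thesis using \<open>i < n\<close> vc by simp
  qed
  then have "v - ?w = 0\<^sub>v n" using ech vsubD(5)[OF U v w] unfolding echelon_def by blast
  then have "vec_index (v - ?w) i = 0" if "i < n" for i using that by simp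
  then show ?thesis using vc by (intro eq_vecI) (auto simp: )
qed

lemma
  assumes U: "vsub n U" and ech: "echelon n U J u"
  shows sdim_echelon: "sdim n U = card J"
    and fin_dim_vsub: "vectorspace.fin_dim class_ring ((module_vec TYPE(complex) n)\<lparr>carrier := U\<rparr>)"
proof -
  have fin: "finite J" using ech finite_subset unfolding echelon_def by blast
  obtain b where b: "bij_betw b {..<card J} J"
    using ex_bij_betw_nat_finite[OF fin] by (auto simp: lessThan_atLeast0)
  define k where "k = card J"
  define B where "B = Matrix.mat n k (\<lambda>(i, l). vec_index (u (b l)) i)"
  have B: "B \<in> carrier_mat n k" unfolding B_def by auto
  have bJ: "b l \<in> J" if "l < k" for l using b that unfolding k_def bij_betw_def by auto
  have binj: "b l = b l' \<Longrightarrow> l < k \<Longrightarrow> l' < k \<Longrightarrow> l = l'" for l l'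
    using b unfolding k_def bij_betw_def inj_on_def by auto
  have Bw: "B *\<^sub>v w = Matrix.vec n (\<lambda>i. \<Sum>l<k. vec_index w l * vec_index (u (b l)) i)"
    if "w \<in> carrier_vec k" for w
    using that B by (intro eq_vecI)
      (auto simp: B_def scalar_prod_def lessThan_atLeast0 mult.commute intro!: sum.cong)
  have maps: "B *\<^sub>v w \<in> U" if "w \<in> carrier_vec k" for w
    unfolding Bw[OF that] using bJ ech by (intro vsub_lincomb[OF U]) (auto simp: echelon_def)
  have coord: "vec_index (B *\<^sub>v w) (b l) = vec_index w l" if "w \<in> carrier_vec k" "l < k" for w l
  proof -
    have "b l < n" using bJ[OF that(2)] ech unfolding echelon_def by auto
    then have "vec_index (B *\<^sub>v w) (b l) = (\<Sum>l'<k. vec_index w l' * vec_index (u (b l')) (b l))"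
      unfolding Bw[OF that(1)] by simp
    also have "\<dots> = (\<Sum>l'<k. if l' = l then vec_index w l else 0)"
      using ech bJ that(2) binj by (intro sum.cong) (auto simp: echelon_def)
    finally show ?thesis using that by simp
  qed
  interpret L: linear_map class_ring "(module_vec TYPE(complex) k)\<lparr>carrier := carrier_vec k\<rparr>"
    "(module_vec TYPE(complex) n)\<lparr>carrier := U\<rparr>" "(*\<^sub>v) B"
    using linear_map_mult_mat_vec[OF B vsub_carrier U maps] .
  have full: "(module_vec TYPE(complex) k)\<lparr>carrier := carrier_vec k\<rparr> = module_vec TYPE(complex) k"
    unfolding module_vec_def by simp
  have k: "L.V.dim = k" "L.V.fin_dim"
    unfolding full using vec_space.dim_is_n[where n = k] vec_space.fin_dim[where n = k] by auto
  have "v \<in> (*\<^sub>v) B ` carrier_vec k" if v: "v \<in> U" for v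
  proof
    let ?w = "Matrix.vec k (\<lambda>l. vec_index v (b l))"
    show "?w \<in> carrier_vec k" by auto
    have "v = Matrix.vec n (\<lambda>i. \<Sum>j\<in>J. vec_index v j * vec_index (u j) i)"
      by (rule echelon_expand[OF U ech v])
    also have "\<dots> = B *\<^sub>v ?w"
      unfolding Bw[OF \<open>?w \<in> carrier_vec k\<close>]
      using sum.reindex_bij_betw[OF b, of "\<lambda>j. vec_index v j * vec_index (u j) _"]
      by (intro eq_vecI) (auto simp: k_def)
    finally show "v = B *\<^sub>v ?w" .
  qed
  then have surj: "(*\<^sub>v) B ` carrier ((module_vec TYPE(complex) k)\<lparr>carrier := carrier_vec k\<rparr>) =
      carrier ((module_vec TYPE(complex) n)\<lparr>carrier := U\<rparr>)"
    using maps by auto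
  have "inj_on ((*\<^sub>v) B) (carrier_vec k)"
  proof (rule inj_onI)
    fix w w' assume w: "w \<in> carrier_vec k" "w' \<in> carrier_vec k" "B *\<^sub>v w = B *\<^sub>v w'"
    then show "w = w'" using coord by (intro eq_vecI) (auto, metis)
  qed
  then have inj: "inj_on ((*\<^sub>v) B) (carrier ((module_vec TYPE(complex) k)\<lparr>carrier := carrier_vec k\<rparr>))" by simp
  show "sdim n U = card J" using L.dim_eq[OF k(2) inj surj] k(1) unfolding sdim_def k_def by simp
  show "L.W.fin_dim" using L.rank_nullity_main(2)[OF k(2) surj] .
qed

lemma sdim_le: "vsub n U \<Longrightarrow> sdim n U \<le> n"
proof -
  assume U: "vsub n U"
  then obtain J u where ech: "echelon n U J u" using echelon_exists by blast
  then have "J \<subseteq> {..<n}" unfolding echelon_def by auto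
  then show ?thesis using sdim_echelon[OF U ech] card_mono[of "{..<n}" J] by simp
qed

lemma sdim_carrier: "sdim n (carrier_vec n) = n"
proof -
  have "echelon n (carrier_vec n) {..<n} (unit_vec n)"
    unfolding echelon_def by (auto intro!: eq_vecI simp: unit_vec_def)
  from sdim_echelon[OF vsub_carrier this] show ?thesis by simp
qed

lemma sdim_zero: "sdim n {0\<^sub>v n} = 0"
proof -
  have "echelon n {0\<^sub>v n} {} (\<lambda>_. 0\<^sub>v n)" unfolding echelon_def by auto
  from sdim_echelon[OF vsub_zero this] show ?thesis by simp
qed

lemma sdim_eq_0D:
  assumes U: "vsub n U" and "sdim n U = 0"
  shows "U = {0\<^sub>v n}"
proof -
  obtain J u where J: "echelon n U J u" using echelon_exists[OF U] by blast
  then have "finite J" using finite_subset unfolding echelon_def by blast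
  then have "J = {}" using sdim_echelon[OF U J] assms by auto
  then have "v = 0\<^sub>v n" if "v \<in> U" for v using J that unfolding echelon_def by blast
  then show ?thesis using vsubD(2)[OF U] by blast
qed

lemma vsub_image:
  assumes A: "A \<in> carrier_mat m n" and U: "vsub n U"
  shows "vsub m ((*\<^sub>v) A ` U)"
proof (rule vsubI)
  show "0\<^sub>v m \<in> (*\<^sub>v) A ` U"
    using vsubD(2)[OF U] A by (intro image_eqI[of _ _ "0\<^sub>v n"]) auto
  show "v + w \<in> (*\<^sub>v) A ` U" if vw: "v \<in> (*\<^sub>v) A ` U" "w \<in> (*\<^sub>v) A ` U" for v w
  proof -
    obtain v' w' where "v' \<in> U" "w' \<in> U" "v = A *\<^sub>v v'" "w = A *\<^sub>v w'" using vw by auto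
    then show ?thesis using vsubD[OF U] A
      by (intro image_eqI[of _ _ "v' + w'"]) (auto simp: mult_add_distrib_mat_vec[OF A])
  qed
  show "c \<cdot>\<^sub>v v \<in> (*\<^sub>v) A ` U" if v: "v \<in> (*\<^sub>v) A ` U" for c v
  proof -
    obtain v' where "v' \<in> U" "v = A *\<^sub>v v'" using v by auto
    then show ?thesis using vsubD[OF U] A
      by (intro image_eqI[of _ _ "c \<cdot>\<^sub>v v'"]) (auto simp: mult_mat_vec[OF A])
  qed
qed (use vsubD(1)[OF U] A in auto)

lemma vsub_kernel:
  assumes A: "A \<in> carrier_mat m n" and U: "vsub n U"
  shows "vsub n {v \<in> U. A *\<^sub>v v = 0\<^sub>v m}"
  using vsubD[OF U] A by (intro vsubI) (auto simp: mult_add_distrib_mat_vec[OF A] mult_mat_vec[OF A])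

lemma rank_nullity:
  assumes A: "A \<in> carrier_mat m n" and U: "vsub n U"
  shows "sdim n U = sdim m ((*\<^sub>v) A ` U) + sdim n {v \<in> U. A *\<^sub>v v = 0\<^sub>v m}"
proof -
  have maps: "A *\<^sub>v v \<in> carrier_vec m" if "v \<in> U" for v
    using vsubD(1)[OF U that] A by auto
  interpret L: linear_map class_ring "(module_vec TYPE(complex) n)\<lparr>carrier := U\<rparr>"
    "(module_vec TYPE(complex) m)\<lparr>carrier := carrier_vec m\<rparr>" "(*\<^sub>v) A"
    using linear_map_mult_mat_vec[OF A U vsub_carrier maps] by simp
  have im: "L.imT = (*\<^sub>v) A ` U" unfolding L.im_def by simp
  have ker: "L.kerT = {v \<in> U. A *\<^sub>v v = 0\<^sub>v m}" unfolding L.ker_def by (auto simp: module_vec_simps)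
  obtain J u where "echelon n U J u" using echelon_exists[OF U] by blast
  from L.rank_nullity_main(1)[OF fin_dim_vsub[OF U this]] show ?thesis
    unfolding im ker sdim_def by simp
qed

definition projection :: "nat \<Rightarrow> complex mat \<Rightarrow> complex Matrix.vec set \<Rightarrow> bool" where
  "projection n e U \<longleftrightarrow> e \<in> carrier_mat n n \<and> (\<forall>v\<in>carrier_vec n. e *\<^sub>v v \<in> U) \<and> (\<forall>v\<in>U. e *\<^sub>v v = v)"

lemma projection_exists:
  assumes U: "vsub n U"
  shows "\<exists>e. projection n e U"
proof -
  obtain J u where ech: "echelon n U J u" using echelon_exists[OF U] by blast
  have J: "J \<subseteq> {..<n}" and fin: "finite J" using ech finite_subset unfolding echelon_def by blast+
  define e where "e = Matrix.mat n n (\<lambda>(i, j). if j \<in> J then vec_index (u j) i else 0)"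
  have ev: "e *\<^sub>v v = Matrix.vec n (\<lambda>i. \<Sum>j\<in>J. vec_index v j * vec_index (u j) i)"
    if v: "v \<in> carrier_vec n" for v
  proof (rule eq_vecI)
    fix i assume "i < dim_vec (Matrix.vec n (\<lambda>i. \<Sum>j\<in>J. vec_index v j * vec_index (u j) i))"
    then have i: "i < n" by simp
    have "vec_index (e *\<^sub>v v) i = (\<Sum>j<n. e $$ (i, j) * vec_index v j)"
      using i v by (intro mult_mat_vec_index) (auto simp: e_def)
    also have "\<dots> = (\<Sum>j\<in>J. vec_index v j * vec_index (u j) i)"
      using J i by (intro sum.mono_neutral_cong_right) (auto simp: e_def)
    finally show "vec_index (e *\<^sub>v v) i
        = vec_index (Matrix.vec n (\<lambda>i. \<Sum>j\<in>J. vec_index v j * vec_index (u j) i)) i"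
      using i by simp
  qed (auto simp: e_def)
  have "e *\<^sub>v v \<in> U" if "v \<in> carrier_vec n" for v
    unfolding ev[OF that] using ech by (intro vsub_lincomb[OF U fin]) (auto simp: echelon_def)
  moreover have "e *\<^sub>v v = v" if "v \<in> U" for v
    using ev[OF vsubD(1)[OF U that]] echelon_expand[OF U ech that] by simp
  moreover have "e \<in> carrier_mat n n" unfolding e_def by auto
  ultimately show ?thesis unfolding projection_def by blast
qed

text \<open>
  Rank-nullity for a projection onto \<open>U\<close>, restricted to \<open>U'\<close>.
\<close>
lemma sdim_subset:
  assumes U: "vsub n U" and U': "vsub n U'" and sub: "U \<subseteq> U'"
  shows "sdim n U \<le> sdim n U'" and "sdim n U' \<le> sdim n U \<Longrightarrow> U = U'"
proof -
  obtain e where e: "projection n e U" using projection_exists[OF U] by blast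
  then have ec: "e \<in> carrier_mat n n" unfolding projection_def by auto
  let ?K = "{v \<in> U'. e *\<^sub>v v = 0\<^sub>v n}"
  have K: "vsub n ?K" by (rule vsub_kernel[OF ec U'])
  have im: "(*\<^sub>v) e ` U' = U"
  proof
    show "(*\<^sub>v) e ` U' \<subseteq> U" using e vsubD(1)[OF U'] unfolding projection_def by auto
    show "U \<subseteq> (*\<^sub>v) e ` U'"
    proof
      fix v assume "v \<in> U"
      then show "v \<in> (*\<^sub>v) e ` U'" using e sub unfolding projection_def by (intro image_eqI[of _ _ v]) auto
    qed
  qed
  then have eq: "sdim n U' = sdim n U + sdim n ?K" using rank_nullity[OF ec U'] by simp
  then show "sdim n U \<le> sdim n U'" by simp
  assume "sdim n U' \<le> sdim n U"
  then have K0: "?K = {0\<^sub>v n}" using eq by (intro sdim_eq_0D[OF K]) simp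
  have "v \<in> U" if v: "v \<in> U'" for v
  proof -
    have vc: "v \<in> carrier_vec n" using vsubD(1)[OF U' v] .
    have evU: "e *\<^sub>v v \<in> U" "e *\<^sub>v (e *\<^sub>v v) = e *\<^sub>v v" using e vc unfolding projection_def by auto
    have "v - e *\<^sub>v v \<in> ?K"
      using evU v sub vsubD(5)[OF U' v, of "e *\<^sub>v v"] mult_minus_distrib_mat_vec[OF ec vc, of "e *\<^sub>v v"]
        vsubD(1)[OF U evU(1)] ec vc by auto
    then have z: "v - e *\<^sub>v v = 0\<^sub>v n" using K0 by auto
    have "v = e *\<^sub>v v"
    proof (rule eq_vecI)
      fix i assume "i < dim_vec (e *\<^sub>v v)"
      then have i: "i < n" using ec by simp
      have "vec_index (v - e *\<^sub>v v) i = 0" using z i by simp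
      then show "vec_index v i = vec_index (e *\<^sub>v v) i" using i vc ec by simp
    qed (use vc ec in auto)
    then show ?thesis using evU(1) by simp
  qed
  then show "U = U'" using sub by auto
qed

section \<open>Subrepresentations and flips\<close>

lemma mat_eq_iff_mult_vec:
  fixes A B :: "complex mat"
  assumes A: "A \<in> carrier_mat m n" and B: "B \<in> carrier_mat m n"
    and eq: "\<And>v. v \<in> carrier_vec n \<Longrightarrow> A *\<^sub>v v = B *\<^sub>v v"
  shows "A = B"
proof (rule eq_matI)
  fix i j assume "i < dim_row B" "j < dim_col B"
  then have ij: "i < m" "j < n" using B by auto
  have "A *\<^sub>v unit_vec n j = col A j" "B *\<^sub>v unit_vec n j = col B j"
    using A B ij by (auto intro!: eq_vecI)
  then have "col A j = col B j" using eq[of "unit_vec n j"] by auto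
  then have "vec_index (col A j) i = vec_index (col B j) i" by simp
  then show "A $$ (i, j) = B $$ (i, j)" using A B ij by simp
qed (use A B in auto)

lemma mult_mat_zero_vec:
  fixes A :: "complex mat"
  shows "A \<in> carrier_mat m n \<Longrightarrow> A *\<^sub>v 0\<^sub>v n = 0\<^sub>v m"
  by (intro eq_vecI) auto

lemma add_diff_vec:
  fixes x y :: "complex Matrix.vec"
  shows "x \<in> carrier_vec n \<Longrightarrow> y \<in> carrier_vec n \<Longrightarrow> x + (y - x) = y"
  by (intro eq_vecI) auto

lemma add_vec_cancel:
  fixes x y z w :: "complex Matrix.vec"
  assumes "x \<in> carrier_vec n" "y \<in> carrier_vec n" "z \<in> carrier_vec n" "w \<in> carrier_vec n"
    and eq: "x + y + z = x + w"
  shows "z + y = w"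
proof (rule eq_vecI)
  fix i assume "i < dim_vec w"
  then have i: "i < n" using assms by simp
  have "vec_index (x + y + z) i = vec_index (x + w) i" using eq by simp
  then show "vec_index (z + y) i = vec_index w i" using i assms(1-4) by (simp add: add.commute)
qed (use assms in auto)

locale quiver =
  fixes Q :: "('v::finite, 'a) pre_digraph" and \<beta> :: "'v \<Rightarrow> nat"
  assumes verts: "verts Q = UNIV"
begin

abbreviation tgt :: "'a \<Rightarrow> 'v" where "tgt a \<equiv> head Q a"
abbreviation src :: "'a \<Rightarrow> 'v" where "src a \<equiv> tail Q a"

definition dims :: "('a \<Rightarrow> complex mat) \<Rightarrow> ('v \<Rightarrow> nat) set" where
  "dims W = {subrep_dim \<beta> U | U. subrep Q \<beta> W U}"

lemma subrep_iff: "subrep Q \<beta> W U \<longleftrightarrow> (\<forall>x. vsub (\<beta> x) (U x)) \<and>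
    (\<forall>a\<in>arcs Q. \<forall>u\<in>U (src a). W a *\<^sub>v u \<in> U (tgt a))"
  unfolding subrep_def verts by simp

lemma subrepI:
  assumes "\<And>x. vsub (\<beta> x) (U x)" "\<And>a u. a \<in> arcs Q \<Longrightarrow> u \<in> U (src a) \<Longrightarrow> W a *\<^sub>v u \<in> U (tgt a)"
  shows "subrep Q \<beta> W U"
  using assms unfolding subrep_iff by auto

lemma subrepD:
  assumes "subrep Q \<beta> W U"
  shows "vsub (\<beta> x) (U x)" "a \<in> arcs Q \<Longrightarrow> u \<in> U (src a) \<Longrightarrow> W a *\<^sub>v u \<in> U (tgt a)"
  using assms unfolding subrep_iff by auto

lemma subrep_dim_eq: "subrep_dim \<beta> U x = sdim (\<beta> x) (U x)"
  unfolding subrep_dim_def sdim_def by simp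

lemma dimsI: "subrep Q \<beta> W U \<Longrightarrow> (\<lambda>x. sdim (\<beta> x) (U x)) \<in> dims W"
  unfolding dims_def by (auto intro!: exI[of _ U] simp: subrep_dim_eq fun_eq_iff)

lemma dimsE:
  assumes "d \<in> dims W"
  obtains U where "subrep Q \<beta> W U" "d = (\<lambda>x. sdim (\<beta> x) (U x))"
  using assms unfolding dims_def by (auto simp: subrep_dim_eq fun_eq_iff)

lemma dims_le: "d \<in> dims W \<Longrightarrow> d x \<le> \<beta> x"
  using sdim_le subrepD(1) by (auto elim!: dimsE)

lemma finite_bounded: "finite {d :: 'v \<Rightarrow> nat. \<forall>x. d x \<le> \<beta> x}"
proof (rule finite_subset)
  show "{d :: 'v \<Rightarrow> nat. \<forall>x. d x \<le> \<beta> x} \<subseteq> PiE UNIV (\<lambda>x. {..\<beta> x})" by auto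
qed (auto intro!: finite_PiE)

lemma finite_dims: "finite (dims W)"
  by (rule finite_subset[OF _ finite_bounded]) (auto simp: dims_le)

lemma generic_sub_iff: "generic_sub Q d \<beta> \<longleftrightarrow> (\<forall>W\<in>Rep Q \<beta>. d \<in> dims W)"
proof -
  have "(\<exists>U. subrep Q \<beta> W U \<and> (\<forall>x\<in>verts Q. subrep_dim \<beta> U x = d x)) \<longleftrightarrow> d \<in> dims W" for W
  proof -
    have "(\<forall>x. subrep_dim \<beta> U x = d x) \<longleftrightarrow> d = subrep_dim \<beta> U" for U by auto
    then show ?thesis unfolding dims_def verts by auto
  qed
  then show ?thesis unfolding generic_sub_def by simp
qed

lemma RepD: "W \<in> Rep Q \<beta> \<Longrightarrow> a \<in> arcs Q \<Longrightarrow> W a \<in> carrier_mat (\<beta> (tgt a)) (\<beta> (src a))"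
  unfolding Rep_def by auto

lemma zero_in_dims: "W \<in> Rep Q \<beta> \<Longrightarrow> (\<lambda>x. 0) \<in> dims W"
proof -
  assume W: "W \<in> Rep Q \<beta>"
  have "subrep Q \<beta> W (\<lambda>x. {0\<^sub>v (\<beta> x)})"
    using mult_mat_zero_vec[OF RepD[OF W]] by (intro subrepI vsub_zero) auto
  from dimsI[OF this] show ?thesis by (simp add: sdim_zero)
qed

definition compl :: "('v \<Rightarrow> complex mat) \<Rightarrow> 'v \<Rightarrow> complex mat" where
  "compl e x = 1\<^sub>m (\<beta> x) - e x"

text \<open>
  In block form relative to \<open>\<complex>\<^sup>n = im e \<oplus> im (1 - e)\<close>, where \<open>im e\<close> is a subrepresentation of \<open>W\<close>, this keeps
  the diagonal blocks of \<open>W\<close>, deletes the block from \<open>im (1 - e)\<close> to \<open>im e\<close>, and takes the block from \<open>im e\<close> to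
  \<open>im (1 - e)\<close> from \<open>C\<close>. So \<open>im (1 - e)\<close>, a copy of the quotient, becomes a subrepresentation. Idempotents avoid a change of
  basis to standard coordinate subspaces.
\<close>
definition flip :: "('v \<Rightarrow> complex mat) \<Rightarrow> ('a \<Rightarrow> complex mat) \<Rightarrow> ('a \<Rightarrow> complex mat) \<Rightarrow> 'a \<Rightarrow> complex mat" where
  "flip e W C = (\<lambda>a\<in>arcs Q. e (tgt a) * W a * e (src a) + compl e (tgt a) * W a * compl e (src a)
      + compl e (tgt a) * C a * e (src a))"

text \<open>
  Here \<open>c\<close> is a family of maps from \<open>im e\<close> to \<open>im (1 - e)\<close>, that is, \<open>c e = c\<close> and \<open>e c = 0\<close>. The
  equation says that the class of the block of \<open>V\<close> from \<open>B\<close> to the quotient is zero in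
  \<open>Ext(B, W/B)\<close>.
\<close>
definition coboundary :: "('v \<Rightarrow> complex mat) \<Rightarrow> ('a \<Rightarrow> complex mat) \<Rightarrow> ('v \<Rightarrow> complex Matrix.vec set) \<Rightarrow>
    ('a \<Rightarrow> complex mat) \<Rightarrow> bool" where
  "coboundary e W B V \<longleftrightarrow> (\<exists>c. (\<forall>x. c x \<in> carrier_mat (\<beta> x) (\<beta> x) \<and>
      (\<forall>v\<in>carrier_vec (\<beta> x). c x *\<^sub>v (e x *\<^sub>v v) = c x *\<^sub>v v \<and> e x *\<^sub>v (c x *\<^sub>v v) = 0\<^sub>v (\<beta> x))) \<and>
    (\<forall>a\<in>arcs Q. \<forall>v\<in>B (src a). compl e (tgt a) *\<^sub>v (V a *\<^sub>v v)
        + compl e (tgt a) *\<^sub>v (W a *\<^sub>v (c (src a) *\<^sub>v v)) = c (tgt a) *\<^sub>v (W a *\<^sub>v v)))"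

end

locale flip_datum = quiver Q \<beta> for Q :: "('v::finite, 'a) pre_digraph" and \<beta> :: "'v \<Rightarrow> nat" +
  fixes W :: "'a \<Rightarrow> complex mat" and B :: "'v \<Rightarrow> complex Matrix.vec set"
    and e :: "'v \<Rightarrow> complex mat" and C :: "'a \<Rightarrow> complex mat"
  assumes W: "W \<in> Rep Q \<beta>" and B: "subrep Q \<beta> W B" and C: "C \<in> Rep Q \<beta>"
    and proj: "\<And>x. projection (\<beta> x) (e x) (B x)"
begin

abbreviation f where "f \<equiv> compl e"

abbreviation W' where "W' \<equiv> flip e W C"

abbreviation K where "K x \<equiv> {v \<in> carrier_vec (\<beta> x). e x *\<^sub>v v = 0\<^sub>v (\<beta> x)}"

lemma e_carrier [simp]: "e x \<in> carrier_mat (\<beta> x) (\<beta> x)"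
  using proj unfolding projection_def by auto

lemma f_carrier [simp]: "f x \<in> carrier_mat (\<beta> x) (\<beta> x)"
  unfolding compl_def by (rule minus_carrier_mat[OF e_carrier])

lemma e_f_dims [simp]: "dim_row (e x) = \<beta> x" "dim_col (e x) = \<beta> x" "dim_row (f x) = \<beta> x" "dim_col (f x) = \<beta> x"
  using e_carrier[of x] f_carrier[of x] by (auto simp del: e_carrier f_carrier)

lemma e_dim [simp]: "v \<in> carrier_vec (\<beta> x) \<Longrightarrow> e x *\<^sub>v v \<in> carrier_vec (\<beta> x)"
  by (rule mult_mat_vec_carrier[OF e_carrier])

lemma f_dim [simp]: "v \<in> carrier_vec (\<beta> x) \<Longrightarrow> f x *\<^sub>v v \<in> carrier_vec (\<beta> x)"
  by (rule mult_mat_vec_carrier[OF f_carrier])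

lemma e_B: "v \<in> carrier_vec (\<beta> x) \<Longrightarrow> e x *\<^sub>v v \<in> B x"
  using proj unfolding projection_def by auto

lemma e_id: "v \<in> B x \<Longrightarrow> e x *\<^sub>v v = v"
  using proj unfolding projection_def by auto

lemma B_carrier: "v \<in> B x \<Longrightarrow> v \<in> carrier_vec (\<beta> x)"
  using vsubD(1)[OF subrepD(1)[OF B]] .

lemma f_eq: "v \<in> carrier_vec (\<beta> x) \<Longrightarrow> f x *\<^sub>v v = v - e x *\<^sub>v v"
  unfolding compl_def by (subst minus_mult_distrib_mat_vec[of _ "\<beta> x" "\<beta> x"]) auto

lemma e_f_sum: "v \<in> carrier_vec (\<beta> x) \<Longrightarrow> e x *\<^sub>v v + f x *\<^sub>v v = v"
  using e_dim[of v x] by (auto simp: f_eq intro!: eq_vecI)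

lemma e_e: "v \<in> carrier_vec (\<beta> x) \<Longrightarrow> e x *\<^sub>v (e x *\<^sub>v v) = e x *\<^sub>v v"
  using e_B e_id by auto

lemma e_f: "v \<in> carrier_vec (\<beta> x) \<Longrightarrow> e x *\<^sub>v (f x *\<^sub>v v) = 0\<^sub>v (\<beta> x)"
  using mult_minus_distrib_mat_vec[OF e_carrier, of v x "e x *\<^sub>v v"] e_e[of v x] e_dim[of v x]
  by (auto simp: f_eq)

lemma f_B: "v \<in> B x \<Longrightarrow> f x *\<^sub>v v = 0\<^sub>v (\<beta> x)"
  using B_carrier[of v x] by (auto simp: f_eq e_id)

lemma f_K: "v \<in> carrier_vec (\<beta> x) \<Longrightarrow> e x *\<^sub>v v = 0\<^sub>v (\<beta> x) \<Longrightarrow> f x *\<^sub>v v = v"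
  by (auto simp: f_eq)

lemma f_f: "v \<in> carrier_vec (\<beta> x) \<Longrightarrow> f x *\<^sub>v (f x *\<^sub>v v) = f x *\<^sub>v v"
  using f_K[of "f x *\<^sub>v v" x] e_f[of v x] by auto

lemma f_0D: "v \<in> carrier_vec (\<beta> x) \<Longrightarrow> f x *\<^sub>v v = 0\<^sub>v (\<beta> x) \<Longrightarrow> v \<in> B x"
  using e_f_sum[of v x] e_B[of v x] e_dim[of v x] by auto

lemma W_dim: "a \<in> arcs Q \<Longrightarrow> v \<in> carrier_vec (\<beta> (src a)) \<Longrightarrow> W a *\<^sub>v v \<in> carrier_vec (\<beta> (tgt a))"
  using RepD[OF W, of a] by auto

lemma C_dim: "a \<in> arcs Q \<Longrightarrow> v \<in> carrier_vec (\<beta> (src a)) \<Longrightarrow> C a *\<^sub>v v \<in> carrier_vec (\<beta> (tgt a))"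
  using RepD[OF C, of a] by auto

lemma flip_Rep: "W' \<in> Rep Q \<beta>"
proof -
  have "e (tgt a) * W a * e (src a) + f (tgt a) * W a * f (src a) + f (tgt a) * C a * e (src a)
      \<in> carrier_mat (\<beta> (tgt a)) (\<beta> (src a))" if a: "a \<in> arcs Q" for a
    using RepD[OF C a] by (intro add_carrier_mat mult_carrier_mat[OF mult_carrier_mat]) auto
  then show ?thesis unfolding Rep_def flip_def by auto
qed

lemma flip_vec:
  assumes a: "a \<in> arcs Q" and v: "v \<in> carrier_vec (\<beta> (src a))"
  shows "W' a *\<^sub>v v = e (tgt a) *\<^sub>v (W a *\<^sub>v (e (src a) *\<^sub>v v)) + f (tgt a) *\<^sub>v (W a *\<^sub>v (f (src a) *\<^sub>v v))
    + f (tgt a) *\<^sub>v (C a *\<^sub>v (e (src a) *\<^sub>v v))"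
proof -
  have assoc: "(X * Y * Z) *\<^sub>v v = X *\<^sub>v (Y *\<^sub>v (Z *\<^sub>v v))"
    if "X \<in> carrier_mat (\<beta> (tgt a)) (\<beta> (tgt a))" "Y \<in> carrier_mat (\<beta> (tgt a)) (\<beta> (src a))"
      "Z \<in> carrier_mat (\<beta> (src a)) (\<beta> (src a))" for X Y Z :: "complex mat"
    using that v assoc_mult_mat_vec[OF mult_carrier_mat[OF that(1,2)] that(3) v]
      assoc_mult_mat_vec[OF that(1,2), of "Z *\<^sub>v v"] by auto
  have car: "X * Y * Z \<in> carrier_mat (\<beta> (tgt a)) (\<beta> (src a))"
    if "X \<in> carrier_mat (\<beta> (tgt a)) (\<beta> (tgt a))" "Y \<in> carrier_mat (\<beta> (tgt a)) (\<beta> (src a))"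
      "Z \<in> carrier_mat (\<beta> (src a)) (\<beta> (src a))" for X Y Z :: "complex mat"
    using that by auto
  note Wa = RepD[OF W a] and Ca = RepD[OF C a]
  have "W' a = e (tgt a) * W a * e (src a) + f (tgt a) * W a * f (src a) + f (tgt a) * C a * e (src a)"
    using a unfolding flip_def by simp
  also have "\<dots> *\<^sub>v v = (e (tgt a) * W a * e (src a)) *\<^sub>v v + (f (tgt a) * W a * f (src a)) *\<^sub>v v
     + (f (tgt a) * C a * e (src a)) *\<^sub>v v"
    unfolding add_mult_distrib_mat_vec[OF add_carrier_mat[OF car[OF f_carrier Wa f_carrier]] car[OF f_carrier Ca e_carrier] v]
      add_mult_distrib_mat_vec[OF car[OF e_carrier Wa e_carrier] car[OF f_carrier Wa f_carrier] v] ..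
  finally show ?thesis
    unfolding assoc[OF e_carrier Wa e_carrier] assoc[OF f_carrier Wa f_carrier] assoc[OF f_carrier Ca e_carrier] .
qed

text \<open>
  The projection \<open>e\<close> is a morphism from the flip onto \<open>B\<close>.
\<close>
lemma e_flip:
  assumes a: "a \<in> arcs Q" and v: "v \<in> carrier_vec (\<beta> (src a))"
  shows "e (tgt a) *\<^sub>v (W' a *\<^sub>v v) = W a *\<^sub>v (e (src a) *\<^sub>v v)"
proof -
  have in_B: "W a *\<^sub>v (e (src a) *\<^sub>v v) \<in> B (tgt a)" using subrepD(2)[OF B a e_B[OF v]] .
  note dim = W_dim[OF a e_dim[OF v]] W_dim[OF a f_dim[OF v]] C_dim[OF a e_dim[OF v]]
  have "e (tgt a) *\<^sub>v (W' a *\<^sub>v v) = e (tgt a) *\<^sub>v (e (tgt a) *\<^sub>v (W a *\<^sub>v (e (src a) *\<^sub>v v)))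
     + e (tgt a) *\<^sub>v (f (tgt a) *\<^sub>v (W a *\<^sub>v (f (src a) *\<^sub>v v)))
     + e (tgt a) *\<^sub>v (f (tgt a) *\<^sub>v (C a *\<^sub>v (e (src a) *\<^sub>v v)))"
    unfolding flip_vec[OF a v] using dim
    by (simp add: mult_add_distrib_mat_vec[of _ "\<beta> (tgt a)" "\<beta> (tgt a)"])
  also have "\<dots> = W a *\<^sub>v (e (src a) *\<^sub>v v)"
    using e_id[OF in_B] e_f[OF dim(2)] e_f[OF dim(3)] dim(1) by simp
  finally show ?thesis .
qed

lemma flip_K:
  assumes a: "a \<in> arcs Q" and v: "v \<in> carrier_vec (\<beta> (src a))" "e (src a) *\<^sub>v v = 0\<^sub>v (\<beta> (src a))"
  shows "W' a *\<^sub>v v = f (tgt a) *\<^sub>v (W a *\<^sub>v v)"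
proof -
  have [simp]: "X *\<^sub>v 0\<^sub>v (\<beta> (src a)) = 0\<^sub>v (\<beta> (tgt a))"
    if "X \<in> carrier_mat (\<beta> (tgt a)) (\<beta> (src a))" for X :: "complex mat" using that by (intro eq_vecI) auto
  have [simp]: "X *\<^sub>v 0\<^sub>v (\<beta> (tgt a)) = 0\<^sub>v (\<beta> (tgt a))"
    if "X \<in> carrier_mat (\<beta> (tgt a)) (\<beta> (tgt a))" for X :: "complex mat" using that by (intro eq_vecI) auto
  show ?thesis
    unfolding flip_vec[OF a v(1)] v(2) f_K[OF v] using RepD[OF W a] RepD[OF C a] f_dim[OF W_dim[OF a v(1)]]
    by simp
qed

text \<open>
  The projection \<open>f\<close> is a morphism from \<open>W\<close> to the flip.
\<close>
lemma flip_f: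
  assumes a: "a \<in> arcs Q" and v: "v \<in> carrier_vec (\<beta> (src a))"
  shows "W' a *\<^sub>v (f (src a) *\<^sub>v v) = f (tgt a) *\<^sub>v (W a *\<^sub>v v)"
proof -
  have *: "W a *\<^sub>v (e (src a) *\<^sub>v v) \<in> B (tgt a)" using subrepD(2)[OF B a e_B[OF v]] .
  note dim = W_dim[OF a e_dim[OF v]] W_dim[OF a f_dim[OF v]]
  have "W a *\<^sub>v v = W a *\<^sub>v (e (src a) *\<^sub>v v + f (src a) *\<^sub>v v)" using e_f_sum[OF v] by simp
  also have "\<dots> = W a *\<^sub>v (e (src a) *\<^sub>v v) + W a *\<^sub>v (f (src a) *\<^sub>v v)"
    using mult_add_distrib_mat_vec[OF RepD[OF W a] e_dim[OF v] f_dim[OF v]] .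
  finally have "f (tgt a) *\<^sub>v (W a *\<^sub>v v) = f (tgt a) *\<^sub>v (W a *\<^sub>v (e (src a) *\<^sub>v v))
     + f (tgt a) *\<^sub>v (W a *\<^sub>v (f (src a) *\<^sub>v v))"
    using mult_add_distrib_mat_vec[OF f_carrier dim] by simp
  also have "\<dots> = W' a *\<^sub>v (f (src a) *\<^sub>v v)"
    unfolding flip_K[OF a f_dim[OF v] e_f[OF v]] f_B[OF *] using f_dim[OF dim(2)] by simp
  finally show ?thesis by simp
qed

text \<open>
  \<open>S\<close> is the image of \<open>U\<close> under the morphism \<open>e\<close> from the flip onto \<open>B\<close>, and \<open>P\<close> is the preimage of \<open>U\<close>
  under the morphism \<open>f\<close> from \<open>W\<close> to the flip. The dimensions come from rank-nullity, both
  for \<open>e\<close> on \<open>U\<close> and for \<open>f\<close> on \<open>P\<close>; the common term is the part of \<open>U\<close> inside \<open>K\<close>.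
\<close>
lemma flip_subrep:
  assumes U: "subrep Q \<beta> W' U"
  defines "S \<equiv> \<lambda>x. (*\<^sub>v) (e x) ` U x" and "P \<equiv> \<lambda>x. {v \<in> carrier_vec (\<beta> x). f x *\<^sub>v v \<in> U x}"
  shows "subrep Q \<beta> W S" "subrep Q \<beta> W P" "S x \<subseteq> B x" "B x \<subseteq> P x"
    "sdim (\<beta> x) (U x) = sdim (\<beta> x) (S x) + sdim (\<beta> x) {v \<in> U x. e x *\<^sub>v v = 0\<^sub>v (\<beta> x)}"
    "sdim (\<beta> x) (P x) = sdim (\<beta> x) (B x) + sdim (\<beta> x) {v \<in> U x. e x *\<^sub>v v = 0\<^sub>v (\<beta> x)}"
proof -
  note Us = subrepD(1)[OF U]
  have Uc: "v \<in> carrier_vec (\<beta> x)" if "v \<in> U x" for v x using vsubD(1)[OF Us that] .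
  have P: "vsub (\<beta> x) (P x)" for x
    using vsubD(2,3,4)[OF Us] unfolding P_def
    by (intro vsubI) (auto simp: mult_add_distrib_mat_vec[OF f_carrier] mult_mat_vec[OF f_carrier]
         mult_mat_zero_vec[OF f_carrier])
  show "subrep Q \<beta> W S"
  proof (rule subrepI)
    show "vsub (\<beta> x) (S x)" for x unfolding S_def by (rule vsub_image[OF e_carrier Us])
    fix a s assume a: "a \<in> arcs Q" and "s \<in> S (src a)"
    then obtain u where u: "u \<in> U (src a)" "s = e (src a) *\<^sub>v u" unfolding S_def by auto
    show "W a *\<^sub>v s \<in> S (tgt a)"
      unfolding u(2) e_flip[OF a Uc[OF u(1)], symmetric] S_def using subrepD(2)[OF U a u(1)] by auto
  qed
  show "subrep Q \<beta> W P"
  proof (rule subrepI)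
    show "vsub (\<beta> x) (P x)" for x by (rule P)
    fix a v assume a: "a \<in> arcs Q" and "v \<in> P (src a)"
    then have v: "v \<in> carrier_vec (\<beta> (src a))" "f (src a) *\<^sub>v v \<in> U (src a)" unfolding P_def by auto
    have "f (tgt a) *\<^sub>v (W a *\<^sub>v v) \<in> U (tgt a)"
      using subrepD(2)[OF U a v(2)] flip_f[OF a v(1)] by simp
    then show "W a *\<^sub>v v \<in> P (tgt a)" using W_dim[OF a v(1)] unfolding P_def by auto
  qed
  show "S x \<subseteq> B x" unfolding S_def using e_B Uc by auto
  show BP: "B x \<subseteq> P x"
    unfolding P_def using f_B vsubD(2)[OF Us] B_carrier by auto
  show "sdim (\<beta> x) (U x) = sdim (\<beta> x) (S x) + sdim (\<beta> x) {v \<in> U x. e x *\<^sub>v v = 0\<^sub>v (\<beta> x)}"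
    unfolding S_def by (rule rank_nullity[OF e_carrier Us])
  have "(*\<^sub>v) (f x) ` P x = {v \<in> U x. e x *\<^sub>v v = 0\<^sub>v (\<beta> x)}"
  proof
    show "(*\<^sub>v) (f x) ` P x \<subseteq> {v \<in> U x. e x *\<^sub>v v = 0\<^sub>v (\<beta> x)}"
      unfolding P_def using e_f by auto
    show "{v \<in> U x. e x *\<^sub>v v = 0\<^sub>v (\<beta> x)} \<subseteq> (*\<^sub>v) (f x) ` P x"
    proof
      fix v assume v: "v \<in> {v \<in> U x. e x *\<^sub>v v = 0\<^sub>v (\<beta> x)}"
      then have "f x *\<^sub>v v = v" using f_K Uc by auto
      then show "v \<in> (*\<^sub>v) (f x) ` P x" using v Uc unfolding P_def by (intro image_eqI[of _ _ v]) auto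
    qed
  qed
  moreover have "{v \<in> P x. f x *\<^sub>v v = 0\<^sub>v (\<beta> x)} = B x"
    using BP f_B f_0D unfolding P_def by auto
  ultimately show "sdim (\<beta> x) (P x) = sdim (\<beta> x) (B x) + sdim (\<beta> x) {v \<in> U x. e x *\<^sub>v v = 0\<^sub>v (\<beta> x)}"
    using rank_nullity[OF f_carrier P[of x]] by simp
qed

lemma flip_dims:
  assumes "d \<in> dims W'"
  obtains s p where "s \<in> dims W" "p \<in> dims W" "\<And>x. d x + sdim (\<beta> x) (B x) = s x + p x"
proof -
  obtain U where U: "subrep Q \<beta> W' U" "d = (\<lambda>x. sdim (\<beta> x) (U x))" using assms by (rule dimsE)
  show ?thesis
    using that[OF dimsI[OF flip_subrep(1)[OF U(1)]] dimsI[OF flip_subrep(2)[OF U(1)]]]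
      flip_subrep(5,6)[OF U(1)] U(2) by simp
qed

lemma K_vsub: "vsub (\<beta> x) (K x)"
  by (rule vsub_kernel[OF e_carrier vsub_carrier])

lemma K_subrep: "subrep Q \<beta> W' K"
proof (rule subrepI)
  fix a v assume a: "a \<in> arcs Q" and "v \<in> K (src a)"
  then show "W' a *\<^sub>v v \<in> K (tgt a)"
    using flip_K[OF a, of v] W_dim[OF a, of v] by (auto simp: e_f)
qed (rule K_vsub)

lemma K_proj: "projection (\<beta> x) (f x) (K x)"
  unfolding projection_def using e_f f_K by auto

lemma K_dim: "sdim (\<beta> x) (B x) + sdim (\<beta> x) (K x) = \<beta> x"
proof -
  have "(*\<^sub>v) (e x) ` carrier_vec (\<beta> x) = B x"
  proof
    show "B x \<subseteq> (*\<^sub>v) (e x) ` carrier_vec (\<beta> x)"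
    proof
      fix v assume "v \<in> B x"
      then show "v \<in> (*\<^sub>v) (e x) ` carrier_vec (\<beta> x)"
        using e_id B_carrier by (intro image_eqI[of _ _ v]) auto
    qed
  qed (use e_B in auto)
  then show ?thesis using rank_nullity[OF e_carrier vsub_carrier, of x] sdim_carrier by simp
qed

text \<open>
  Flipping back along \<open>K\<close> with the deleted block of \<open>W\<close> as new block. Hence whatever is inherited by
  flips also passes from a flip to \<open>W\<close>.
\<close>
lemma flip_flip: "flip f W' W = W"
proof -
  have ce: "compl f x = e x" for x
    unfolding compl_def by (intro eq_matI) auto
  have "flip f W' W a = W a" for a
  proof (cases "a \<in> arcs Q")
    case False
    then show ?thesis using PiE_arb[OF W[unfolded Rep_def] False] unfolding flip_def by simp
  next
    case a: True
    interpret F: flip_datum Q \<beta> W' K f W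
      using flip_Rep K_subrep W K_proj by unfold_locales auto
    show ?thesis
    proof (rule mat_eq_iff_mult_vec[OF RepD[OF F.flip_Rep a] RepD[OF W a]])
      fix v :: "complex Matrix.vec" assume v: "v \<in> carrier_vec (\<beta> (src a))"
      have B': "W a *\<^sub>v (e (src a) *\<^sub>v v) \<in> B (tgt a)" using subrepD(2)[OF B a e_B[OF v]] .
      note dim = W_dim[OF a e_dim[OF v]] W_dim[OF a f_dim[OF v]]
      have 1: "f (tgt a) *\<^sub>v (W' a *\<^sub>v (f (src a) *\<^sub>v v)) = f (tgt a) *\<^sub>v (W a *\<^sub>v (f (src a) *\<^sub>v v))"
        using flip_K[OF a f_dim[OF v] e_f[OF v]] f_f[OF dim(2)] by simp
      have 2: "e (tgt a) *\<^sub>v (W' a *\<^sub>v (e (src a) *\<^sub>v v)) = W a *\<^sub>v (e (src a) *\<^sub>v v)"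
        using e_flip[OF a e_dim[OF v]] e_e[OF v] by simp
      have "flip f W' W a *\<^sub>v v = f (tgt a) *\<^sub>v (W a *\<^sub>v (f (src a) *\<^sub>v v)) + W a *\<^sub>v (e (src a) *\<^sub>v v)
          + e (tgt a) *\<^sub>v (W a *\<^sub>v (f (src a) *\<^sub>v v))"
        unfolding F.flip_vec[OF a v] ce 1 2 ..
      also have "\<dots> = W a *\<^sub>v (e (src a) *\<^sub>v v)
         + (e (tgt a) *\<^sub>v (W a *\<^sub>v (f (src a) *\<^sub>v v)) + f (tgt a) *\<^sub>v (W a *\<^sub>v (f (src a) *\<^sub>v v)))"
      proof -
        have "x + y + z = y + (z + x)" if "x \<in> carrier_vec n" "y \<in> carrier_vec n" "z \<in> carrier_vec n"
          for x y z :: "complex Matrix.vec" and n using that by (intro eq_vecI) auto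
        then show ?thesis using f_dim[OF dim(2)] dim(1) e_dim[OF dim(2)] .
      qed
      also have "\<dots> = W a *\<^sub>v (e (src a) *\<^sub>v v) + W a *\<^sub>v (f (src a) *\<^sub>v v)"
        unfolding e_f_sum[OF dim(2)] ..
      also have "\<dots> = W a *\<^sub>v v"
        using mult_add_distrib_mat_vec[OF RepD[OF W a] e_dim[OF v] f_dim[OF v]] e_f_sum[OF v] by simp
      finally show "flip f W' W a *\<^sub>v v = W a *\<^sub>v v" .
    qed
  qed
  then show ?thesis by auto
qed

text \<open>
  The hypotheses say that \<open>U\<close> is a complement of \<open>K\<close>, so that \<open>e\<close> maps it bijectively onto \<open>B\<close>. Then \<open>U\<close> is
  the graph of a map \<open>c\<close> from \<open>B\<close> to \<open>K\<close>, and stability of the graph is the coboundary equation.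
\<close>
lemma split_flip:
  assumes U: "subrep Q \<beta> W' U" and inj: "\<And>x. {v \<in> U x. e x *\<^sub>v v = 0\<^sub>v (\<beta> x)} = {0\<^sub>v (\<beta> x)}"
    and surj: "\<And>x. (*\<^sub>v) (e x) ` U x = B x"
  shows "coboundary e W B C"
proof -
  note Us = subrepD(1)[OF U]
  have Uc: "v \<in> carrier_vec (\<beta> x)" if "v \<in> U x" for v x using vsubD(1)[OF Us that] .
  have "\<exists>u. u \<in> U x \<and> e x *\<^sub>v u = e x *\<^sub>v unit_vec (\<beta> x) j" for x j
    using surj[of x] e_B[of "unit_vec (\<beta> x) j" x] by auto (metis imageE)
  then obtain u where u: "\<And>x j. u x j \<in> U x" "\<And>x j. e x *\<^sub>v u x j = e x *\<^sub>v unit_vec (\<beta> x) j" by metis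
  \<comment> \<open>\<open>e'\<close> projects onto \<open>U\<close> along \<open>K\<close>, so \<open>e' - e\<close> is the map with graph \<open>U\<close>\<close>
  define e' where "e' x = Matrix.mat (\<beta> x) (\<beta> x) (\<lambda>(i, j). vec_index (u x j) i)" for x
  have e'[simp]: "e' x \<in> carrier_mat (\<beta> x) (\<beta> x)" for x unfolding e'_def by auto
  have e'_dim[simp]: "e' x *\<^sub>v v \<in> carrier_vec (\<beta> x)" if "v \<in> carrier_vec (\<beta> x)" for x v
    using mult_mat_vec_carrier[OF e' that] .
  have e'U: "e' x *\<^sub>v v \<in> U x" if v: "v \<in> carrier_vec (\<beta> x)" for x v
  proof -
    have "e' x *\<^sub>v v = Matrix.vec (\<beta> x) (\<lambda>i. \<Sum>j<\<beta> x. vec_index v j * vec_index (u x j) i)"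
      using v by (intro eq_vecI) (auto simp: e'_def scalar_prod_def lessThan_atLeast0 mult.commute intro!: sum.cong)
    then show ?thesis using vsub_lincomb[OF Us, of "{..<\<beta> x}" "u x" x "\<lambda>j. vec_index v j"] u(1) by auto
  qed
  have "e x * e' x = e x" for x
  proof (rule eq_matI)
    fix i j assume "i < dim_row (e x)" "j < dim_col (e x)"
    then have ij: "i < \<beta> x" "j < \<beta> x" using e_carrier[of x] by auto
    have "dim_vec (u x j) = \<beta> x" using Uc[OF u(1)] by auto
    then have "col (e' x) j = u x j" using ij unfolding e'_def by (intro eq_vecI) auto
    then have "(e x * e' x) $$ (i, j) = vec_index (e x *\<^sub>v u x j) i"
      using ij by (simp add: e'_def)
    also have "\<dots> = vec_index (e x *\<^sub>v unit_vec (\<beta> x) j) i" unfolding u(2) ..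
    also have "\<dots> = e x $$ (i, j)" using ij by simp
    finally show "(e x * e' x) $$ (i, j) = e x $$ (i, j)" .
  qed (auto simp: e'_def)
  then have ee': "e x *\<^sub>v (e' x *\<^sub>v v) = e x *\<^sub>v v" if "v \<in> carrier_vec (\<beta> x)" for x v
    using assoc_mult_mat_vec[OF e_carrier e' that] by simp
  have eqI: "v = w" if "v \<in> U x" "w \<in> U x" "e x *\<^sub>v v = e x *\<^sub>v w" for v w x
  proof -
    have "v - w \<in> {v \<in> U x. e x *\<^sub>v v = 0\<^sub>v (\<beta> x)}"
      using vsubD(5)[OF Us that(1,2)] that(3) mult_minus_distrib_mat_vec[OF e_carrier Uc[OF that(1)] Uc[OF that(2)]]
        e_dim[OF Uc[OF that(2)]] by auto
    then have "v - w = 0\<^sub>v (\<beta> x)" unfolding inj by simp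
    then have "vec_index (v - w) i = 0" if "i < \<beta> x" for i using that by simp
    then show ?thesis using Uc[OF that(1)] Uc[OF that(2)] by (intro eq_vecI) auto
  qed
  define c where "c x = e' x - e x" for x
  have c[simp]: "c x \<in> carrier_mat (\<beta> x) (\<beta> x)" for x
    unfolding c_def using minus_carrier_mat[OF e_carrier] by auto
  have cv: "c x *\<^sub>v v = e' x *\<^sub>v v - e x *\<^sub>v v" if "v \<in> carrier_vec (\<beta> x)" for x v
    unfolding c_def using minus_mult_distrib_mat_vec[OF e' e_carrier that] .
  have e'e: "e' x *\<^sub>v (e x *\<^sub>v v) = e' x *\<^sub>v v" if v: "v \<in> carrier_vec (\<beta> x)" for x v
    by (rule eqI[OF e'U[OF e_dim[OF v]] e'U[OF v]]) (simp add: ee' e_e v)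
  have 1: "c x *\<^sub>v (e x *\<^sub>v v) = c x *\<^sub>v v" if v: "v \<in> carrier_vec (\<beta> x)" for x v
    using v by (simp add: cv e'e e_e)
  have 2: "e x *\<^sub>v (c x *\<^sub>v v) = 0\<^sub>v (\<beta> x)" if v: "v \<in> carrier_vec (\<beta> x)" for x v
    using mult_minus_distrib_mat_vec[OF e_carrier e'_dim[OF v] e_dim[OF v]] e_dim[OF v]
    by (simp add: cv v ee' e_e)
  have 3: "f (tgt a) *\<^sub>v (C a *\<^sub>v v) + f (tgt a) *\<^sub>v (W a *\<^sub>v (c (src a) *\<^sub>v v)) = c (tgt a) *\<^sub>v (W a *\<^sub>v v)"
    if a: "a \<in> arcs Q" and vB: "v \<in> B (src a)" for a v
  proof -
    have v: "v \<in> carrier_vec (\<beta> (src a))" using B_carrier[OF vB] .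
    have ev: "e (src a) *\<^sub>v v = v" using e_id[OF vB] .
    have WB: "W a *\<^sub>v v \<in> B (tgt a)" using subrepD(2)[OF B a vB] .
    have Wv: "W a *\<^sub>v v \<in> carrier_vec (\<beta> (tgt a))" using B_carrier[OF WB] .
    have cc: "c (src a) *\<^sub>v v \<in> carrier_vec (\<beta> (src a))" "c (tgt a) *\<^sub>v (W a *\<^sub>v v) \<in> carrier_vec (\<beta> (tgt a))"
      using mult_mat_vec_carrier[OF c v] mult_mat_vec_carrier[OF c Wv] .
    have "W' a *\<^sub>v (e' (src a) *\<^sub>v v) = e' (tgt a) *\<^sub>v (W a *\<^sub>v v)"
    proof (rule eqI)
      show "W' a *\<^sub>v (e' (src a) *\<^sub>v v) \<in> U (tgt a)" using subrepD(2)[OF U a e'U[OF v]] .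
      show "e' (tgt a) *\<^sub>v (W a *\<^sub>v v) \<in> U (tgt a)" using e'U[OF Wv] .
      show "e (tgt a) *\<^sub>v (W' a *\<^sub>v (e' (src a) *\<^sub>v v)) = e (tgt a) *\<^sub>v (e' (tgt a) *\<^sub>v (W a *\<^sub>v v))"
        using e_flip[OF a e'_dim[OF v]] ee'[OF v] ee'[OF Wv] e_id[OF WB] ev by simp
    qed
    moreover have "W' a *\<^sub>v (e' (src a) *\<^sub>v v) = W a *\<^sub>v v + f (tgt a) *\<^sub>v (W a *\<^sub>v (c (src a) *\<^sub>v v))
        + f (tgt a) *\<^sub>v (C a *\<^sub>v v)"
      unfolding flip_vec[OF a e'_dim[OF v]] ee'[OF v] f_eq[OF e'_dim[OF v]] ev e_id[OF WB] 
      using cv[OF v] ev by simp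
    moreover have "e' (tgt a) *\<^sub>v (W a *\<^sub>v v) = W a *\<^sub>v v + c (tgt a) *\<^sub>v (W a *\<^sub>v v)"
      unfolding cv[OF Wv] e_id[OF WB] using add_diff_vec[OF Wv e'_dim[OF Wv]] by simp
    ultimately have eq: "W a *\<^sub>v v + f (tgt a) *\<^sub>v (W a *\<^sub>v (c (src a) *\<^sub>v v)) + f (tgt a) *\<^sub>v (C a *\<^sub>v v)
       = W a *\<^sub>v v + c (tgt a) *\<^sub>v (W a *\<^sub>v v)" by simp
    show ?thesis
      using add_vec_cancel[OF Wv f_dim[OF W_dim[OF a cc(1)]] f_dim[OF C_dim[OF a v]] cc(2) eq] .
  qed
  show ?thesis unfolding coboundary_def using c 1 2 3 by (intro exI[of _ c]) auto
qed

end

section \<open>Polynomial functions on the representation space\<close>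

lemma poly_eq_0_if_off_0:
  fixes p :: "complex poly"
  assumes "\<And>t. t \<noteq> 0 \<Longrightarrow> poly p t = 0"
  shows "p = 0"
proof (rule ccontr)
  assume "p \<noteq> 0"
  then have "finite {t. poly p t = 0}" by (rule poly_roots_finite)
  moreover have "UNIV - {0} \<subseteq> {t. poly p t = 0}" using assms by auto
  ultimately have "finite (UNIV - {0 :: complex})" using finite_subset by blast
  then show False using infinite_UNIV_char_0[where 'a = complex] by simp
qed

lemma smult_mat_mult_vec:
  fixes A :: "complex mat"
  assumes "A \<in> carrier_mat m n" "v \<in> carrier_vec n"
  shows "(k \<cdot>\<^sub>m A) *\<^sub>v v = k \<cdot>\<^sub>v (A *\<^sub>v v)"
  using assms by (intro eq_vecI) (auto simp: scalar_prod_def sum_distrib_left mult.assoc)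

context quiver
begin

lemma coefficient_ring_polynomials: "coefficient_ring (rep_polynomials Q \<beta>)"
  by unfold_locales (auto intro: rep_polynomials.intros)

lemma rep_polynomial_cong:
  assumes "g \<in> rep_polynomials Q \<beta>"
    and "\<And>a i j. a \<in> arcs Q \<Longrightarrow> i < \<beta> (tgt a) \<Longrightarrow> j < \<beta> (src a) \<Longrightarrow> X a $$ (i, j) = Y a $$ (i, j)"
  shows "g X = g Y"
  using assms by (induction rule: rep_polynomials.induct) auto

lemma rep_polynomial_curve:
  assumes "g \<in> rep_polynomials Q \<beta>"
    and "\<And>a i j. a \<in> arcs Q \<Longrightarrow> i < \<beta> (tgt a) \<Longrightarrow> j < \<beta> (src a) \<Longrightarrow>
      \<exists>q. \<forall>t. X t a $$ (i, j) = poly q t"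
  shows "\<exists>q. \<forall>t. g (X t) = poly q t"
  using assms
proof (induction rule: rep_polynomials.induct)
  case (const c)
  then show ?case by (intro exI[of _ "[:c:]"]) auto
next
  case (add f g)
  then obtain p q where "\<forall>t. f (X t) = poly p t" "\<forall>t. g (X t) = poly q t" by blast
  then show ?case by (intro exI[of _ "p + q"]) auto
next
  case (mult f g)
  then obtain p q where "\<forall>t. f (X t) = poly p t" "\<forall>t. g (X t) = poly q t" by blast
  then show ?case by (intro exI[of _ "p * q"]) auto
qed auto

text \<open>
  Expansion of \<open>g (W + t Y)\<close> in \<open>t\<close>. The argument \<open>X\<close> stands for \<open>W + t Y\<close> and is described by its
  entries, because only these matter to \<open>g\<close>.
\<close>
lemma rep_polynomial_taylor:
  assumes "g \<in> rep_polynomials Q \<beta>"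
  shows "\<exists>n F. (\<forall>k\<le>n. F k \<in> rep_polynomials Q \<beta>) \<and>
    (\<forall>X Y t. (\<forall>a\<in>arcs Q. \<forall>i<\<beta> (tgt a). \<forall>j<\<beta> (src a). X a $$ (i, j) = W a $$ (i, j) + t * Y a $$ (i, j))
      \<longrightarrow> g X = (\<Sum>k\<le>n. t ^ k * F k Y))"
    (is "\<exists>n F. ?P n F \<and> (\<forall>X Y t. ?R X Y t \<longrightarrow> g X = ?S n F Y t)")
  using assms
proof (induction rule: rep_polynomials.induct)
  case (const c)
  show ?case by (intro exI[of _ 0] exI[of _ "\<lambda>_ _. c"]) (auto intro: rep_polynomials.const)
next
  case (coordinate a i j)
  then show ?case
    by (intro exI[of _ 1] exI[of _ "\<lambda>k Y. if k = 0 then W a $$ (i, j) else Y a $$ (i, j)"])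
       (auto intro: rep_polynomials.intros simp: le_Suc_eq)
next
  case (add f g)
  then obtain n F m G where F: "?P n F" "\<And>X Y t. ?R X Y t \<Longrightarrow> f X = ?S n F Y t"
    and G: "?P m G" "\<And>X Y t. ?R X Y t \<Longrightarrow> g X = ?S m G Y t" by blast
  let ?H = "\<lambda>k Y. (if k \<le> n then F k Y else 0) + (if k \<le> m then G k Y else 0)"
  have "?H k \<in> rep_polynomials Q \<beta>" if "k \<le> n + m" for k
    using F(1) G(1) by (cases "k \<le> n"; cases "k \<le> m") (auto intro: rep_polynomials.intros)
  moreover have "f X + g X = ?S (n + m) ?H Y t" if R: "?R X Y t" for X Y t
  proof -
    have "(\<Sum>k\<le>n + m. t ^ k * (if k \<le> n then F k Y else 0)) = ?S n F Y t"
      by (rule sum.mono_neutral_cong_right) auto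
    moreover have "(\<Sum>k\<le>n + m. t ^ k * (if k \<le> m then G k Y else 0)) = ?S m G Y t"
      by (rule sum.mono_neutral_cong_right) auto
    ultimately show ?thesis unfolding F(2)[OF R] G(2)[OF R] distrib_left sum.distrib by simp
  qed
  ultimately show ?case by (intro exI[of _ "n + m"] exI[of _ ?H]) auto
next
  case (mult f g)
  then obtain n F m G where F: "?P n F" "\<And>X Y t. ?R X Y t \<Longrightarrow> f X = ?S n F Y t"
    and G: "?P m G" "\<And>X Y t. ?R X Y t \<Longrightarrow> g X = ?S m G Y t" by blast
  define A where "A k = {i. i \<le> k \<and> i \<le> n \<and> k - i \<le> m}" for k
  have finA: "finite (A k)" for k unfolding A_def by auto
  let ?H = "\<lambda>k Y. \<Sum>i\<in>A k. F i Y * G (k - i) Y"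
  have sum_in: "(\<lambda>Y. \<Sum>i\<in>I. h i Y) \<in> rep_polynomials Q \<beta>"
    if "finite I" "\<And>i. i \<in> I \<Longrightarrow> h i \<in> rep_polynomials Q \<beta>" for I :: "nat set" and h
    using that by (induction I rule: finite_induct) (auto intro: rep_polynomials.intros)
  have "?H k \<in> rep_polynomials Q \<beta>" for k
    using F(1) G(1) by (intro sum_in[OF finA] rep_polynomials.mult) (auto simp: A_def)
  moreover have "f X * g X = ?S (n + m) ?H Y t" if R: "?R X Y t" for X Y t
  proof -
    have "?S n F Y t * ?S m G Y t
      = (\<Sum>(i, j)\<in>{..n} \<times> {..m}. t ^ (i + j) * (F i Y * G j Y))"
      by (simp add: sum_product sum.cartesian_product power_add algebra_simps)
    also have "\<dots> = (\<Sum>(k, i)\<in>Sigma {..n + m} A. t ^ k * (F i Y * G (k - i) Y))"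
      by (intro sum.reindex_bij_witness[of _ "\<lambda>(k, i). (i, k - i)" "\<lambda>(i, j). (i + j, i)"])
         (auto simp: A_def)
    also have "\<dots> = ?S (n + m) ?H Y t"
      by (simp add: sum.Sigma[symmetric] finA sum_distrib_left)
    finally show ?thesis unfolding F(2)[OF R] G(2)[OF R] .
  qed
  ultimately show ?case by (intro exI[of _ "n + m"] exI[of _ ?H]) auto
qed

lemma Rep_mat: "(\<lambda>a\<in>arcs Q. Matrix.mat (\<beta> (tgt a)) (\<beta> (src a)) (h a)) \<in> Rep Q \<beta>"
  unfolding Rep_def by auto

text \<open>
  Irreducibility of the representation space: restricted to the line through two points where one or
  the other is nonzero, the polynomials become nonzero polynomials in one variable.
\<close>
lemma rep_polynomials_common_nonzero:
  assumes "finite G" "\<And>g. g \<in> G \<Longrightarrow> g \<in> rep_polynomials Q \<beta> \<and> (\<exists>W\<in>Rep Q \<beta>. g W \<noteq> 0)"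
  shows "\<exists>W\<in>Rep Q \<beta>. \<forall>g\<in>G. g W \<noteq> 0"
  using assms
proof (induction G rule: finite_induct)
  case empty
  then show ?case using Rep_mat[of "\<lambda>_ _. 0"] by auto
next
  case (insert g G)
  obtain W1 where W1: "W1 \<in> Rep Q \<beta>" "g W1 \<noteq> 0" using insert.prems by blast
  obtain W2 where W2: "W2 \<in> Rep Q \<beta>" "\<forall>h\<in>G. h W2 \<noteq> 0" using insert.IH insert.prems by blast
  define X where "X t = (\<lambda>a\<in>arcs Q. Matrix.mat (\<beta> (tgt a)) (\<beta> (src a))
      (\<lambda>(i, j). W1 a $$ (i, j) + t * (W2 a $$ (i, j) - W1 a $$ (i, j))))" for t :: complex
  have X: "X t \<in> Rep Q \<beta>" for t unfolding X_def by (rule Rep_mat)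
  have curve: "\<exists>q. \<forall>t. h (X t) = poly q t" if "h \<in> rep_polynomials Q \<beta>" for h
  proof (rule rep_polynomial_curve[OF that])
    fix a i j assume "a \<in> arcs Q" "i < \<beta> (tgt a)" "j < \<beta> (src a)"
    then show "\<exists>q. \<forall>t. X t a $$ (i, j) = poly q t"
      by (intro exI[of _ "[:W1 a $$ (i, j), W2 a $$ (i, j) - W1 a $$ (i, j):]"]) (auto simp: X_def)
  qed
  have X01: "h (X 0) = h W1" "h (X 1) = h W2" if "h \<in> rep_polynomials Q \<beta>" for h
    by (auto intro!: rep_polynomial_cong[OF that] simp: X_def)
  have "\<exists>q. \<forall>h\<in>insert g G. \<forall>t. h (X t) = poly (q h) t"
    using curve insert.prems by (intro bchoice) auto
  then obtain q where q: "\<And>h t. h \<in> insert g G \<Longrightarrow> h (X t) = poly (q h) t" by blast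
  have "q h \<noteq> 0" if h: "h \<in> insert g G" for h
  proof -
    have "poly (q h) 0 \<noteq> 0 \<or> poly (q h) 1 \<noteq> 0"
      using q[OF h, symmetric] X01[of h] insert.prems[OF h] W1(2) W2(2) h by auto
    then show ?thesis by auto
  qed
  then have "finite (\<Union>h\<in>insert g G. {t. poly (q h) t = 0})"
    using insert.hyps(1) poly_roots_finite by (intro finite_UN_I) auto
  then obtain t where "t \<notin> (\<Union>h\<in>insert g G. {t. poly (q h) t = 0})"
    using ex_new_if_finite[OF infinite_UNIV_char_0] by blast
  then show ?case using X[of t] q by (intro bexI[of _ "X t"]) auto
qed

end

section \<open>Split extensions and general subrepresentations\<close>

context quiver
begin

text \<open>
  The curve is \<open>(1 + t c) (W + t P) (1 - t c)\<close>, where \<open>P = V - c W + W c\<close> makes the derivative at \<open>t = 0\<close>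
  equal to \<open>V\<close>. The coboundary equation says that \<open>P\<close> maps \<open>B\<close> to itself, so \<open>B\<close> is a
  subrepresentation of \<open>W + t P\<close>; and \<open>1 + t c\<close>, whose inverse is \<open>1 - t c\<close> as \<open>c c = 0\<close>,
  transports it to the curve.
\<close>
lemma deformation_curve:
  assumes W: "W \<in> Rep Q \<beta>" and V: "V \<in> Rep Q \<beta>" and B: "subrep Q \<beta> W B"
    and proj: "\<And>x. projection (\<beta> x) (e x) (B x)"
    and c: "\<And>x. c x \<in> carrier_mat (\<beta> x) (\<beta> x)"
    and ce: "\<And>x v. v \<in> carrier_vec (\<beta> x) \<Longrightarrow> c x *\<^sub>v (e x *\<^sub>v v) = c x *\<^sub>v v"
    and ec: "\<And>x v. v \<in> carrier_vec (\<beta> x) \<Longrightarrow> e x *\<^sub>v (c x *\<^sub>v v) = 0\<^sub>v (\<beta> x)"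
    and split: "\<And>a v. a \<in> arcs Q \<Longrightarrow> v \<in> B (src a) \<Longrightarrow>
      compl e (tgt a) *\<^sub>v (V a *\<^sub>v v) + compl e (tgt a) *\<^sub>v (W a *\<^sub>v (c (src a) *\<^sub>v v)) = c (tgt a) *\<^sub>v (W a *\<^sub>v v)"
  shows "\<exists>R0 R1. R0 \<in> Rep Q \<beta> \<and> R1 \<in> Rep Q \<beta> \<and> (\<forall>t. \<exists>X\<in>Rep Q \<beta>.
     (\<lambda>x. sdim (\<beta> x) (B x)) \<in> dims X \<and>
     (\<forall>a\<in>arcs Q. \<forall>i<\<beta> (tgt a). \<forall>j<\<beta> (src a).
       X a $$ (i, j) = W a $$ (i, j) + t * (V a $$ (i, j) + t * (R0 a $$ (i, j) + t * R1 a $$ (i, j)))))"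
proof -
  interpret flip_datum Q \<beta> W B e V using W B V proj by unfold_locales
  define P where "P a = V a - c (tgt a) * W a + W a * c (src a)" for a
  note Wa = RepD[OF W] and Va = RepD[OF V]
  have P: "P a \<in> carrier_mat (\<beta> (tgt a)) (\<beta> (src a))" if "a \<in> arcs Q" for a
    unfolding P_def using mult_carrier_mat[OF Wa[OF that] c] by auto
  have Pv: "P a *\<^sub>v v = V a *\<^sub>v v - c (tgt a) *\<^sub>v (W a *\<^sub>v v) + W a *\<^sub>v (c (src a) *\<^sub>v v)"
    if a: "a \<in> arcs Q" and v: "v \<in> carrier_vec (\<beta> (src a))" for a v
  proof -
    have 1: "c (tgt a) * W a \<in> carrier_mat (\<beta> (tgt a)) (\<beta> (src a))" using mult_carrier_mat[OF c Wa[OF a]] .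
    have 2: "W a * c (src a) \<in> carrier_mat (\<beta> (tgt a)) (\<beta> (src a))" using mult_carrier_mat[OF Wa[OF a] c] .
    show ?thesis
      unfolding P_def add_mult_distrib_mat_vec[OF minus_carrier_mat[OF 1] 2 v]
        minus_mult_distrib_mat_vec[OF Va[OF a] 1 v] assoc_mult_mat_vec[OF c Wa[OF a] v]
        assoc_mult_mat_vec[OF Wa[OF a] c v] ..
  qed
  have cv: "c x *\<^sub>v v \<in> carrier_vec (\<beta> x)" if "v \<in> carrier_vec (\<beta> x)" for x v
    using mult_mat_vec_carrier[OF c that] .
  have cdim: "dim_row (c x) = \<beta> x" "dim_col (c x) = \<beta> x" for x using c[of x] by auto
  have PB: "P a *\<^sub>v v \<in> B (tgt a)" if a: "a \<in> arcs Q" and v: "v \<in> B (src a)" for a v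
  proof -
    have vc: "v \<in> carrier_vec (\<beta> (src a))" using B_carrier[OF v] .
    have Wv: "W a *\<^sub>v v \<in> carrier_vec (\<beta> (tgt a))" using W_dim[OF a vc] .
    note dims = cv[OF Wv] C_dim[OF a vc] W_dim[OF a cv[OF vc]]
    have fc: "f (tgt a) *\<^sub>v (c (tgt a) *\<^sub>v (W a *\<^sub>v v)) = c (tgt a) *\<^sub>v (W a *\<^sub>v v)"
      using f_K[OF cv[OF Wv] ec[OF Wv]] .
    have "f (tgt a) *\<^sub>v (P a *\<^sub>v v) = f (tgt a) *\<^sub>v (V a *\<^sub>v v) - c (tgt a) *\<^sub>v (W a *\<^sub>v v)
        + f (tgt a) *\<^sub>v (W a *\<^sub>v (c (src a) *\<^sub>v v))"
      unfolding Pv[OF a vc] mult_add_distrib_mat_vec[OF f_carrier minus_carrier_vec[OF dims(2,1)] dims(3)]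
        mult_minus_distrib_mat_vec[OF f_carrier dims(2,1)] fc ..
    also have "\<dots> = 0\<^sub>v (\<beta> (tgt a))"
    proof -
      have "x - y + z = 0\<^sub>v n" if "x \<in> carrier_vec n" "y \<in> carrier_vec n" "z \<in> carrier_vec n" "x + z = y"
        for x y z :: "complex Matrix.vec" and n
        using that by (intro eq_vecI) auto
      then show ?thesis using f_dim[OF dims(2)] dims(1) f_dim[OF dims(3)] split[OF a v] .
    qed
    finally have "f (tgt a) *\<^sub>v (P a *\<^sub>v v) = 0\<^sub>v (\<beta> (tgt a))" .
    then show ?thesis using f_0D mult_mat_vec_carrier[OF P[OF a] vc] by auto
  qed
  have cc: "c x *\<^sub>v (c x *\<^sub>v v) = 0\<^sub>v (\<beta> x)" if v: "v \<in> carrier_vec (\<beta> x)" for x v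
    using ce[OF cv[OF v]] ec[OF v] mult_mat_zero_vec[OF c] by simp
  define R0 where "R0 = (\<lambda>a\<in>arcs Q. c (tgt a) * P a - P a * c (src a) - c (tgt a) * (W a * c (src a)))"
  define R1 where "R1 = (\<lambda>a\<in>arcs Q. - (c (tgt a) * (P a * c (src a))))"
  have R: "R0 \<in> Rep Q \<beta>" "R1 \<in> Rep Q \<beta>"
    unfolding R0_def R1_def Rep_def
    using minus_carrier_mat[OF mult_carrier_mat[OF c mult_carrier_mat[OF Wa c]]]
      uminus_carrier_mat[OF mult_carrier_mat[OF c mult_carrier_mat[OF P c]]] by (simp_all add: PiE_iff)
  have "\<exists>X\<in>Rep Q \<beta>. (\<lambda>x. sdim (\<beta> x) (B x)) \<in> dims X \<and>
     (\<forall>a\<in>arcs Q. \<forall>i<\<beta> (tgt a). \<forall>j<\<beta> (src a).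
       X a $$ (i, j) = W a $$ (i, j) + t * (V a $$ (i, j) + t * (R0 a $$ (i, j) + t * R1 a $$ (i, j))))" for t
  proof -
    define M where "M a = W a + t \<cdot>\<^sub>m P a" for a
    have M: "M a \<in> carrier_mat (\<beta> (tgt a)) (\<beta> (src a))" if "a \<in> arcs Q" for a
      unfolding M_def using P[OF that] by auto
    have Mv: "M a *\<^sub>v v = W a *\<^sub>v v + t \<cdot>\<^sub>v (P a *\<^sub>v v)"
      if a: "a \<in> arcs Q" and v: "v \<in> carrier_vec (\<beta> (src a))" for a v
      unfolding M_def using P[OF a] v Wa[OF a]
      by (subst add_mult_distrib_mat_vec[OF Wa[OF a] _ v]) (auto simp: smult_mat_mult_vec[OF P[OF a] v])
    have MB: "M a *\<^sub>v v \<in> B (tgt a)" if a: "a \<in> arcs Q" and v: "v \<in> B (src a)" for a v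
      unfolding Mv[OF a B_carrier[OF v]]
      using vsubD(3,4)[OF subrepD(1)[OF B]] subrepD(2)[OF B a v] PB[OF a v] by auto
    define X where "X = (\<lambda>a\<in>arcs Q. M a + t \<cdot>\<^sub>m (c (tgt a) * M a) - t \<cdot>\<^sub>m (M a * c (src a))
        - (t * t) \<cdot>\<^sub>m (c (tgt a) * (M a * c (src a))))"
    have X: "X \<in> Rep Q \<beta>"
      unfolding X_def Rep_def
      using minus_carrier_mat[OF smult_carrier_mat[OF mult_carrier_mat[OF c mult_carrier_mat[OF M c]]]]
      by (simp add: PiE_iff)
    define G where "G x = 1\<^sub>m (\<beta> x) + t \<cdot>\<^sub>m c x" for x
    have G: "G x \<in> carrier_mat (\<beta> x) (\<beta> x)" for x unfolding G_def using c[of x] by auto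
    have Gv: "G x *\<^sub>v v = v + t \<cdot>\<^sub>v (c x *\<^sub>v v)" if v: "v \<in> carrier_vec (\<beta> x)" for x v
      unfolding G_def using c[of x] v
      by (subst add_mult_distrib_mat_vec[of _ "\<beta> x" "\<beta> x"]) (auto simp: smult_mat_mult_vec[OF c v])
    have XG: "X a *\<^sub>v (G (src a) *\<^sub>v v) = G (tgt a) *\<^sub>v (M a *\<^sub>v v)"
      if a: "a \<in> arcs Q" and v: "v \<in> B (src a)" for a v
    proof -
      have vc: "v \<in> carrier_vec (\<beta> (src a))" using B_carrier[OF v] .
      define u where "u = G (src a) *\<^sub>v v"
      have u: "u \<in> carrier_vec (\<beta> (src a))" unfolding u_def using mult_mat_vec_carrier[OF G vc] .
      have lin: "A *\<^sub>v u = A *\<^sub>v v + t \<cdot>\<^sub>v (A *\<^sub>v (c (src a) *\<^sub>v v))"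
        if A: "A \<in> carrier_mat n (\<beta> (src a))" for A n
        unfolding u_def Gv[OF vc]
        using mult_add_distrib_mat_vec[OF A vc, of "t \<cdot>\<^sub>v (c (src a) *\<^sub>v v)"] cv[OF vc]
          mult_mat_vec[OF A cv[OF vc]] by simp
      have cu: "c (src a) *\<^sub>v u = c (src a) *\<^sub>v v"
        unfolding lin[OF c] cc[OF vc] using cv[OF vc]
        by (intro eq_vecI) (auto simp: cdim simp del: index_mult_mat_vec)
      note M1 = mult_carrier_mat[OF c M[OF a]] and M2 = mult_carrier_mat[OF M[OF a] c]
      note M3 = mult_carrier_mat[OF c M2]
      define m n where "m = M a *\<^sub>v v" and "n = M a *\<^sub>v (c (src a) *\<^sub>v v)"
      have mn: "m \<in> carrier_vec (\<beta> (tgt a))" "n \<in> carrier_vec (\<beta> (tgt a))"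
        unfolding m_def n_def using mult_mat_vec_carrier[OF M[OF a]] vc cv[OF vc] by auto
      have Mu: "M a *\<^sub>v u = m + t \<cdot>\<^sub>v n" unfolding lin[OF M[OF a]] m_def n_def ..
      have 1: "(c (tgt a) * M a) *\<^sub>v u = c (tgt a) *\<^sub>v m + t \<cdot>\<^sub>v (c (tgt a) *\<^sub>v n)"
        unfolding assoc_mult_mat_vec[OF c M[OF a] u] Mu using mn
        by (subst mult_add_distrib_mat_vec[OF c]) (auto simp: mult_mat_vec[OF c])
      have 2: "(M a * c (src a)) *\<^sub>v u = n"
        unfolding assoc_mult_mat_vec[OF M[OF a] c u] cu n_def ..
      have 3: "(c (tgt a) * (M a * c (src a))) *\<^sub>v u = c (tgt a) *\<^sub>v n"
        unfolding assoc_mult_mat_vec[OF c M2 u] 2 ..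
      have "X a *\<^sub>v u = M a *\<^sub>v u + t \<cdot>\<^sub>v ((c (tgt a) * M a) *\<^sub>v u) - t \<cdot>\<^sub>v ((M a * c (src a)) *\<^sub>v u)
          - (t * t) \<cdot>\<^sub>v ((c (tgt a) * (M a * c (src a))) *\<^sub>v u)"
      proof -
        have s: "(k \<cdot>\<^sub>m A) *\<^sub>v u = k \<cdot>\<^sub>v (A *\<^sub>v u)" if "A \<in> carrier_mat (\<beta> (tgt a)) (\<beta> (src a))" for k A
          using smult_mat_mult_vec[OF that u] .
        note S1 = smult_carrier_mat[OF M1, of t] and S2 = smult_carrier_mat[OF M2, of t]
          and S3 = smult_carrier_mat[OF M3, of "t * t"]
        have "X a = M a + t \<cdot>\<^sub>m (c (tgt a) * M a) - t \<cdot>\<^sub>m (M a * c (src a))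
            - (t * t) \<cdot>\<^sub>m (c (tgt a) * (M a * c (src a)))" using a unfolding X_def by simp
        then show ?thesis
          unfolding s[OF M1, symmetric] s[OF M2, symmetric] s[OF M3, symmetric]
          by (simp only: minus_mult_distrib_mat_vec[OF minus_carrier_mat[OF S2] S3 u]
              minus_mult_distrib_mat_vec[OF add_carrier_mat[OF S1] S2 u]
              add_mult_distrib_mat_vec[OF M[OF a] S1 u])
      qed
      also have "\<dots> = m + t \<cdot>\<^sub>v (c (tgt a) *\<^sub>v m)"
        unfolding Mu 1 2 3 using mn cv[OF mn(1)] cv[OF mn(2)]
        by (intro eq_vecI) (auto simp: algebra_simps cdim simp del: index_mult_mat_vec)
      also have "\<dots> = G (tgt a) *\<^sub>v (M a *\<^sub>v v)" using Gv[OF mn(1)] unfolding m_def by simp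
      finally show ?thesis unfolding u_def .
    qed
    have sub: "subrep Q \<beta> X (\<lambda>x. (*\<^sub>v) (G x) ` B x)"
      using vsub_image[OF G subrepD(1)[OF B]] XG MB by (intro subrepI) auto
    have "sdim (\<beta> x) ((*\<^sub>v) (G x) ` B x) = sdim (\<beta> x) (B x)" for x
    proof -
      have "v = 0\<^sub>v (\<beta> x)" if v: "v \<in> B x" "G x *\<^sub>v v = 0\<^sub>v (\<beta> x)" for v
      proof -
        have vc: "v \<in> carrier_vec (\<beta> x)" using B_carrier[OF v(1)] .
        have "e x *\<^sub>v (G x *\<^sub>v v) = e x *\<^sub>v v + t \<cdot>\<^sub>v (e x *\<^sub>v (c x *\<^sub>v v))"
          unfolding Gv[OF vc] using cv[OF vc]
          by (subst mult_add_distrib_mat_vec[OF e_carrier vc]) (auto simp: mult_mat_vec[OF e_carrier])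
        also have "\<dots> = v" unfolding e_id[OF v(1)] ec[OF vc] using vc by (intro eq_vecI) auto
        finally show ?thesis unfolding v(2) using mult_mat_zero_vec[OF e_carrier] by simp
      qed
      then have ker: "{v \<in> B x. G x *\<^sub>v v = 0\<^sub>v (\<beta> x)} = {0\<^sub>v (\<beta> x)}"
        using vsubD(2)[OF subrepD(1)[OF B]] mult_mat_zero_vec[OF G] by auto
      show ?thesis using rank_nullity[OF G subrepD(1)[OF B], of x] unfolding ker sdim_zero by simp
    qed
    then have "(\<lambda>x. sdim (\<beta> x) (B x)) \<in> dims X" using dimsI[OF sub] by simp
    moreover have "X a $$ (i, j) = W a $$ (i, j) + t * (V a $$ (i, j) + t * (R0 a $$ (i, j) + t * R1 a $$ (i, j)))"
      if a: "a \<in> arcs Q" and i: "i < \<beta> (tgt a)" and j: "j < \<beta> (src a)" for a i j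
    proof -
      have tP: "t \<cdot>\<^sub>m P a \<in> carrier_mat (\<beta> (tgt a)) (\<beta> (src a))" using P[OF a] by auto
      have s1: "c (tgt a) * M a = c (tgt a) * W a + t \<cdot>\<^sub>m (c (tgt a) * P a)"
        unfolding M_def mult_add_distrib_mat[OF c Wa[OF a] tP] mult_smult_distrib[OF c P[OF a]] ..
      have s2: "M a * c (src a) = W a * c (src a) + t \<cdot>\<^sub>m (P a * c (src a))"
        unfolding M_def add_mult_distrib_mat[OF Wa[OF a] tP c] mult_smult_assoc_mat[OF P[OF a] c] ..
      have s3: "c (tgt a) * (M a * c (src a)) = c (tgt a) * (W a * c (src a)) + t \<cdot>\<^sub>m (c (tgt a) * (P a * c (src a)))"
        unfolding s2 mult_add_distrib_mat[OF c mult_carrier_mat[OF Wa[OF a] c] smult_carrier_mat[OF mult_carrier_mat[OF P[OF a] c]]]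
          mult_smult_distrib[OF c mult_carrier_mat[OF P[OF a] c]] ..
      define cW cP Wc Pc cWc cPc where abb: "cW = (c (tgt a) * W a)" "cP = (c (tgt a) * P a)"
        "Wc = (W a * c (src a))" "Pc = (P a * c (src a))" "cWc = c (tgt a) * Wc" "cPc = c (tgt a) * Pc"
      have dims: "cW \<in> carrier_mat (\<beta> (tgt a)) (\<beta> (src a))" "cP \<in> carrier_mat (\<beta> (tgt a)) (\<beta> (src a))"
         "Wc \<in> carrier_mat (\<beta> (tgt a)) (\<beta> (src a))" "Pc \<in> carrier_mat (\<beta> (tgt a)) (\<beta> (src a))"
         "cWc \<in> carrier_mat (\<beta> (tgt a)) (\<beta> (src a))" "cPc \<in> carrier_mat (\<beta> (tgt a)) (\<beta> (src a))"
        unfolding abb using mult_carrier_mat[OF c Wa[OF a]] mult_carrier_mat[OF c P[OF a]]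
          mult_carrier_mat[OF Wa[OF a] c] mult_carrier_mat[OF P[OF a] c]
          mult_carrier_mat[OF c mult_carrier_mat[OF Wa[OF a] c]]
          mult_carrier_mat[OF c mult_carrier_mat[OF P[OF a] c]] by auto
      have P_ij: "P a $$ (i, j) = V a $$ (i, j) - cW $$ (i, j) + Wc $$ (i, j)"
        using i j dims(1,3) Va[OF a] unfolding P_def abb(1,3)[symmetric] by simp
      have R0_ij: "R0 a $$ (i, j) = cP $$ (i, j) - Pc $$ (i, j) - cWc $$ (i, j)"
        using a i j dims unfolding R0_def by (simp add: abb[symmetric])
      have R1_ij: "R1 a $$ (i, j) = - cPc $$ (i, j)"
        using a i j dims unfolding R1_def by (simp add: abb[symmetric])
      have M_ij: "M a $$ (i, j) = W a $$ (i, j) + t * P a $$ (i, j)"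
        using i j P[OF a] Wa[OF a] unfolding M_def by simp
      have "X a = M a + t \<cdot>\<^sub>m (cW + t \<cdot>\<^sub>m cP) - t \<cdot>\<^sub>m (Wc + t \<cdot>\<^sub>m Pc) - (t * t) \<cdot>\<^sub>m (cWc + t \<cdot>\<^sub>m cPc)"
      proof -
        have "X a = M a + t \<cdot>\<^sub>m (c (tgt a) * M a) - t \<cdot>\<^sub>m (M a * c (src a))
            - (t * t) \<cdot>\<^sub>m (c (tgt a) * (M a * c (src a)))" using a unfolding X_def by simp
        then show ?thesis unfolding s3 unfolding s1 s2 by (simp add: abb[symmetric])
      qed
      then have "X a $$ (i, j) = M a $$ (i, j) + t * (cW $$ (i, j) + t * cP $$ (i, j))
          - t * (Wc $$ (i, j) + t * Pc $$ (i, j)) - (t * t) * (cWc $$ (i, j) + t * cPc $$ (i, j))"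
        using i j dims M[OF a] by simp
      then show ?thesis unfolding M_ij P_ij R0_ij R1_ij by (simp add: algebra_simps)
    qed
    ultimately show ?thesis using X by blast
  qed
  then show ?thesis using R by blast
qed

text \<open>
  Let \<open>F k\<close> be the Taylor terms of \<open>g\<close> at \<open>W\<close>. Along the deformation with direction \<open>V\<close> the polynomial
  \<open>g\<close> vanishes, while its expansion starts with \<open>t ^ k * F k V\<close> if the terms below \<open>k\<close> are
  known to be zero. So all Taylor terms are zero.
\<close>
lemma vanishing_if_split:
  assumes W: "W \<in> Rep Q \<beta>" and B: "subrep Q \<beta> W B"
    and proj: "\<And>x. projection (\<beta> x) (e x) (B x)"
    and split: "\<And>V. V \<in> Rep Q \<beta> \<Longrightarrow> coboundary e W B V"
    and g: "g \<in> rep_polynomials Q \<beta>"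
    and van: "\<And>X. X \<in> Rep Q \<beta> \<Longrightarrow> (\<lambda>x. sdim (\<beta> x) (B x)) \<in> dims X \<Longrightarrow> g X = 0"
    and X: "X \<in> Rep Q \<beta>"
  shows "g X = 0"
proof -
  obtain n F where F: "\<And>k. k \<le> n \<Longrightarrow> F k \<in> rep_polynomials Q \<beta>"
    and taylor: "\<And>X Y t. (\<forall>a\<in>arcs Q. \<forall>i<\<beta> (tgt a). \<forall>j<\<beta> (src a). X a $$ (i, j) = W a $$ (i, j) + t * Y a $$ (i, j))
      \<Longrightarrow> g X = (\<Sum>k\<le>n. t ^ k * F k Y)"
    using rep_polynomial_taylor[OF g, of W] by blast
  have F0: "F k V = 0" if "k \<le> n" "V \<in> Rep Q \<beta>" for k V
    using that
  proof (induction k arbitrary: V rule: less_induct)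
    case (less k)
    note V = less.prems(2)
    obtain c where c: "\<And>x. c x \<in> carrier_mat (\<beta> x) (\<beta> x)"
      "\<And>x v. v \<in> carrier_vec (\<beta> x) \<Longrightarrow> c x *\<^sub>v (e x *\<^sub>v v) = c x *\<^sub>v v"
      "\<And>x v. v \<in> carrier_vec (\<beta> x) \<Longrightarrow> e x *\<^sub>v (c x *\<^sub>v v) = 0\<^sub>v (\<beta> x)"
      "\<And>a v. a \<in> arcs Q \<Longrightarrow> v \<in> B (src a) \<Longrightarrow>
         compl e (tgt a) *\<^sub>v (V a *\<^sub>v v) + compl e (tgt a) *\<^sub>v (W a *\<^sub>v (c (src a) *\<^sub>v v)) = c (tgt a) *\<^sub>v (W a *\<^sub>v v)"
      using split[OF V] unfolding coboundary_def by blast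
    obtain R0 R1 where R: "\<And>t. \<exists>X\<in>Rep Q \<beta>.
     (\<lambda>x. sdim (\<beta> x) (B x)) \<in> dims X \<and>
     (\<forall>a\<in>arcs Q. \<forall>i<\<beta> (tgt a). \<forall>j<\<beta> (src a).
       X a $$ (i, j) = W a $$ (i, j) + t * (V a $$ (i, j) + t * (R0 a $$ (i, j) + t * R1 a $$ (i, j))))"
      using deformation_curve[OF W V B proj c] by blast
    define Y where "Y t = (\<lambda>a\<in>arcs Q. Matrix.mat (\<beta> (tgt a)) (\<beta> (src a))
      (\<lambda>(i, j). V a $$ (i, j) + t * (R0 a $$ (i, j) + t * R1 a $$ (i, j))))" for t
    have Y: "Y t \<in> Rep Q \<beta>" for t unfolding Y_def by (rule Rep_mat)
    have sum0: "(\<Sum>l\<le>n. t ^ l * F l (Y t)) = 0" for t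
    proof -
      obtain X where X: "X \<in> Rep Q \<beta>" "(\<lambda>x. sdim (\<beta> x) (B x)) \<in> dims X"
        "\<forall>a\<in>arcs Q. \<forall>i<\<beta> (tgt a). \<forall>j<\<beta> (src a). X a $$ (i, j) = W a $$ (i, j) + t * Y t a $$ (i, j)"
        using R[of t] unfolding Y_def by auto
      show ?thesis using taylor[OF X(3)] van[OF X(1,2)] by simp
    qed
    have "\<exists>q. \<forall>t. F l (Y t) = poly q t" if "l \<le> n" for l
    proof (rule rep_polynomial_curve[OF F[OF that]])
      fix a i j assume "a \<in> arcs Q" "i < \<beta> (tgt a)" "j < \<beta> (src a)"
      then show "\<exists>q. \<forall>t. Y t a $$ (i, j) = poly q t"
        by (intro exI[of _ "[:V a $$ (i, j), R0 a $$ (i, j), R1 a $$ (i, j):]"]) (auto simp: Y_def)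
    qed
    then obtain q where q: "\<And>l t. l \<le> n \<Longrightarrow> F l (Y t) = poly (q l) t" by metis
    define p where "p = (\<Sum>l\<in>{k..n}. Polynomial.monom 1 (l - k) * q l)"
    have "poly p t = 0" if t: "t \<noteq> 0" for t
    proof -
      have "0 = (\<Sum>l\<le>n. t ^ l * F l (Y t))" using sum0 by simp
      also have "\<dots> = (\<Sum>l\<in>{k..n}. t ^ l * F l (Y t))"
        using less.IH[OF _ _ Y] by (intro sum.mono_neutral_right) auto
      also have "\<dots> = (\<Sum>l\<in>{k..n}. t ^ k * (t ^ (l - k) * poly (q l) t))"
        by (intro sum.cong) (auto simp: q mult.assoc[symmetric] power_add[symmetric])
      also have "\<dots> = t ^ k * poly p t"
        unfolding p_def by (simp add: poly_sum poly_monom sum_distrib_left)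
      finally show ?thesis using t by simp
    qed
    then have "p = 0" by (rule poly_eq_0_if_off_0)
    then have "0 = poly p 0" by simp
    also have "\<dots> = (\<Sum>l\<in>{k..n}. if l = k then poly (q k) 0 else 0)"
      unfolding p_def poly_sum by (rule sum.cong) (auto simp: poly_monom power_0_left)
    also have "\<dots> = F k (Y 0)" using less.prems(1) by (simp add: q)
    also have "\<dots> = F k V"
      by (intro rep_polynomial_cong[OF F[OF less.prems(1)]]) (auto simp: Y_def)
    finally show ?case by simp
  qed
  define Y where "Y = (\<lambda>a\<in>arcs Q. Matrix.mat (\<beta> (tgt a)) (\<beta> (src a)) (\<lambda>(i, j). X a $$ (i, j) - W a $$ (i, j)))"
  have "g X = (\<Sum>k\<le>n. 1 ^ k * F k Y)" by (rule taylor) (auto simp: Y_def)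
  also have "\<dots> = 0" using F0 Rep_mat[of "\<lambda>a (i, j). X a $$ (i, j) - W a $$ (i, j)"] unfolding Y_def
    by (intro sum.neutral) auto
  finally show ?thesis .
qed

end

section \<open>Quiver Grassmannians are closed\<close>

text \<open>
  Cofactors of a column do not involve that column.
\<close>
lemma det_replace_col:
  fixes A :: "complex mat"
  assumes A: "A \<in> carrier_mat n n" and l: "l < n"
  shows "det (replace_col A v l) = (\<Sum>i<n. vec_index v i * cofactor A i l)"
proof -
  have R: "replace_col A v l \<in> carrier_mat n n" using A unfolding replace_col_def by auto
  have "cofactor (replace_col A v l) i l = cofactor A i l" if "i < n" for i
  proof -
    have "mat_delete (replace_col A v l) i l = mat_delete A i l"
      using A l that unfolding mat_delete_def replace_col_def by (intro eq_matI) auto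
    then show ?thesis unfolding cofactor_def by simp
  qed
  moreover have "replace_col A v l $$ (i, l) = vec_index v i" if "i < n" for i
    using that A l unfolding replace_col_def by auto
  ultimately show ?thesis using laplace_expansion_column[OF R l] by simp
qed

lemma cofactor_row_sum:
  fixes A :: "complex mat"
  assumes A: "A \<in> carrier_mat n n" and "i < n" "k < n"
  shows "(\<Sum>j<n. A $$ (i, j) * cofactor A k j) = (if i = k then det A else 0)"
proof -
  have "(\<Sum>j<n. A $$ (i, j) * cofactor A k j) = (A * adj_mat A) $$ (i, k)"
    using assms adj_mat(1)[OF A]
    by (auto simp: scalar_prod_def adj_mat_def lessThan_atLeast0 intro!: sum.cong)
  also have "\<dots> = (if i = k then det A else 0)" using assms by (simp add: adj_mat(2)[OF A])
  finally show ?thesis .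
qed

text \<open>
  A slot \<open>l < N\<close> belongs to the vertex \<open>\<tau> l\<close>, and there are \<open>d x\<close> slots at \<open>x\<close>. All vertices are treated at
  once: a family of subspaces of dimensions \<open>d x\<close> has Pluecker coordinates \<open>p J\<close> indexed by the
  choices \<open>J\<close> of one coordinate \<open>J l < \<beta> (\<tau> l)\<close> for each slot, up to sign the products of the maximal
  minors at the vertices. This gives a single set of homogeneous coordinates.
\<close>
locale slots = quiver Q \<beta> for Q :: "('v::finite, 'a) pre_digraph" and \<beta> :: "'v \<Rightarrow> nat" +
  fixes d :: "'v \<Rightarrow> nat" and N :: nat and \<tau> :: "nat \<Rightarrow> 'v"
  assumes card_slots: "\<And>x. card {l. l < N \<and> \<tau> l = x} = d x"
begin

definition idx :: "(nat \<Rightarrow> nat) set" where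
  "idx = PiE {..<N} (\<lambda>l. {..<\<beta> (\<tau> l)})"

lemma idx_lt: "J \<in> idx \<Longrightarrow> l < N \<Longrightarrow> J l < \<beta> (\<tau> l)"
  unfolding idx_def by (auto simp: PiE_iff)

lemma idx_upd: "J \<in> idx \<Longrightarrow> l < N \<Longrightarrow> i < \<beta> (\<tau> l) \<Longrightarrow> J(l := i) \<in> idx"
  unfolding idx_def by (auto simp: PiE_iff extensional_def)

lemma finite_idx: "finite idx"
  unfolding idx_def by (auto intro!: finite_PiE)

definition alternating :: "((nat \<Rightarrow> nat) \<Rightarrow> complex) \<Rightarrow> bool" where
  "alternating p \<longleftrightarrow> (\<forall>J\<in>idx. \<forall>l<N. \<forall>m<N. l \<noteq> m \<and> \<tau> l = \<tau> m \<and> J l = J m \<longrightarrow> p J = 0)"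

text \<open>
  For fixed \<open>J\<close> and \<open>l\<close> the vector with entries \<open>p (J(l := j))\<close> lies in the subspace at \<open>\<tau> l\<close>. A vector \<open>y\<close> lies in the
  subspace at \<open>x\<close> iff \<open>p J' * y\<^sub>i\<close> is, for all \<open>J'\<close> and \<open>i\<close>, the sum of \<open>y\<^bsub>J' m\<^esub> * p (J'(m := i))\<close> over the slots \<open>m\<close> at \<open>x\<close>
  (Cramer's rule). So this says that the arrows map the subspaces into each other; together with \<open>alternating\<close> it suffices to recover
  a subrepresentation from \<open>p\<close>.
\<close>
definition incidence :: "('a \<Rightarrow> complex mat) \<Rightarrow> ((nat \<Rightarrow> nat) \<Rightarrow> complex) \<Rightarrow> bool" where
  "incidence W p \<longleftrightarrow> (\<forall>a\<in>arcs Q. \<forall>J\<in>idx. \<forall>J'\<in>idx. \<forall>l<N. \<forall>i<\<beta> (tgt a). \<tau> l = src a \<longrightarrow>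
     p J' * (\<Sum>j<\<beta> (src a). W a $$ (i, j) * p (J(l := j))) =
     (\<Sum>m | m < N \<and> \<tau> m = tgt a. (\<Sum>j<\<beta> (src a). W a $$ (J' m, j) * p (J(l := j))) * p (J'(m := i))))"

text \<open>
  Fix \<open>J\<close> with \<open>p J \<noteq> 0\<close> and let \<open>U x\<close> be the solutions of the Cramer equations for this \<open>J\<close> alone.
  A solution is determined by its coordinates \<open>J m\<close>, and \<open>alternating\<close> makes the vectors with entries
  \<open>p (J(m := i)) / p J\<close> the dual basis, an echelon basis of \<open>U x\<close>.
\<close>
lemma subrep_of_coordinates:
  assumes W: "W \<in> Rep Q \<beta>" and alt: "alternating p" and inc: "incidence W p"
    and J: "J \<in> idx" "p J \<noteq> 0"
  shows "d \<in> dims W"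
proof -
  let ?M = "\<lambda>x. {m. m < N \<and> \<tau> m = x}"
  define U where "U x = {y \<in> carrier_vec (\<beta> x). \<forall>i<\<beta> x. p J * vec_index y i = (\<Sum>m\<in>?M x. vec_index y (J m) * p (J(m := i)))}" for x
  have Jlt: "J m < \<beta> x" if "m \<in> ?M x" for m x using idx_lt[OF J(1)] that by auto
  have Us: "vsub (\<beta> x) (U x)" for x
  proof (rule vsubI)
    show "U x \<subseteq> carrier_vec (\<beta> x)" unfolding U_def by auto
    have "(\<Sum>m\<in>?M x. vec_index (0\<^sub>v (\<beta> x)) (J m) * p (J(m := i))) = 0" for i
      using Jlt by (intro sum.neutral) auto
    then show "0\<^sub>v (\<beta> x) \<in> U x" unfolding U_def by auto
    show "v + w \<in> U x" if "v \<in> U x" "w \<in> U x" for v w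
    proof -
      have vw: "v \<in> carrier_vec (\<beta> x)" "w \<in> carrier_vec (\<beta> x)" using that unfolding U_def by auto
      have "(\<Sum>m\<in>?M x. vec_index (v + w) (J m) * p (J(m := i))) =
         (\<Sum>m\<in>?M x. vec_index v (J m) * p (J(m := i))) + (\<Sum>m\<in>?M x. vec_index w (J m) * p (J(m := i)))" for i
        unfolding sum.distrib[symmetric] using vw Jlt by (intro sum.cong) (auto simp: distrib_right)
      then show ?thesis using that vw unfolding U_def by (auto simp: distrib_left)
    qed
    show "c \<cdot>\<^sub>v v \<in> U x" if "v \<in> U x" for c v
    proof -
      have v: "v \<in> carrier_vec (\<beta> x)" using that unfolding U_def by auto
      have "(\<Sum>m\<in>?M x. vec_index (c \<cdot>\<^sub>v v) (J m) * p (J(m := i))) =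
         c * (\<Sum>m\<in>?M x. vec_index v (J m) * p (J(m := i)))" for i
        unfolding sum_distrib_left using v Jlt by (intro sum.cong) auto
      then show ?thesis using that v unfolding U_def by (auto simp: mult.left_commute)
    qed
  qed
  have sub: "subrep Q \<beta> W U"
  proof (rule subrepI[OF Us])
    fix a y assume a: "a \<in> arcs Q" and y: "y \<in> U (src a)"
    have yc: "y \<in> carrier_vec (\<beta> (src a))" using y unfolding U_def by auto
    define \<kappa> where "\<kappa> m = vec_index y (J m) / p J" for m
    define z where "z m i = (\<Sum>j<\<beta> (src a). W a $$ (i, j) * p (J(m := j)))" for m i
    have y_eq: "vec_index y j = (\<Sum>m\<in>?M (src a). \<kappa> m * p (J(m := j)))" if "j < \<beta> (src a)" for j
    proof -
      have "p J * vec_index y j = (\<Sum>m\<in>?M (src a). vec_index y (J m) * p (J(m := j)))" using y that unfolding U_def by auto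
      also have "\<dots> = p J * (\<Sum>m\<in>?M (src a). \<kappa> m * p (J(m := j)))"
        unfolding sum_distrib_left \<kappa>_def using J(2) by (intro sum.cong) auto
      finally show ?thesis using J(2) by simp
    qed
    have Wy: "vec_index (W a *\<^sub>v y) i = (\<Sum>m\<in>?M (src a). \<kappa> m * z m i)" if i: "i < \<beta> (tgt a)" for i
    proof -
      have "vec_index (W a *\<^sub>v y) i = (\<Sum>j<\<beta> (src a). W a $$ (i, j) * vec_index y j)"
        by (rule mult_mat_vec_index[OF RepD[OF W a] yc i])
      also have "\<dots> = (\<Sum>j<\<beta> (src a). \<Sum>m\<in>?M (src a). \<kappa> m * (W a $$ (i, j) * p (J(m := j))))"
        by (intro sum.cong) (auto simp: y_eq sum_distrib_left mult_ac)
      also have "\<dots> = (\<Sum>m\<in>?M (src a). \<kappa> m * z m i)"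
        unfolding z_def sum_distrib_left by (rule sum.swap)
      finally show ?thesis .
    qed
    have "p J * vec_index (W a *\<^sub>v y) i = (\<Sum>n\<in>?M (tgt a). vec_index (W a *\<^sub>v y) (J n) * p (J(n := i)))"
      if i: "i < \<beta> (tgt a)" for i
    proof -
      have "p J * vec_index (W a *\<^sub>v y) i = (\<Sum>m\<in>?M (src a). \<kappa> m * (p J * z m i))"
        unfolding Wy[OF i] by (simp add: sum_distrib_left mult_ac)
      also have "\<dots> = (\<Sum>m\<in>?M (src a). \<kappa> m * (\<Sum>n\<in>?M (tgt a). z m (J n) * p (J(n := i))))"
        using inc a J(1) i unfolding incidence_def z_def by (intro sum.cong) auto
      also have "\<dots> = (\<Sum>m\<in>?M (src a). \<Sum>n\<in>?M (tgt a). \<kappa> m * z m (J n) * p (J(n := i)))"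
        by (simp add: sum_distrib_left mult_ac)
      also have "\<dots> = (\<Sum>n\<in>?M (tgt a). \<Sum>m\<in>?M (src a). \<kappa> m * z m (J n) * p (J(n := i)))"
        by (rule sum.swap)
      also have "\<dots> = (\<Sum>n\<in>?M (tgt a). vec_index (W a *\<^sub>v y) (J n) * p (J(n := i)))"
        by (intro sum.cong refl) (simp add: Wy[OF Jlt] sum_distrib_right)
      finally show ?thesis .
    qed
    then show "W a *\<^sub>v y \<in> U (tgt a)"
      using mult_mat_vec_carrier[OF RepD[OF W a] yc] unfolding U_def by auto
  qed
  have "sdim (\<beta> x) (U x) = d x" for x
  proof -
    have rep: "p (J(m := J n)) = (if n = m then p J else 0)" if "m \<in> ?M x" "n \<in> ?M x" for m n
    proof (cases "n = m")
      case False
      have "J(m := J n) \<in> idx" using that(1) idx_upd[OF J(1), of m "J n"] Jlt[OF that(2)] by auto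
      then have "p (J(m := J n)) = 0" using alt False that unfolding alternating_def by (auto split: if_splits)
      then show ?thesis using False by simp
    qed auto
    have inj: "inj_on J (?M x)"
    proof (rule inj_onI, rule ccontr)
      fix m n assume "m \<in> ?M x" "n \<in> ?M x" "J m = J n" "m \<noteq> n"
      then show False using alt J unfolding alternating_def by auto
    qed
    define u where "u j = Matrix.vec (\<beta> x) (\<lambda>i. p (J((the_inv_into (?M x) J j) := i)) / p J)" for j
    have uJ: "u (J m) = Matrix.vec (\<beta> x) (\<lambda>i. p (J(m := i)) / p J)" if "m \<in> ?M x" for m
      unfolding u_def using the_inv_into_f_f[OF inj that] by simp
    have "u (J m) \<in> U x" if m: "m \<in> ?M x" for m
    proof -
      have "(\<Sum>n\<in>?M x. vec_index (u (J m)) (J n) * p (J(n := i))) = (\<Sum>n\<in>?M x. if n = m then p (J(m := i)) else 0)" for i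
        using Jlt J(2) by (intro sum.cong) (auto simp: uJ[OF m] rep[OF m])
      also have "\<dots>i = p (J(m := i))" for i using m by simp
      finally show ?thesis using J(2) unfolding U_def by (auto simp: uJ[OF m])
    qed
    moreover have "vec_index (u (J m)) (J n) = (if J n = J m then 1 else 0)" if "m \<in> ?M x" "n \<in> ?M x" for m n
      using that Jlt[OF that(2)] rep[OF that] J(2) inj by (auto simp: uJ inj_on_eq_iff)
    moreover have "v = 0\<^sub>v (\<beta> x)" if v: "v \<in> U x" "\<forall>j\<in>J ` ?M x. vec_index v j = 0" for v
    proof (rule eq_vecI)
      fix i assume "i < dim_vec (0\<^sub>v (\<beta> x) :: complex Matrix.vec)"
      then have i: "i < \<beta> x" by simp
      then have "p J * vec_index v i = 0" using v unfolding U_def by auto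
      then show "vec_index v i = vec_index (0\<^sub>v (\<beta> x)) i" using J(2) i by simp
    qed (use v in \<open>auto simp: U_def\<close>)
    ultimately have "echelon (\<beta> x) (U x) (J ` ?M x) u"
      unfolding echelon_def using Jlt by auto
    from sdim_echelon[OF Us this] show ?thesis using card_image[OF inj] card_slots by simp
  qed
  then show ?thesis using dimsI[OF sub] by simp
qed

text \<open>
  \<open>p J\<close> is the determinant of the block matrix that evaluates the coordinates \<open>J\<close> on
  bases of the subspaces. With echelon bases it is \<open>1\<close> at the echelon coordinates.
\<close>
lemma coordinates_of_subrep:
  assumes W: "W \<in> Rep Q \<beta>" and dW: "d \<in> dims W"
  shows "\<exists>p. (\<exists>J\<in>idx. p J \<noteq> 0) \<and> alternating p \<and> incidence W p"
proof -
  let ?M = "\<lambda>x. {m. m < N \<and> \<tau> m = x}"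
  obtain U where U: "subrep Q \<beta> W U" and dU: "d = (\<lambda>x. sdim (\<beta> x) (U x))" using dW by (rule dimsE)
  note Us = subrepD(1)[OF U]
  obtain I u where ech: "\<And>x. echelon (\<beta> x) (U x) (I x) (u x)" using echelon_exists[OF Us] by metis
  have Ifin: "finite (I x)" for x using ech[of x] finite_subset unfolding echelon_def by blast
  have "card (?M x) = card (I x)" for x using card_slots sdim_echelon[OF Us ech] dU by simp
  then have "\<exists>b. bij_betw b (?M x) (I x)" for x
    using Ifin by (intro finite_same_card_bij) auto
  then obtain b where b: "\<And>x. bij_betw (b x) (?M x) (I x)" by metis
  define J0 where "J0 = restrict (\<lambda>l. b (\<tau> l) l) {..<N}"
  have J0I: "J0 l \<in> I (\<tau> l)" if "l < N" for l
    using b[of "\<tau> l"] that unfolding J0_def bij_betw_def by auto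
  have J0inj: "J0 l = J0 m \<Longrightarrow> l = m" if "l < N" "m < N" "\<tau> l = \<tau> m" for l m
    using b[of "\<tau> l"] that unfolding J0_def bij_betw_def inj_on_def by auto
  have J0_bij: "bij_betw J0 (?M x) (I x)" for x
    using b[of x] by (rule bij_betw_cong[THEN iffD1, rotated]) (auto simp: J0_def)
  have J0: "J0 \<in> idx"
    unfolding idx_def using J0I ech unfolding echelon_def J0_def by (fastforce simp: PiE_iff)
  define B where "B l = u (\<tau> l) (J0 l)" for l
  have B: "B l \<in> U (\<tau> l)" if "l < N" for l using ech[of "\<tau> l"] J0I[OF that] unfolding B_def echelon_def by auto
  define A where "A J = Matrix.mat N N (\<lambda>(c, l). if \<tau> c = \<tau> l then vec_index (B c) (J l) else 0)" for J
  have A: "A J \<in> carrier_mat N N" for J unfolding A_def by auto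
  define C where "C x i = Matrix.vec N (\<lambda>c. if \<tau> c = x then vec_index (B c) i else 0)" for x i
  define p where "p J = det (A J)" for J
  have A_upd: "A (J(l := i)) = replace_col (A J) (C (\<tau> l) i) l" if "l < N" for J l i
    unfolding A_def C_def replace_col_def using that by (intro eq_matI) auto
  have p_upd: "p (J(l := i)) = (\<Sum>c\<in>?M (\<tau> l). cofactor (A J) c l * vec_index (B c) i)" if l: "l < N" for J l i
  proof -
    have "p (J(l := i)) = (\<Sum>c<N. vec_index (C (\<tau> l) i) c * cofactor (A J) c l)"
      unfolding p_def A_upd[OF l] by (rule det_replace_col[OF A l])
    also have "\<dots> = (\<Sum>c\<in>?M (\<tau> l). cofactor (A J) c l * vec_index (B c) i)"
      by (rule sum.mono_neutral_cong_right) (auto simp: C_def)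
    finally show ?thesis .
  qed
  have "A J0 = 1\<^sub>m N"
  proof (rule eq_matI)
    fix c l assume "c < dim_row (1\<^sub>m N :: complex mat)" "l < dim_col (1\<^sub>m N :: complex mat)"
    then have cl: "c < N" "l < N" by auto
    show "A J0 $$ (c, l) = 1\<^sub>m N $$ (c, l)"
    proof (cases "\<tau> c = \<tau> l")
      case True
      then have "vec_index (B c) (J0 l) = (if J0 l = J0 c then 1 else 0)"
        using ech[of "\<tau> c"] J0I[OF cl(1)] J0I[OF cl(2)] unfolding B_def echelon_def by auto
      then show ?thesis using J0inj[OF cl True] cl True unfolding A_def by auto
    next
      case False
      then show ?thesis using cl unfolding A_def by auto
    qed
  qed (auto simp: A_def)
  then have p0: "p J0 \<noteq> 0" unfolding p_def by simp
  have alt: "alternating p"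
    unfolding alternating_def p_def
  proof (intro ballI allI impI)
    fix J l m assume J: "J \<in> idx" and lm: "l < N" "m < N" "l \<noteq> m \<and> \<tau> l = \<tau> m \<and> J l = J m"
    have "col (A J) l = col (A J) m" using lm unfolding A_def by (intro eq_vecI) auto
    then show "det (A J) = 0" using det_identical_columns[OF A] lm by blast
  qed
  have cramer: "p J * vec_index y i = (\<Sum>m\<in>?M x. vec_index y (J m) * p (J(m := i)))" if y: "y \<in> U x" and i: "i < \<beta> x"
    and J: "J \<in> idx" for J y i x
  proof -
    define \<gamma> where "\<gamma> c = vec_index y (J0 c)" for c
    have y_eq: "vec_index y k = (\<Sum>c\<in>?M x. \<gamma> c * vec_index (B c) k)" if k: "k < \<beta> x" for k
    proof -
      have "vec_index y k = (\<Sum>j\<in>I x. vec_index y j * vec_index (u x j) k)"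
        by (subst echelon_expand[OF Us ech y]) (simp add: k)
      also have "\<dots> = (\<Sum>c\<in>?M x. \<gamma> c * vec_index (B c) k)"
        unfolding sum.reindex_bij_betw[OF J0_bij, symmetric] by (intro sum.cong) (auto simp: B_def \<gamma>_def)
      finally show ?thesis .
    qed
    have basis: "p J * vec_index (B c) i = (\<Sum>m\<in>?M x. vec_index (B c) (J m) * p (J(m := i)))" if c: "c \<in> ?M x" for c
    proof -
      have cN: "c < N" "\<tau> c = x" using c by auto
      have "(\<Sum>m\<in>?M x. vec_index (B c) (J m) * p (J(m := i)))
        = (\<Sum>m\<in>?M x. \<Sum>c'\<in>?M x. A J $$ (c, m) * (cofactor (A J) c' m * vec_index (B c') i))"
        using cN by (intro sum.cong) (auto simp: p_upd A_def sum_distrib_left)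
      also have "\<dots> = (\<Sum>m<N. \<Sum>c'\<in>?M x. A J $$ (c, m) * (cofactor (A J) c' m * vec_index (B c') i))"
        using cN by (intro sum.mono_neutral_cong_left) (auto simp: A_def)
      also have "\<dots> = (\<Sum>c'\<in>?M x. (\<Sum>m<N. A J $$ (c, m) * cofactor (A J) c' m) * vec_index (B c') i)"
        by (subst sum.swap) (simp add: sum_distrib_right mult.assoc)
      also have "\<dots> = (\<Sum>c'\<in>?M x. if c' = c then det (A J) * vec_index (B c) i else 0)"
        using cN by (intro sum.cong) (auto simp: cofactor_row_sum[OF A])
      also have "\<dots> = p J * vec_index (B c) i" using c unfolding p_def by simp
      finally show ?thesis by simp
    qed
    have "p J * vec_index y i = (\<Sum>c\<in>?M x. \<gamma> c * (p J * vec_index (B c) i))"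
      unfolding y_eq[OF i] by (simp add: sum_distrib_left mult_ac)
    also have "\<dots> = (\<Sum>c\<in>?M x. \<Sum>m\<in>?M x. \<gamma> c * vec_index (B c) (J m) * p (J(m := i)))"
      using basis by (intro sum.cong) (auto simp: sum_distrib_left mult_ac)
    also have "\<dots> = (\<Sum>m\<in>?M x. \<Sum>c\<in>?M x. \<gamma> c * vec_index (B c) (J m) * p (J(m := i)))"
      by (rule sum.swap)
    also have "\<dots> = (\<Sum>m\<in>?M x. vec_index y (J m) * p (J(m := i)))"
      using idx_lt[OF J] by (intro sum.cong) (auto simp: y_eq sum_distrib_right)
    finally show ?thesis .
  qed
  have "incidence W p"
    unfolding incidence_def
  proof (intro ballI allI impI)
    fix a J J' l i
    assume a: "a \<in> arcs Q" and J: "J \<in> idx" "J' \<in> idx" and l: "l < N" and i: "i < \<beta> (tgt a)" and tl: "\<tau> l = src a"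
    define v where "v = Matrix.vec (\<beta> (src a)) (\<lambda>i. p (J(l := i)))"
    have "v = Matrix.vec (\<beta> (src a)) (\<lambda>i. \<Sum>c\<in>?M (src a). cofactor (A J) c l * vec_index (B c) i)"
      unfolding v_def p_upd[OF l] tl ..
    then have v: "v \<in> U (src a)"
      using vsub_lincomb[OF Us, of "?M (src a)" B "src a" "\<lambda>c. cofactor (A J) c l"] B by fastforce
    have "vec_index (W a *\<^sub>v v) k = (\<Sum>j<\<beta> (src a). W a $$ (k, j) * p (J(l := j)))" if "k < \<beta> (tgt a)" for k
      using mult_mat_vec_index[OF RepD[OF W a] _ that, of v] unfolding v_def by auto
    moreover have "p J' * vec_index (W a *\<^sub>v v) i = (\<Sum>m\<in>?M (tgt a). vec_index (W a *\<^sub>v v) (J' m) * p (J'(m := i)))"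
      using cramer[OF subrepD(2)[OF U a v] i J(2)] .
    moreover have "J' m < \<beta> (tgt a)" if "m \<in> ?M (tgt a)" for m using idx_lt[OF J(2), of m] that by auto
    ultimately show "p J' * (\<Sum>j<\<beta> (src a). W a $$ (i, j) * p (J(l := j))) =
     (\<Sum>m\<in>?M (tgt a). (\<Sum>j<\<beta> (src a). W a $$ (J' m, j) * p (J(l := j))) * p (J'(m := i)))"
      using i by simp
  qed
  then show ?thesis using J0 p0 alt by blast
qed

lemma closed_of_slots:
  assumes "idx \<noteq> {}"
  shows "zariski_closed Q \<beta> {W \<in> Rep Q \<beta>. d \<in> dims W}"
proof -
  interpret R: coefficient_ring "rep_polynomials Q \<beta>" by (rule coefficient_ring_polynomials)
  let ?R = "rep_polynomials Q \<beta>"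
  \<comment> \<open>the factor \<open>p K\<close> makes the linear conditions quadratic, as the elimination theorem wants equal degrees\<close>
  define F1 where "F1 = {\<lambda>(W :: 'a \<Rightarrow> complex mat) p. p K * p J :: complex | J K. J \<in> idx \<and> K \<in> idx \<and>
     (\<exists>l<N. \<exists>m<N. l \<noteq> m \<and> \<tau> l = \<tau> m \<and> J l = J m)}"
  define g where "g a J J' l i = (\<lambda>(W :: 'a \<Rightarrow> complex mat) p. p J' * (\<Sum>j<\<beta> (src a). W a $$ (i, j) * p (J(l := j))) +
     (- 1) * (\<Sum>m | m < N \<and> \<tau> m = tgt a. (\<Sum>j<\<beta> (src a). W a $$ (J' m, j) * p (J(l := j))) * p (J'(m := i))) :: complex)"
    for a J J' l i
  define F2 where "F2 = {g a J J' l i | a J J' l i. a \<in> arcs Q \<and> J \<in> idx \<and> J' \<in> idx \<and> l < N \<and> i < \<beta> (tgt a) \<and> \<tau> l = src a}"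
  have two: "(2 :: nat) = 1 + 1" by simp
  have inner: "(1, \<lambda>W p. \<Sum>j<\<beta> (src a). W a $$ (i, j) * p (J(l := j))) \<in> forms ?R idx"
    if "a \<in> arcs Q" "i < \<beta> (tgt a)" "J \<in> idx" "l < N" "\<tau> l = src a" for a i J l
  proof (rule R.forms_sum)
    fix j assume "j \<in> {..<\<beta> (src a)}"
    then have "(0 + 1, \<lambda>W p. W a $$ (i, j) * p (J(l := j))) \<in> forms ?R idx"
      using that by (intro forms.mult forms.coef forms.var rep_polynomials.coordinate idx_upd) auto
    then show "(1, \<lambda>W p. W a $$ (i, j) * p (J(l := j))) \<in> forms ?R idx" by simp
  qed simp
  have forms: "(2, f) \<in> forms ?R idx" if "f \<in> F1 \<union> F2" for f
  proof -
    from that have "f \<in> F1 \<or> f \<in> F2" by simp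
    then show ?thesis
    proof
      assume "f \<in> F1"
      then obtain J K where f: "f = (\<lambda>W p. p K * p J)" and JK: "J \<in> idx" "K \<in> idx"
        unfolding F1_def by blast
      show ?thesis unfolding f two by (intro forms.mult forms.var JK)
    next
      assume "f \<in> F2"
      then obtain a J J' l i where f: "f = g a J J' l i" and h: "a \<in> arcs Q" "J \<in> idx" "J' \<in> idx" "l < N" "i < \<beta> (tgt a)" "\<tau> l = src a"
        unfolding F2_def by blast
      show ?thesis unfolding f g_def two
      proof (intro forms.add R.forms_scale R.forms_sum)
        show "(1 + 1, \<lambda>W p. p J' * (\<Sum>j<\<beta> (src a). W a $$ (i, j) * p (J(l := j)))) \<in> forms ?R idx"
          using h by (intro forms.mult[OF forms.var inner]) auto
        fix m assume m: "m \<in> {m. m < N \<and> \<tau> m = tgt a}"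
        then have "J' m < \<beta> (tgt a)" "J'(m := i) \<in> idx" using idx_lt[OF h(3), of m] idx_upd[OF h(3), of m i] h(5) by auto
        then show "(1 + 1, \<lambda>W p. (\<Sum>j<\<beta> (src a). W a $$ (J' m, j) * p (J(l := j))) * p (J'(m := i))) \<in> forms ?R idx"
          using h by (intro forms.mult[OF inner forms.var]) auto
      qed simp
    qed
  qed
  obtain E where E: "E \<subseteq> ?R"
    "\<And>W. (\<exists>p. (\<exists>s\<in>idx. p s \<noteq> 0) \<and> (\<forall>f\<in>F1 \<union> F2. f W p = 0)) \<longleftrightarrow> (\<forall>g\<in>E. g W = 0)"
    using R.elimination[OF finite_idx assms, of 2 "F1 \<union> F2"] forms by auto
  have "d \<in> dims W \<longleftrightarrow> (\<forall>g\<in>E. g W = 0)" if W: "W \<in> Rep Q \<beta>" for W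
  proof -
    have F1: "(\<forall>f\<in>F1. f W p = 0) \<longleftrightarrow> alternating p" if ex: "\<exists>s\<in>idx. p s \<noteq> 0" for p
    proof
      obtain K where K: "K \<in> idx" "p K \<noteq> 0" using ex by blast
      assume van: "\<forall>f\<in>F1. f W p = 0"
      show "alternating p"
        unfolding alternating_def
      proof (intro ballI allI impI)
        fix J l m assume "J \<in> idx" "l < N" "m < N" "l \<noteq> m \<and> \<tau> l = \<tau> m \<and> J l = J m"
        then have "(\<lambda>W p. p K * p J) \<in> F1" unfolding F1_def using K(1) by blast
        from bspec[OF van this] have "p K * p J = 0" .
        then show "p J = 0" using K(2) by simp
      qed
    next
      assume alt: "alternating p"
      show "\<forall>f\<in>F1. f W p = 0"
      proof
        fix f assume "f \<in> F1"
        then obtain J K l m where f: "f = (\<lambda>W p. p K * p J)" and J: "J \<in> idx" "l < N" "m < N" "l \<noteq> m" "\<tau> l = \<tau> m" "J l = J m"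
          unfolding F1_def by blast
        then have "p J = 0" using alt unfolding alternating_def by blast
        then show "f W p = 0" unfolding f by simp
      qed
    qed
    have F2: "(\<forall>f\<in>F2. f W p = 0) \<longleftrightarrow> incidence W p" for p
    proof -
      have "(\<forall>f\<in>F2. f W p = 0) \<longleftrightarrow> (\<forall>a\<in>arcs Q. \<forall>J\<in>idx. \<forall>J'\<in>idx. \<forall>l<N. \<forall>i<\<beta> (tgt a). \<tau> l = src a \<longrightarrow> g a J J' l i W p = 0)"
        unfolding F2_def by blast
      also have "\<dots> \<longleftrightarrow> incidence W p" unfolding incidence_def g_def by simp
      finally show ?thesis .
    qed
    have "d \<in> dims W \<longleftrightarrow> (\<exists>p. (\<exists>s\<in>idx. p s \<noteq> 0) \<and> alternating p \<and> incidence W p)"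
      using subrep_of_coordinates[OF W] coordinates_of_subrep[OF W] by blast
    also have "\<dots> \<longleftrightarrow> (\<exists>p. (\<exists>s\<in>idx. p s \<noteq> 0) \<and> (\<forall>f\<in>F1 \<union> F2. f W p = 0))"
      unfolding ball_Un F2 using F1 by blast
    finally show ?thesis unfolding E(2) .
  qed
  then have "{W \<in> Rep Q \<beta>. d \<in> dims W} = {W \<in> Rep Q \<beta>. \<forall>f\<in>E. f W = 0}" by auto
  then show ?thesis unfolding zariski_closed_def using E(1) by blast
qed

end

context quiver
begin

lemma slots_exist: "\<exists>N \<tau>. \<forall>x::'v. card {l. l < (N::nat) \<and> \<tau> l = x} = d x"
proof -
  define S where "S = (SIGMA x:(UNIV :: 'v set). {..<d x})"
  have "finite S" unfolding S_def by auto
  then obtain h where h: "bij_betw h {0..<card S} S" using ex_bij_betw_nat_finite by blast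
  have "card {l. l < card S \<and> fst (h l) = x} = d x" for x
  proof -
    have "bij_betw h {l \<in> {0..<card S}. fst (h l) = x} {s \<in> S. fst s = x}"
      using h by (rule bij_betw_Collect) auto
    then have "card {l. l < card S \<and> fst (h l) = x} = card {s \<in> S. fst s = x}"
      using bij_betw_same_card by fastforce
    also have "{s \<in> S. fst s = x} = Pair x ` {..<d x}" unfolding S_def by auto
    also have "card (Pair x ` {..<d x}) = card {..<d x}" by (intro card_image) (auto simp: inj_on_def)
    also have "\<dots> = d x" by simp
    finally show ?thesis .
  qed
  then show ?thesis by (intro exI[of _ "card S"] exI[of _ "\<lambda>l. fst (h l)"]) auto
qed

theorem closed_dims: "zariski_closed Q \<beta> {W \<in> Rep Q \<beta>. d \<in> dims W}"
proof (cases "\<forall>x. d x \<le> \<beta> x")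
  case False
  then have "{W \<in> Rep Q \<beta>. d \<in> dims W} = {W \<in> Rep Q \<beta>. \<forall>f\<in>{\<lambda>_. 1 :: complex}. f W = 0}"
    using dims_le by auto
  then show ?thesis
    unfolding zariski_closed_def by (intro exI[of _ "{\<lambda>_. 1}"]) (auto intro: rep_polynomials.const)
next
  case True
  obtain N and \<tau> :: "nat \<Rightarrow> 'v" where card: "\<And>x. card {l. l < N \<and> \<tau> l = x} = d x" using slots_exist[of d] by blast
  interpret slots Q \<beta> d N \<tau> by unfold_locales (rule card)
  have "0 < \<beta> (\<tau> l)" if "l < N" for l
  proof -
    have "l \<in> {k. k < N \<and> \<tau> k = \<tau> l}" using that by simp
    then have "0 < card {k. k < N \<and> \<tau> k = \<tau> l}" by (intro card_gt_0_iff[THEN iffD2] conjI) auto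
    then show ?thesis using card True by (metis less_le_trans)
  qed
  then have "restrict (\<lambda>_. 0) {..<N} \<in> idx" unfolding idx_def by auto
  then show ?thesis by (intro closed_of_slots) auto
qed

end

section \<open>Semi-stability\<close>

lemma weight_add: "weight (\<sigma> + \<tau>) d = weight \<sigma> d + weight \<tau> d"
  unfolding weight_def by (simp add: sum.distrib distrib_right)

lemma weight_scaleR: "weight (c *\<^sub>R \<sigma>) d = c * weight \<sigma> d"
  unfolding weight_def by (simp add: sum_distrib_left mult.assoc)

lemma weight_diff: "weight (\<sigma> - \<tau>) d = weight \<sigma> d - weight \<tau> d"
  unfolding weight_def by (simp add: sum_subtractf left_diff_distrib)

lemmas weight_linear = weight_add weight_scaleR weight_diff

lemma weight_zero: "weight \<sigma> (\<lambda>x. 0) = 0" "weight 0 d = 0"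
  unfolding weight_def by auto

text \<open>
  Additivity on dimension vectors, in the form without subtraction that flips provide.
\<close>
lemma weight_exact:
  assumes "\<And>x. d x + b x = s x + p x"
  shows "weight \<sigma> d + weight \<sigma> b = weight \<sigma> s + weight \<sigma> p"
proof -
  have "real (d x) + real (b x) = real (s x) + real (p x)" for x
    using assms[of x] by (metis of_nat_add)
  then show ?thesis
    unfolding weight_def sum.distrib[symmetric] distrib_left[symmetric] by simp
qed

context quiver
begin

lemma Rep_ss_iff:
  "W \<in> Rep_ss Q \<beta> \<sigma> \<longleftrightarrow> W \<in> Rep Q \<beta> \<and> weight \<sigma> \<beta> = 0 \<and> (\<forall>d\<in>dims W. weight \<sigma> d \<le> 0)"
  unfolding Rep_ss_def dims_def by auto

lemma zariski_closed_empty: "zariski_closed Q \<beta> {}"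
  unfolding zariski_closed_def by (intro exI[of _ "{\<lambda>_. 1}"]) (auto intro: rep_polynomials.const)

lemma zariski_closed_Un:
  assumes "zariski_closed Q \<beta> Y" "zariski_closed Q \<beta> Z"
  shows "zariski_closed Q \<beta> (Y \<union> Z)"
proof -
  obtain F G where F: "F \<subseteq> rep_polynomials Q \<beta>" "Y = {W \<in> Rep Q \<beta>. \<forall>f\<in>F. f W = 0}"
    and G: "G \<subseteq> rep_polynomials Q \<beta>" "Z = {W \<in> Rep Q \<beta>. \<forall>f\<in>G. f W = 0}"
    using assms unfolding zariski_closed_def by blast
  let ?H = "(\<lambda>(f, g) W. f W * g W) ` (F \<times> G)"
  have "?H \<subseteq> rep_polynomials Q \<beta>" using F(1) G(1) by (auto intro: rep_polynomials.mult)
  moreover have "Y \<union> Z = {W \<in> Rep Q \<beta>. \<forall>f\<in>?H. f W = 0}" unfolding F(2) G(2) by auto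
  ultimately show ?thesis unfolding zariski_closed_def by blast
qed

lemma zariski_closed_UN:
  "finite I \<Longrightarrow> (\<And>i. i \<in> I \<Longrightarrow> zariski_closed Q \<beta> (Z i)) \<Longrightarrow> zariski_closed Q \<beta> (\<Union>i\<in>I. Z i)"
  by (induction I rule: finite_induct) (auto intro: zariski_closed_empty zariski_closed_Un)

lemma Rep_ss_open:
  assumes "weight \<sigma> \<beta> = 0"
  shows "zariski_open Q \<beta> (Rep_ss Q \<beta> \<sigma>)"
proof -
  let ?D = "{d. (\<forall>x. d x \<le> \<beta> x) \<and> weight \<sigma> d > 0}"
  have "Rep Q \<beta> - Rep_ss Q \<beta> \<sigma> = (\<Union>d\<in>?D. {W \<in> Rep Q \<beta>. d \<in> dims W})"
  proof -
    have "W \<notin> Rep_ss Q \<beta> \<sigma> \<longleftrightarrow> (\<exists>d\<in>?D. d \<in> dims W)" if "W \<in> Rep Q \<beta>" for W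
      using that assms dims_le[of _ W] unfolding Rep_ss_iff by (simp add: not_le) blast
    then show ?thesis by blast
  qed
  moreover have "finite ?D" using finite_bounded by (rule finite_subset[rotated]) auto
  then have "zariski_closed Q \<beta> (\<Union>d\<in>?D. {W \<in> Rep Q \<beta>. d \<in> dims W})"
    by (rule zariski_closed_UN) (rule closed_dims)
  ultimately show ?thesis unfolding zariski_open_def by (auto simp: Rep_ss_iff)
qed

text \<open>
  Closedness turns the vanishing of polynomials into the presence of subrepresentations.
\<close>
lemma generic_subI_vanishing:
  assumes "\<And>g X. g \<in> rep_polynomials Q \<beta> \<Longrightarrow> (\<And>X. X \<in> Rep Q \<beta> \<Longrightarrow> d \<in> dims X \<Longrightarrow> g X = 0) \<Longrightarrow>
    X \<in> Rep Q \<beta> \<Longrightarrow> g X = 0"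
  shows "generic_sub Q d \<beta>"
proof -
  obtain F where F: "F \<subseteq> rep_polynomials Q \<beta>" "{W \<in> Rep Q \<beta>. d \<in> dims W} = {W \<in> Rep Q \<beta>. \<forall>f\<in>F. f W = 0}"
    using closed_dims[of d] unfolding zariski_closed_def by blast
  have "d \<in> dims X" if X: "X \<in> Rep Q \<beta>" for X
  proof -
    have "g X = 0" if g: "g \<in> F" for g using assms[of g X] F g X by blast
    then show ?thesis using F(2) X by blast
  qed
  then show ?thesis unfolding generic_sub_iff by blast
qed

text \<open>
  If \<open>d\<close> is not general, some polynomial vanishes on the representations with a \<open>d\<close>-dimensional
  subrepresentation but not everywhere. These finitely many polynomials are nonzero at a common point.
\<close>
lemma general_representation:
  "\<exists>W\<in>Rep Q \<beta>. \<forall>d\<in>dims W. generic_sub Q d \<beta>"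
proof -
  let ?N = "{d. (\<forall>x. d x \<le> \<beta> x) \<and> \<not> generic_sub Q d \<beta>}"
  have "\<exists>g. g \<in> rep_polynomials Q \<beta> \<and> (\<forall>X\<in>Rep Q \<beta>. d \<in> dims X \<longrightarrow> g X = 0) \<and> (\<exists>W\<in>Rep Q \<beta>. g W \<noteq> 0)"
    if d: "d \<in> ?N" for d
  proof (rule ccontr)
    assume none: "\<not> ?thesis"
    have "generic_sub Q d \<beta>"
    proof (rule generic_subI_vanishing)
      fix g X assume g: "g \<in> rep_polynomials Q \<beta>" "\<And>X. X \<in> Rep Q \<beta> \<Longrightarrow> d \<in> dims X \<Longrightarrow> g X = 0" and X: "X \<in> Rep Q \<beta>"
      show "g X = 0" using none g X by meson
    qed
    then show False using d by simp
  qed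
  then obtain g where g: "\<And>d. d \<in> ?N \<Longrightarrow> g d \<in> rep_polynomials Q \<beta> \<and>
      (\<forall>X\<in>Rep Q \<beta>. d \<in> dims X \<longrightarrow> g d X = 0) \<and> (\<exists>W\<in>Rep Q \<beta>. g d W \<noteq> 0)"
    using bchoice[of ?N "\<lambda>d g. g \<in> rep_polynomials Q \<beta> \<and> (\<forall>X\<in>Rep Q \<beta>. d \<in> dims X \<longrightarrow> g X = 0) \<and>
      (\<exists>W\<in>Rep Q \<beta>. g W \<noteq> 0)"] by blast
  have "finite ?N" using finite_bounded by (rule finite_subset[rotated]) auto
  then have "\<exists>W\<in>Rep Q \<beta>. \<forall>h\<in>g ` ?N. h W \<noteq> 0"
    using g by (intro rep_polynomials_common_nonzero) blast+
  then obtain W where W: "W \<in> Rep Q \<beta>" "\<And>d. d \<in> ?N \<Longrightarrow> g d W \<noteq> 0" by blast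
  have "generic_sub Q d \<beta>" if "d \<in> dims W" for d
    using g[of d] W that dims_le[OF that] by blast
  then show ?thesis using W(1) by blast
qed

lemma Rep_ss_effective:
  assumes "W \<in> Rep_ss Q \<beta> \<sigma>"
  shows "\<sigma> \<in> effective_cone Q \<beta>"
  using assms unfolding effective_cone_def Rep_ss_iff generic_sub_iff by auto

lemma effective_Rep_ss_nonempty:
  assumes "\<sigma> \<in> effective_cone Q \<beta>"
  shows "Rep_ss Q \<beta> \<sigma> \<noteq> {}"
proof -
  obtain W where "W \<in> Rep Q \<beta>" "\<forall>d\<in>dims W. generic_sub Q d \<beta>" using general_representation by blast
  then have "W \<in> Rep_ss Q \<beta> \<sigma>" using assms unfolding effective_cone_def Rep_ss_iff by auto
  then show ?thesis by blast
qed

end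

context flip_datum
begin

lemma flip_weight:
  assumes "d \<in> dims W'"
  obtains s p where "s \<in> dims W" "p \<in> dims W"
    "\<And>\<tau>. weight \<tau> d + weight \<tau> (\<lambda>x. sdim (\<beta> x) (B x)) = weight \<tau> s + weight \<tau> p"
proof -
  obtain s p where "s \<in> dims W" "p \<in> dims W" "\<And>x. d x + sdim (\<beta> x) (B x) = s x + p x"
    using flip_dims[OF assms] by blast
  then show ?thesis using that weight_exact[of d "\<lambda>x. sdim (\<beta> x) (B x)" s p] by blast
qed

lemma flip_Rep_ss:
  assumes "W \<in> Rep_ss Q \<beta> \<tau>" "weight \<tau> (\<lambda>x. sdim (\<beta> x) (B x)) = 0"
  shows "W' \<in> Rep_ss Q \<beta> \<tau>"
proof -
  have "weight \<tau> d \<le> 0" if d: "d \<in> dims W'" for d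
  proof -
    obtain s p where sp: "s \<in> dims W" "p \<in> dims W"
      "weight \<tau> d + weight \<tau> (\<lambda>x. sdim (\<beta> x) (B x)) = weight \<tau> s + weight \<tau> p"
      by (rule flip_weight[OF d]) blast
    have "weight \<tau> s \<le> 0" "weight \<tau> p \<le> 0" using sp(1,2) assms(1) unfolding Rep_ss_iff by blast+
    then show ?thesis using sp(3) assms(2) by linarith
  qed
  then show ?thesis using assms(1) flip_Rep unfolding Rep_ss_iff by blast
qed

lemma weight_K: "weight \<tau> (\<lambda>x. sdim (\<beta> x) (B x)) + weight \<tau> (\<lambda>x. sdim (\<beta> x) (K x)) = weight \<tau> \<beta>"
  using weight_exact[of "\<lambda>x. sdim (\<beta> x) (B x)" "\<lambda>x. sdim (\<beta> x) (K x)" \<beta> "\<lambda>x. 0" \<tau>] K_dim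
  by (simp add: weight_zero)

end

context quiver
begin

text \<open>
  The extremal choice replaces a limit argument. \<open>\<mu> W\<close> is the largest value of \<open>\<sigma>\<close> on subrepresentations with
  \<open>\<tau> = 0\<close> and \<open>n W\<close> the smallest size of a subrepresentation attaining it. Flipping along a smallest maximiser \<open>B\<close> never increases \<open>\<mu>\<close>,
  and if \<open>\<mu>\<close> stays the same, a maximiser of the flip maps onto \<open>B\<close>, so \<open>n\<close> does not decrease. Among the
  representations with the least \<open>\<mu>\<close>, one with the largest \<open>n\<close> therefore has only flips in which the maximiser
  is a copy of \<open>B\<close> complementary to \<open>K\<close>.
\<close>
lemma flips_reach_semistable:
  assumes eff: "\<sigma> \<in> effective_cone Q \<beta>" and sub: "\<K> \<subseteq> Rep_ss Q \<beta> \<tau>" and ne: "\<K> \<noteq> {}"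
    and closed: "\<And>W B e C. W \<in> \<K> \<Longrightarrow> flip_datum Q \<beta> W B e C \<Longrightarrow>
      weight \<tau> (\<lambda>x. sdim (\<beta> x) (B x)) = 0 \<Longrightarrow> flip e W C \<in> \<K>"
  shows "\<exists>W\<in>\<K>. \<forall>d\<in>dims W. weight \<tau> d = 0 \<longrightarrow> weight \<sigma> d \<le> 0"
proof (rule ccontr)
  assume contra: "\<not> ?thesis"
  define size where "size d = (\<Sum>x\<in>UNIV. d x)" for d :: "'v \<Rightarrow> nat"
  define N where "N W = {d \<in> dims W. weight \<tau> d = 0}" for W
  define \<mu> where "\<mu> W = Max (weight \<sigma> ` N W)" for W
  define D where "D W = {d \<in> N W. weight \<sigma> d = \<mu> W}" for W
  define n where "n W = Min (size ` D W)" for W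
  have N: "finite (N W)" for W unfolding N_def using finite_dims by auto
  have N_ne: "N W \<noteq> {}" if "W \<in> \<K>" for W
  proof -
    have "W \<in> Rep Q \<beta>" using that sub by (auto simp: Rep_ss_iff)
    then have "(\<lambda>x. 0) \<in> N W" using zero_in_dims unfolding N_def by (auto simp: weight_zero)
    then show ?thesis by blast
  qed
  have \<mu>_ge: "weight \<sigma> d \<le> \<mu> W" if "d \<in> N W" for d W unfolding \<mu>_def using N that by simp
  have D: "finite (D W)" for W using N unfolding D_def by auto
  have D_ne: "D W \<noteq> {}" if "W \<in> \<K>" for W
    using Max_in[of "weight \<sigma> ` N W"] N N_ne[OF that] unfolding D_def \<mu>_def by fastforce
  have n_le: "n W \<le> size d" if "d \<in> D W" for d W unfolding n_def using D that by simp
  have n_ex: "\<exists>d\<in>D W. size d = n W" if "W \<in> \<K>" for W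
    using Min_in[of "size ` D W"] D D_ne[OF that] unfolding n_def by fastforce
  have \<mu>_pos: "\<mu> W > 0" if W: "W \<in> \<K>" for W
  proof -
    obtain d where "d \<in> dims W" "weight \<tau> d = 0" "weight \<sigma> d > 0"
      using contra W by (auto simp: not_le)
    then show ?thesis using \<mu>_ge[of d W] unfolding N_def by auto
  qed
  have "\<mu> ` \<K> \<subseteq> weight \<sigma> ` {d. \<forall>x. d x \<le> \<beta> x}"
  proof
    fix y assume "y \<in> \<mu> ` \<K>"
    then obtain W where W: "W \<in> \<K>" "y = \<mu> W" by auto
    then obtain d where "d \<in> D W" using D_ne by blast
    then show "y \<in> weight \<sigma> ` {d. \<forall>x. d x \<le> \<beta> x}"
      unfolding W(2) by (intro image_eqI[of _ _ d]) (auto simp: D_def N_def dims_le)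
  qed
  then have fin: "finite (\<mu> ` \<K>)" using finite_bounded finite_subset by blast
  define m where "m = Min (\<mu> ` \<K>)"
  have m_le: "m \<le> \<mu> W" if "W \<in> \<K>" for W unfolding m_def using fin that by simp
  define \<K>' where "\<K>' = {W \<in> \<K>. \<mu> W = m}"
  have "\<K>' \<noteq> {}" using Min_in[OF fin] ne unfolding \<K>'_def m_def by auto
  have "n ` \<K>' \<subseteq> {..size \<beta>}"
  proof
    fix k assume "k \<in> n ` \<K>'"
    then obtain W where W: "W \<in> \<K>" "k = n W" unfolding \<K>'_def by auto
    then obtain d where d: "d \<in> D W" "size d = n W" using n_ex by blast
    then have "size d \<le> size \<beta>" unfolding size_def D_def N_def by (intro sum_mono) (auto simp: dims_le)
    then show "k \<in> {..size \<beta>}" using d W by simp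
  qed
  then have fin': "finite (n ` \<K>')" using finite_subset by blast
  then have "Max (n ` \<K>') \<in> n ` \<K>'" using \<open>\<K>' \<noteq> {}\<close> by (intro Max_in) auto
  then obtain W where W: "W \<in> \<K>'" "n W = Max (n ` \<K>')" by fastforce
  have n_max: "n W' \<le> n W" if "W' \<in> \<K>'" for W' unfolding W(2) using fin' that by simp
  have W\<K>: "W \<in> \<K>" "\<mu> W = m" using W unfolding \<K>'_def by auto
  have Wss: "W \<in> Rep_ss Q \<beta> \<tau>" and WR: "W \<in> Rep Q \<beta>" using W\<K> sub by (auto simp: Rep_ss_iff)
  obtain b where b: "b \<in> D W" "size b = n W" using n_ex[OF W\<K>(1)] by blast
  then have bd: "b \<in> dims W" "weight \<tau> b = 0" "weight \<sigma> b = m" unfolding D_def N_def W\<K>(2) by auto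
  obtain B where B: "subrep Q \<beta> W B" and bB: "b = (\<lambda>x. sdim (\<beta> x) (B x))" using bd(1) by (rule dimsE)
  obtain e where e: "\<And>x. projection (\<beta> x) (e x) (B x)"
    using projection_exists[OF subrepD(1)[OF B]] by metis
  have split: "coboundary e W B V" if V: "V \<in> Rep Q \<beta>" for V
  proof -
    interpret flip_datum Q \<beta> W B e V using WR B V e by unfold_locales
    have W'\<K>: "W' \<in> \<K>" using closed[OF W\<K>(1) flip_datum_axioms] bd(2) unfolding bB by simp
    obtain d where d: "d \<in> D W'" "size d = n W'" using n_ex[OF W'\<K>] by blast
    then have dd: "d \<in> dims W'" "weight \<tau> d = 0" "weight \<sigma> d = \<mu> W'" unfolding D_def N_def by auto
    obtain U where U: "subrep Q \<beta> W' U" and dU: "d = (\<lambda>x. sdim (\<beta> x) (U x))" using dd(1) by (rule dimsE)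
    define S where "S x = (*\<^sub>v) (e x) ` U x" for x
    define P where "P x = {v \<in> carrier_vec (\<beta> x). compl e x *\<^sub>v v \<in> U x}" for x
    define s p where "s = (\<lambda>x. sdim (\<beta> x) (S x))" and "p = (\<lambda>x. sdim (\<beta> x) (P x))"
    have S: "subrep Q \<beta> W S" and P: "subrep Q \<beta> W P" and SB: "\<And>x. S x \<subseteq> B x" and BP: "\<And>x. B x \<subseteq> P x"
      using flip_subrep(1-4)[OF U] unfolding S_def P_def by auto
    have eqs: "d x + b x = s x + p x" for x
      using flip_subrep(5,6)[OF U, of x] unfolding dU bB s_def p_def S_def P_def by simp
    have sd: "s \<in> dims W" and pd: "p \<in> dims W" unfolding s_def p_def using dimsI[OF S] dimsI[OF P] by auto
    have "weight \<tau> s \<le> 0" "weight \<tau> p \<le> 0" using sd pd Wss unfolding Rep_ss_iff by blast+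
    then have "weight \<tau> s = 0" "weight \<tau> p = 0"
      using weight_exact[of d b s p \<tau>] eqs bd(2) dd(2) by auto
    then have sN: "s \<in> N W" and pN: "p \<in> N W" using sd pd unfolding N_def by auto
    have "weight \<sigma> s \<le> m" "weight \<sigma> p \<le> m" using \<mu>_ge[OF sN] \<mu>_ge[OF pN] W\<K>(2) by auto
    moreover have "\<mu> W' + m = weight \<sigma> s + weight \<sigma> p"
      using weight_exact[of d b s p \<sigma>] eqs bd(3) dd(3) by simp
    moreover have "m \<le> \<mu> W'" using m_le[OF W'\<K>] .
    ultimately have eq: "\<mu> W' = m" "weight \<sigma> s = m" "weight \<sigma> p = m" by linarith+
    have "W' \<in> \<K>'" using W'\<K> eq(1) unfolding \<K>'_def by simp
    then have size_d: "size d \<le> size b" using n_max d(2) b(2) by auto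
    have "s \<in> D W" using sN eq(2) W\<K>(2) unfolding D_def by simp
    then have size_s: "size b \<le> size s" using n_le b(2) by simp
    have s_le: "s x \<le> b x" and p_ge: "b x \<le> p x" for x
      using sdim_subset(1)[OF subrepD(1)[OF S] subrepD(1)[OF B] SB]
        sdim_subset(1)[OF subrepD(1)[OF B] subrepD(1)[OF P] BP] unfolding s_def bB p_def by auto
    have "(\<Sum>x\<in>UNIV. d x + b x) = (\<Sum>x\<in>UNIV. s x + p x)" using eqs by simp
    then have "size d + size b = size s + size p" unfolding size_def sum.distrib by simp
    then have size_p: "size p \<le> size b" using size_d size_s by simp
    have s_eq: "s x = b x" for x
    proof (rule ccontr)
      assume "s x \<noteq> b x"
      then have "s x < b x" using s_le[of x] by simp
      then have "size s < size b" unfolding size_def by (intro sum_strict_mono_ex1) (use s_le in auto)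
      then show False using size_s by simp
    qed
    have p_eq: "p x = b x" for x
    proof (rule ccontr)
      assume "p x \<noteq> b x"
      then have "b x < p x" using p_ge[of x] by simp
      then have "size b < size p" unfolding size_def by (intro sum_strict_mono_ex1) (use p_ge in auto)
      then show False using size_p by simp
    qed
    have surj: "(*\<^sub>v) (e x) ` U x = B x" for x
      using sdim_subset(2)[OF subrepD(1)[OF S] subrepD(1)[OF B] SB, of x] s_eq[of x]
      unfolding s_def bB S_def by simp
    have "sdim (\<beta> x) {v \<in> U x. e x *\<^sub>v v = 0\<^sub>v (\<beta> x)} = 0" for x
      using flip_subrep(6)[OF U, of x] p_eq[of x] unfolding p_def bB P_def by simp
    then have "{v \<in> U x. e x *\<^sub>v v = 0\<^sub>v (\<beta> x)} = {0\<^sub>v (\<beta> x)}" for x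
      by (intro sdim_eq_0D vsub_kernel[OF e_carrier subrepD(1)[OF U]])
    from split_flip[OF U this surj] show ?thesis .
  qed
  have "generic_sub Q b \<beta>"
    unfolding bB by (rule generic_subI_vanishing) (rule vanishing_if_split[OF WR B e split])
  then have "weight \<sigma> b \<le> 0" using eff unfolding effective_cone_def by auto
  then show False using bd(3) \<mu>_pos[OF W\<K>(1)] W\<K>(2) by simp
qed

text \<open>
  \<open>\<G> W\<close> is equivalent to \<open>\<G>\<close> for any flip of \<open>W\<close> along a subrepresentation with \<open>\<tau> = 0\<close>, so the \<open>\<tau>\<close>-semi-stable representations without
  \<open>\<G>\<close> are closed under flips. The one provided by \<open>flips_reach_semistable\<close> is semi-stable for \<open>\<tau>'\<close>
  and for the point beyond \<open>\<tau>\<close> as seen from \<open>\<tau>'\<close>; a subrepresentation with \<open>\<tau> = 0\<close> gets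
  opposite signs from these two weights, hence \<open>\<G>\<close> holds after all.
\<close>
lemma Rep_ss_subset_if:
  assumes eff: "\<sigma> \<in> effective_cone Q \<beta>" and \<delta>: "\<delta> > 0"
    and gen: "\<And>V. V \<in> Rep_ss Q \<beta> \<tau> \<Longrightarrow> (\<And>d. d \<in> dims V \<Longrightarrow> weight \<tau> d = 0 \<Longrightarrow> weight \<sigma> d \<le> 0) \<Longrightarrow>
      V \<in> Rep_ss Q \<beta> \<tau>' \<and> V \<in> Rep_ss Q \<beta> (\<tau> + \<delta> *\<^sub>R (\<tau> - \<tau>'))"
  shows "Rep_ss Q \<beta> \<tau> \<subseteq> Rep_ss Q \<beta> \<tau>'"
proof -
  define \<G> where "\<G> W \<longleftrightarrow> W \<in> Rep_ss Q \<beta> \<tau>' \<and> (\<forall>d\<in>dims W. weight \<tau> d = 0 \<longrightarrow> weight \<tau>' d = 0)" for W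
  define \<K> where "\<K> = {W \<in> Rep_ss Q \<beta> \<tau>. \<not> \<G> W}"
  have "\<K> = {}"
  proof (rule ccontr)
    assume ne: "\<K> \<noteq> {}"
    have "\<exists>W\<in>\<K>. \<forall>d\<in>dims W. weight \<tau> d = 0 \<longrightarrow> weight \<sigma> d \<le> 0"
    proof (rule flips_reach_semistable[OF eff _ ne])
      show "\<K> \<subseteq> Rep_ss Q \<beta> \<tau>" unfolding \<K>_def by auto
      fix W B e C assume W\<K>: "W \<in> \<K>" and "flip_datum Q \<beta> W B e C" and B0: "weight \<tau> (\<lambda>x. sdim (\<beta> x) (B x)) = 0"
      then interpret flip_datum Q \<beta> W B e C by simp
      have Wss: "W \<in> Rep_ss Q \<beta> \<tau>" using W\<K> unfolding \<K>_def by simp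
      have W'ss: "W' \<in> Rep_ss Q \<beta> \<tau>" using flip_Rep_ss[OF Wss B0] .
      interpret F: flip_datum Q \<beta> W' K f W
        using flip_Rep K_subrep W K_proj by unfold_locales
      have K0: "weight \<tau> (\<lambda>x. sdim (\<beta> x) (K x)) = 0" using weight_K[of \<tau>] B0 Wss by (simp add: Rep_ss_iff)
      have "\<G> W" if G: "\<G> W'"
      proof -
        have K'0: "weight \<tau>' (\<lambda>x. sdim (\<beta> x) (K x)) = 0"
          using G dimsI[OF K_subrep] K0 unfolding \<G>_def by blast
        have "W \<in> Rep_ss Q \<beta> \<tau>'" using F.flip_Rep_ss[OF _ K'0] G unfolding flip_flip \<G>_def by blast
        moreover have "weight \<tau>' d = 0" if d: "d \<in> dims W" "weight \<tau> d = 0" for d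
        proof -
          obtain s p where sp: "s \<in> dims W'" "p \<in> dims W'"
            "\<And>\<tau>. weight \<tau> d + weight \<tau> (\<lambda>x. sdim (\<beta> x) (K x)) = weight \<tau> s + weight \<tau> p"
            using F.flip_weight d(1) unfolding flip_flip by blast
          have "weight \<tau> s \<le> 0" "weight \<tau> p \<le> 0" using sp(1,2) W'ss unfolding Rep_ss_iff by blast+
          then have "weight \<tau> s = 0" "weight \<tau> p = 0" using sp(3)[of \<tau>] d(2) K0 by auto
          then have "weight \<tau>' s = 0" "weight \<tau>' p = 0" using G sp(1,2) unfolding \<G>_def by blast+
          then show ?thesis using sp(3)[of \<tau>'] K'0 by simp
        qed
        ultimately show ?thesis unfolding \<G>_def by blast
      qed
      then show "W' \<in> \<K>" using W\<K> W'ss unfolding \<K>_def by blast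
    qed
    then obtain V where V: "V \<in> \<K>" "\<And>d. d \<in> dims V \<Longrightarrow> weight \<tau> d = 0 \<Longrightarrow> weight \<sigma> d \<le> 0" by blast
    have Vss: "V \<in> Rep_ss Q \<beta> \<tau>'" "V \<in> Rep_ss Q \<beta> (\<tau> + \<delta> *\<^sub>R (\<tau> - \<tau>'))"
      using gen[of V] V unfolding \<K>_def by blast+
    have "weight \<tau>' d = 0" if d: "d \<in> dims V" "weight \<tau> d = 0" for d
    proof -
      have "weight \<tau>' d \<le> 0" using Vss(1) d(1) unfolding Rep_ss_iff by blast
      moreover have "weight (\<tau> + \<delta> *\<^sub>R (\<tau> - \<tau>')) d \<le> 0" using Vss(2) d(1) unfolding Rep_ss_iff by blast
      then have "- (\<delta> * weight \<tau>' d) \<le> 0" using d(2) by (simp add: weight_linear)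
      then have "weight \<tau>' d \<ge> 0" using \<delta> by (simp add: zero_le_mult_iff)
      ultimately show ?thesis by simp
    qed
    then show False using V(1) Vss(1) unfolding \<K>_def \<G>_def by blast
  qed
  then show ?thesis unfolding \<K>_def \<G>_def by blast
qed

end

section \<open>The fan of GIT-cones\<close>

lemma small_perturbation:
  fixes f g :: "'b \<Rightarrow> real"
  assumes "finite D" "\<And>d. d \<in> D \<Longrightarrow> f d \<le> 0" "\<And>d. d \<in> D \<Longrightarrow> f d = 0 \<Longrightarrow> g d \<le> 0"
  shows "\<exists>\<epsilon>>0. \<epsilon> < 1 \<and> (\<forall>d\<in>D. f d + \<epsilon> * g d \<le> 0)"
  using assms
proof (induction D rule: finite_induct)
  case empty
  show ?case by (intro exI[of _ "1 / 2"]) auto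
next
  case (insert d D)
  then obtain \<epsilon> where \<epsilon>: "\<epsilon> > 0" "\<epsilon> < 1" "\<forall>d\<in>D. f d + \<epsilon> * g d \<le> 0" by auto
  have "\<exists>\<eta>>0. f d + \<eta> * g d \<le> 0"
  proof (cases "f d = 0")
    case True
    then show ?thesis using insert.prems(2)[of d] by (intro exI[of _ 1]) auto
  next
    case False
    then have "f d < 0" using insert.prems(1)[of d] by simp
    then show ?thesis
      by (intro exI[of _ "- f d / (\<bar>g d\<bar> + 1)"]) (auto simp: field_simps abs_if mult_less_0_iff zero_less_mult_iff)
  qed
  then obtain \<eta> where \<eta>: "\<eta> > 0" "f d + \<eta> * g d \<le> 0" by blast
  have mono: "a + s * b \<le> 0" if "a \<le> 0" "a + t * b \<le> 0" "0 < s" "s \<le> t" for a b s t :: real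
  proof (cases "b \<le> 0")
    case True
    then have "s * b \<le> 0" using that by (simp add: mult_nonneg_nonpos)
    then show ?thesis using that by linarith
  next
    case False
    then have "s * b \<le> t * b" using that by (intro mult_right_mono) auto
    then show ?thesis using that by linarith
  qed
  have "\<forall>d'\<in>insert d D. f d' + min \<epsilon> \<eta> * g d' \<le> 0"
  proof
    fix d' assume d': "d' \<in> insert d D"
    have "f d' + \<epsilon> * g d' \<le> 0 \<or> f d' + \<eta> * g d' \<le> 0" using d' \<epsilon>(3) \<eta>(2) by auto
    then show "f d' + min \<epsilon> \<eta> * g d' \<le> 0"
      using mono[OF insert.prems(1)[OF d'], of \<epsilon> "g d'" "min \<epsilon> \<eta>"] mono[OF insert.prems(1)[OF d'], of \<eta> "g d'" "min \<epsilon> \<eta>"] \<epsilon> \<eta>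
      by auto
  qed
  then show ?case using \<epsilon> \<eta> by (intro exI[of _ "min \<epsilon> \<eta>"]) auto
qed

context quiver
begin

definition ss_dims :: "real ^ 'v \<Rightarrow> ('v \<Rightarrow> nat) set" where
  "ss_dims \<sigma> = (\<Union>W\<in>Rep_ss Q \<beta> \<sigma>. dims W)"

lemma ss_dims_bounded: "ss_dims \<sigma> \<subseteq> {d. \<forall>x. d x \<le> \<beta> x}"
  unfolding ss_dims_def using dims_le by auto

lemma finite_ss_dims: "finite (ss_dims \<sigma>)"
  using ss_dims_bounded finite_bounded by (rule finite_subset)

lemma git_cone_iff:
  assumes "\<sigma> \<in> effective_cone Q \<beta>"
  shows "\<tau> \<in> git_cone Q \<beta> \<sigma> \<longleftrightarrow> weight \<tau> \<beta> = 0 \<and> (\<forall>d\<in>ss_dims \<sigma>. weight \<tau> d \<le> 0)"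
proof -
  have "Rep_ss Q \<beta> \<sigma> \<subseteq> Rep_ss Q \<beta> \<tau> \<longleftrightarrow> weight \<tau> \<beta> = 0 \<and> (\<forall>d\<in>ss_dims \<sigma>. weight \<tau> d \<le> 0)"
  proof
    assume sub: "Rep_ss Q \<beta> \<sigma> \<subseteq> Rep_ss Q \<beta> \<tau>"
    then obtain W where "W \<in> Rep_ss Q \<beta> \<tau>" using effective_Rep_ss_nonempty[OF assms] by blast
    then show "weight \<tau> \<beta> = 0 \<and> (\<forall>d\<in>ss_dims \<sigma>. weight \<tau> d \<le> 0)"
      using sub unfolding ss_dims_def by (auto simp: Rep_ss_iff subset_iff)
  qed (auto simp: ss_dims_def Rep_ss_iff)
  moreover have "\<tau> \<in> effective_cone Q \<beta>" if "Rep_ss Q \<beta> \<sigma> \<subseteq> Rep_ss Q \<beta> \<tau>"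
    using that effective_Rep_ss_nonempty[OF assms] Rep_ss_effective by blast
  ultimately show ?thesis unfolding git_cone_def by blast
qed

lemma git_cone_effective: "\<tau> \<in> git_cone Q \<beta> \<sigma> \<Longrightarrow> \<tau> \<in> effective_cone Q \<beta>"
  unfolding git_cone_def by simp

lemma git_cone_refl: "\<sigma> \<in> effective_cone Q \<beta> \<Longrightarrow> \<sigma> \<in> git_cone Q \<beta> \<sigma>"
  unfolding git_cone_def by simp

lemma git_cone_mono: "\<tau> \<in> git_cone Q \<beta> \<sigma> \<Longrightarrow> git_cone Q \<beta> \<tau> \<subseteq> git_cone Q \<beta> \<sigma>"
  unfolding git_cone_def by auto

lemma git_cone_Rep_ss: "\<tau> \<in> git_cone Q \<beta> \<sigma> \<Longrightarrow> V \<in> Rep_ss Q \<beta> \<sigma> \<Longrightarrow> V \<in> Rep_ss Q \<beta> \<tau>"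
  unfolding git_cone_def by auto

lemma git_cone_convex:
  assumes "\<sigma> \<in> effective_cone Q \<beta>"
  shows "convex (git_cone Q \<beta> \<sigma>)"
proof (rule convexI)
  fix \<tau> \<tau>' :: "real ^ 'v" and u v :: real
  assume h: "\<tau> \<in> git_cone Q \<beta> \<sigma>" "\<tau>' \<in> git_cone Q \<beta> \<sigma>" "0 \<le> u" "0 \<le> v"
  have "u * weight \<tau> d + v * weight \<tau>' d \<le> 0" if "d \<in> ss_dims \<sigma>" for d
    using h that unfolding git_cone_iff[OF assms] by (intro add_nonpos_nonpos mult_nonneg_nonpos) auto
  then show "u *\<^sub>R \<tau> + v *\<^sub>R \<tau>' \<in> git_cone Q \<beta> \<sigma>"
    using h unfolding git_cone_iff[OF assms] by (simp add: weight_linear)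
qed

definition dim_vec_real :: "('v \<Rightarrow> nat) \<Rightarrow> real ^ 'v" where
  "dim_vec_real d = (\<chi> x. real (d x))"

lemma inner_dim_vec: "inner (dim_vec_real d) \<sigma> = weight \<sigma> d"
  unfolding dim_vec_real_def weight_def inner_vec_def by (simp add: mult.commute)

lemma git_cone_polyhedral:
  assumes "\<sigma> \<in> effective_cone Q \<beta>"
  shows "rational_polyhedral_cone (git_cone Q \<beta> \<sigma>)"
proof -
  let ?A = "insert (dim_vec_real \<beta>) (insert (- dim_vec_real \<beta>) (dim_vec_real ` ss_dims \<sigma>))"
  have "finite ?A" using finite_ss_dims by simp
  moreover have "\<forall>a\<in>?A. \<forall>x. vec_nth a x \<in> \<rat>" by (auto simp: dim_vec_real_def)
  moreover have "git_cone Q \<beta> \<sigma> = {\<tau>. \<forall>a\<in>?A. inner a \<tau> \<le> 0}"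
    by (auto simp: git_cone_iff[OF assms] inner_dim_vec)
  ultimately show ?thesis unfolding rational_polyhedral_cone_def by blast
qed

lemma zero_in_git_cone: "\<sigma> \<in> effective_cone Q \<beta> \<Longrightarrow> 0 \<in> git_cone Q \<beta> \<sigma>"
  by (simp add: git_cone_iff weight_zero)

text \<open>
  With \<open>B\<close> of dimension \<open>d\<close>, a flip along \<open>B\<close> is still \<open>\<sigma>\<close>-semi-stable, hence \<open>\<tau>\<close>-semi-stable, and contains the complement
  \<open>K\<close> of dimension \<open>\<beta> - d\<close>; so \<open>\<tau>(d)\<close> is both nonpositive and nonnegative.
\<close>
lemma git_cone_vanishing:
  assumes \<tau>: "\<tau> \<in> git_cone Q \<beta> \<sigma>" and d: "d \<in> ss_dims \<sigma>" "weight \<sigma> d = 0"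
  shows "weight \<tau> d = 0"
proof -
  obtain W where W: "W \<in> Rep_ss Q \<beta> \<sigma>" "d \<in> dims W" using d(1) unfolding ss_dims_def by blast
  obtain B where B: "subrep Q \<beta> W B" "d = (\<lambda>x. sdim (\<beta> x) (B x))" using W(2) by (rule dimsE)
  obtain e where e: "\<And>x. projection (\<beta> x) (e x) (B x)"
    using projection_exists[OF subrepD(1)[OF B(1)]] by metis
  have WR: "W \<in> Rep Q \<beta>" using W(1) by (simp add: Rep_ss_iff)
  interpret F: flip_datum Q \<beta> W B e W using WR B(1) e by unfold_locales
  \<comment> \<open>any flip along \<open>B\<close> serves; the block of \<open>W\<close> itself is at hand\<close>
  have "flip e W W \<in> Rep_ss Q \<beta> \<sigma>" using F.flip_Rep_ss[OF W(1)] d(2) B(2) by simp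
  then have "flip e W W \<in> Rep_ss Q \<beta> \<tau>" using git_cone_Rep_ss[OF \<tau>] by blast
  then have "weight \<tau> (\<lambda>x. sdim (\<beta> x) (F.K x)) \<le> 0" "weight \<tau> \<beta> = 0"
    using dimsI[OF F.K_subrep] unfolding Rep_ss_iff by blast+
  then have "weight \<tau> d \<ge> 0" using F.weight_K[of \<tau>] B(2) by simp
  moreover have "weight \<tau> d \<le> 0" using git_cone_Rep_ss[OF \<tau> W(1)] W(2) unfolding Rep_ss_iff by blast
  ultimately show ?thesis by simp
qed

lemma git_cone_extend:
  assumes \<sigma>: "\<sigma> \<in> effective_cone Q \<beta>" and \<tau>: "\<tau> \<in> git_cone Q \<beta> \<sigma>" and \<tau>': "\<tau>' \<in> git_cone Q \<beta> \<sigma>"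
    and van: "\<And>d. d \<in> ss_dims \<sigma> \<Longrightarrow> weight \<tau> d = 0 \<Longrightarrow> weight \<tau>' d = 0"
  shows "\<exists>\<delta>>0. \<tau> + \<delta> *\<^sub>R (\<tau> - \<tau>') \<in> git_cone Q \<beta> \<sigma>"
proof -
  have "\<exists>\<delta>>0. \<delta> < 1 \<and> (\<forall>d\<in>ss_dims \<sigma>. weight \<tau> d + \<delta> * (weight \<tau> d - weight \<tau>' d) \<le> 0)"
    using \<tau> van by (intro small_perturbation finite_ss_dims) (auto simp: git_cone_iff[OF \<sigma>])
  then show ?thesis using \<tau> \<tau>' by (auto simp: git_cone_iff[OF \<sigma>] weight_linear)
qed

text \<open>
  The relative interior of a convex set consists of the points at which every segment of the set ending there
  can be prolonged; this lemma and the next one are the two directions.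
\<close>
lemma rel_interior_extend:
  fixes S :: "(real ^ 'v) set"
  assumes "convex S" "x \<in> rel_interior S" "y \<in> S"
  shows "\<exists>\<delta>>0. x + \<delta> *\<^sub>R (x - y) \<in> S"
proof -
  have "S \<noteq> {}" using assms by auto
  then obtain e where e: "e > 1" "(1 - e) *\<^sub>R y + e *\<^sub>R x \<in> S"
    using assms convex_rel_interior_iff[OF assms(1)] by blast
  have "(1 - e) *\<^sub>R y + e *\<^sub>R x = x + (e - 1) *\<^sub>R (x - y)" by (simp add: algebra_simps)
  then show ?thesis using e by (intro exI[of _ "e - 1"]) auto
qed

lemma rel_interiorI_extend:
  fixes S :: "(real ^ 'v) set"
  assumes "convex S" "S \<noteq> {}" "\<And>y. y \<in> S \<Longrightarrow> \<exists>\<delta>>0. x + \<delta> *\<^sub>R (x - y) \<in> S"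
  shows "x \<in> rel_interior S"
  unfolding convex_rel_interior_iff[OF assms(1,2)]
proof
  fix y assume "y \<in> S"
  then obtain \<delta> where \<delta>: "\<delta> > 0" "x + \<delta> *\<^sub>R (x - y) \<in> S" using assms(3) by blast
  have "(1 - (1 + \<delta>)) *\<^sub>R y + (1 + \<delta>) *\<^sub>R x = x + \<delta> *\<^sub>R (x - y)" by (simp add: algebra_simps)
  then show "\<exists>e>1. (1 - e) *\<^sub>R y + e *\<^sub>R x \<in> S" using \<delta> by (intro exI[of _ "1 + \<delta>"]) auto
qed

lemma git_cone_self_rel_interior:
  assumes \<sigma>: "\<sigma> \<in> effective_cone Q \<beta>"
  shows "\<sigma> \<in> rel_interior (git_cone Q \<beta> \<sigma>)"
  using git_cone_refl[OF \<sigma>] git_cone_vanishing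
  by (intro rel_interiorI_extend git_cone_convex \<sigma> git_cone_extend) auto

text \<open>
  The parameters \<open>t\<close> with \<open>W\<close> semi-stable for \<open>\<sigma> + t \<rho>\<close> form a closed interval. Its end nearest to
  \<open>\<sigma>\<close> is the largest of the zeros \<open>r d\<close> of the inequalities that fail at \<open>\<sigma>\<close>.
\<close>
lemma first_wall:
  fixes \<sigma> \<rho> :: "real ^ 'v"
  assumes b: "0 < b" and W: "W \<in> Rep_ss Q \<beta> (\<sigma> + b *\<^sub>R \<rho>)" and nW: "W \<notin> Rep_ss Q \<beta> \<sigma>"
    and zero: "weight \<sigma> \<beta> = 0" "weight \<rho> \<beta> = 0"
  shows "\<exists>s. 0 < s \<and> s \<le> b \<and> W \<in> Rep_ss Q \<beta> (\<sigma> + s *\<^sub>R \<rho>) \<and>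
    (\<exists>d\<in>dims W. weight (\<sigma> + s *\<^sub>R \<rho>) d = 0 \<and> weight \<sigma> d > 0)"
proof -
  let ?P = "{d \<in> dims W. weight \<sigma> d > 0}"
  define r where "r d = - weight \<sigma> d / weight \<rho> d" for d
  have WR: "W \<in> Rep Q \<beta>" using W by (simp add: Rep_ss_iff)
  have ne: "?P \<noteq> {}" using nW WR zero(1) by (auto simp: Rep_ss_iff not_le)
  have fin: "finite ?P" using finite_dims by simp
  have at_b: "weight \<sigma> d + b * weight \<rho> d \<le> 0" if "d \<in> dims W" for d
    using W that by (auto simp: Rep_ss_iff weight_linear)
  have neg: "weight \<rho> d < 0" if d: "d \<in> ?P" for d
  proof -
    have "b * weight \<rho> d < 0" using at_b[of d] d by auto
    then show ?thesis using b by (simp add: mult_less_0_iff)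
  qed
  have r: "0 < r d" "r d \<le> b" if d: "d \<in> ?P" for d
    using neg[OF d] at_b[of d] d b unfolding r_def by (auto simp: field_simps)
  define s where "s = Max (r ` ?P)"
  have "s \<in> r ` ?P" unfolding s_def using fin ne by (intro Max_in) auto
  then obtain d where d: "d \<in> ?P" "s = r d" by blast
  have s: "0 < s" "s \<le> b" using r[OF d(1)] d(2) by auto
  have "weight (\<sigma> + s *\<^sub>R \<rho>) d' \<le> 0" if d': "d' \<in> dims W" for d'
  proof (cases "weight \<sigma> d' > 0")
    case True
    then have P: "d' \<in> ?P" using d' by simp
    then have "r d' \<le> s" unfolding s_def using fin by simp
    then show ?thesis using neg[OF P] unfolding r_def by (simp add: weight_linear field_simps)
  next
    case False
    show ?thesis
    proof (cases "weight \<rho> d' \<le> 0")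
      case True
      then show ?thesis using False s(1) by (auto simp: weight_linear intro!: add_nonpos_nonpos mult_nonneg_nonpos)
    next
      case pos: False
      then have "s * weight \<rho> d' \<le> b * weight \<rho> d'" using s by (intro mult_right_mono) auto
      then show ?thesis using at_b[OF d'] by (simp add: weight_linear)
    qed
  qed
  then have "W \<in> Rep_ss Q \<beta> (\<sigma> + s *\<^sub>R \<rho>)" using WR zero by (simp add: Rep_ss_iff weight_linear)
  moreover have "weight (\<sigma> + s *\<^sub>R \<rho>) d = 0" using neg[OF d(1)] unfolding d(2) r_def by (simp add: weight_linear)
  ultimately show ?thesis using s d(1) by blast
qed

text \<open>
  There are finitely many walls on the segment from \<open>\<sigma>\<close> to \<open>\<sigma>0\<close>. At the first one, with parameter
  \<open>a\<close>, a semi-stable representation without a subrepresentation of weight zero there and \<open>\<sigma> > 0\<close> is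
  \<open>\<sigma>\<close>-semi-stable, as no wall lies in between. So \<open>Rep_ss_subset_if\<close> applies with \<open>\<tau>' = \<sigma>\<close> and with the point of \<open>C(\<sigma>)\<close> slightly beyond \<open>\<sigma>0\<close>, and
  shows that the wall does not exist.
\<close>
lemma rel_interior_Rep_ss:
  assumes \<sigma>: "\<sigma> \<in> effective_cone Q \<beta>" and \<sigma>0: "\<sigma>0 \<in> rel_interior (git_cone Q \<beta> \<sigma>)"
  shows "Rep_ss Q \<beta> \<sigma>0 \<subseteq> Rep_ss Q \<beta> \<sigma>"
proof (rule ccontr)
  assume "\<not> ?thesis"
  then obtain W1 where W1: "W1 \<in> Rep_ss Q \<beta> \<sigma>0" "W1 \<notin> Rep_ss Q \<beta> \<sigma>" by blast
  obtain \<delta> where \<delta>: "\<delta> > 0" "\<sigma>0 + \<delta> *\<^sub>R (\<sigma>0 - \<sigma>) \<in> git_cone Q \<beta> \<sigma>"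
    using rel_interior_extend[OF git_cone_convex[OF \<sigma>] \<sigma>0 git_cone_refl[OF \<sigma>]] by blast
  define \<rho> where "\<rho> = \<sigma>0 - \<sigma>"
  have zero: "weight \<sigma> \<beta> = 0" "weight \<rho> \<beta> = 0"
    using \<sigma> W1(1) unfolding \<rho>_def effective_cone_def by (auto simp: weight_linear Rep_ss_iff)
  define wall where "wall W s d \<longleftrightarrow> W \<in> Rep_ss Q \<beta> (\<sigma> + s *\<^sub>R \<rho>) \<and> d \<in> dims W \<and>
    weight (\<sigma> + s *\<^sub>R \<rho>) d = 0 \<and> weight \<sigma> d > 0" for W s d
  define A where "A = {s. 0 < s \<and> (\<exists>W d. wall W s d)}"
  have "A \<subseteq> (\<lambda>d. - weight \<sigma> d / weight \<rho> d) ` {d. \<forall>x. d x \<le> \<beta> x}"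
  proof
    fix s assume "s \<in> A"
    then obtain W d where d: "d \<in> dims W" "weight \<sigma> d + s * weight \<rho> d = 0" "weight \<sigma> d > 0"
      unfolding A_def wall_def by (auto simp: weight_linear)
    then have "weight \<rho> d \<noteq> 0" by auto
    then have "s = - weight \<sigma> d / weight \<rho> d" using d(2) by (simp add: field_simps)
    then show "s \<in> (\<lambda>d. - weight \<sigma> d / weight \<rho> d) ` {d. \<forall>x. d x \<le> \<beta> x}" using dims_le[OF d(1)] by auto
  qed
  then have fin: "finite A" using finite_bounded finite_subset by blast
  have "W1 \<in> Rep_ss Q \<beta> (\<sigma> + 1 *\<^sub>R \<rho>)" using W1(1) unfolding \<rho>_def by simp
  from first_wall[OF _ this W1(2) zero] obtain s1 where s1: "s1 \<in> A" "s1 \<le> 1"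
    unfolding A_def wall_def by auto
  define a where "a = Min A"
  have a_min: "a \<le> s" if "s \<in> A" for s unfolding a_def using Min_le[OF fin that] .
  have a: "a \<in> A" "a \<le> 1"
    using Min_in[OF fin] s1 a_min[OF s1(1)] unfolding a_def by auto
  obtain W d where W: "wall W a d" using a(1) unfolding A_def by blast
  have a0: "0 < a" using a(1) unfolding A_def by simp
  \<comment> \<open>this factor prolongs the segment from \<open>\<sigma>\<close> through the wall exactly to \<open>\<sigma>0 + \<delta> (\<sigma>0 - \<sigma>)\<close>\<close>
  define \<delta>' where "\<delta>' = (1 + \<delta>) / a - 1"
  have \<delta>': "\<delta>' > 0" unfolding \<delta>'_def using a(2) a0 \<delta>(1) by (simp add: field_simps)
  have "a + \<delta>' * a = 1 + \<delta>" unfolding \<delta>'_def using a0 by (simp add: field_simps)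
  then have end_pt: "(\<sigma> + a *\<^sub>R \<rho>) + \<delta>' *\<^sub>R ((\<sigma> + a *\<^sub>R \<rho>) - \<sigma>) = \<sigma>0 + \<delta> *\<^sub>R (\<sigma>0 - \<sigma>)"
  proof -
    have "(\<sigma> + a *\<^sub>R \<rho>) + \<delta>' *\<^sub>R ((\<sigma> + a *\<^sub>R \<rho>) - \<sigma>) = \<sigma> + (a + \<delta>' * a) *\<^sub>R \<rho>"
      by (simp add: algebra_simps)
    also have "\<dots> = \<sigma>0 + \<delta> *\<^sub>R (\<sigma>0 - \<sigma>)"
      unfolding \<open>a + \<delta>' * a = 1 + \<delta>\<close> \<rho>_def by (simp add: algebra_simps)
    finally show ?thesis .
  qed
  have "Rep_ss Q \<beta> (\<sigma> + a *\<^sub>R \<rho>) \<subseteq> Rep_ss Q \<beta> \<sigma>"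
  proof (rule Rep_ss_subset_if[OF \<sigma> \<delta>'])
    fix V assume V: "V \<in> Rep_ss Q \<beta> (\<sigma> + a *\<^sub>R \<rho>)"
      and nd: "\<And>d. d \<in> dims V \<Longrightarrow> weight (\<sigma> + a *\<^sub>R \<rho>) d = 0 \<Longrightarrow> weight \<sigma> d \<le> 0"
    have V\<sigma>: "V \<in> Rep_ss Q \<beta> \<sigma>"
    proof (rule ccontr)
      assume "V \<notin> Rep_ss Q \<beta> \<sigma>"
      from first_wall[OF a0 V this zero] obtain s d where s: "s \<le> a" "0 < s" "wall V s d"
        unfolding wall_def by blast
      then have "s \<in> A" unfolding A_def by blast
      then have "s = a" using a_min s(1) by fastforce
      then show False using s(3) nd[of d] unfolding wall_def by auto
    qed
    then show "V \<in> Rep_ss Q \<beta> \<sigma> \<and> V \<in> Rep_ss Q \<beta> ((\<sigma> + a *\<^sub>R \<rho>) + \<delta>' *\<^sub>R ((\<sigma> + a *\<^sub>R \<rho>) - \<sigma>))"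
      unfolding end_pt using git_cone_Rep_ss[OF \<delta>(2)] by blast
  qed
  then have "W \<in> Rep_ss Q \<beta> \<sigma>" using W unfolding wall_def by blast
  then show False using W unfolding wall_def Rep_ss_iff by (auto simp: not_less[symmetric])
qed

lemma rel_interior_git_cone:
  assumes \<sigma>: "\<sigma> \<in> effective_cone Q \<beta>"
  shows "rel_interior (git_cone Q \<beta> \<sigma>) = git_class Q \<beta> \<sigma>"
proof (intro Set.set_eqI iffI)
  fix \<tau> assume \<tau>: "\<tau> \<in> rel_interior (git_cone Q \<beta> \<sigma>)"
  then have "\<tau> \<in> git_cone Q \<beta> \<sigma>" using rel_interior_subset by blast
  then show "\<tau> \<in> git_class Q \<beta> \<sigma>"
    using rel_interior_Rep_ss[OF \<sigma> \<tau>] unfolding git_cone_def git_class_def by auto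
next
  fix \<tau> assume "\<tau> \<in> git_class Q \<beta> \<sigma>"
  then have \<tau>: "\<tau> \<in> effective_cone Q \<beta>" "Rep_ss Q \<beta> \<sigma> = Rep_ss Q \<beta> \<tau>" unfolding git_class_def by auto
  then have "git_cone Q \<beta> \<tau> = git_cone Q \<beta> \<sigma>" unfolding git_cone_def by simp
  then show "\<tau> \<in> rel_interior (git_cone Q \<beta> \<sigma>)" using git_cone_self_rel_interior[OF \<tau>(1)] by simp
qed

text \<open>
  A \<open>\<tau>\<close>-semi-stable representation that is not destabilised in the direction of \<open>\<sigma>\<close> is semi-stable for a
  point of the open segment from \<open>\<tau>\<close> to \<open>\<sigma>\<close>. Such a point is in the relative interior of \<open>C(\<sigma>)\<close>,
  so the representation is \<open>\<sigma>\<close>-semi-stable.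
\<close>
lemma Rep_ss_subset_in_cone:
  assumes \<sigma>: "\<sigma> \<in> effective_cone Q \<beta>" and \<tau>: "\<tau> \<in> git_cone Q \<beta> \<sigma>" and \<tau>': "\<tau>' \<in> git_cone Q \<beta> \<sigma>"
    and \<delta>: "\<delta> > 0" "\<tau> + \<delta> *\<^sub>R (\<tau> - \<tau>') \<in> git_cone Q \<beta> \<sigma>"
  shows "Rep_ss Q \<beta> \<tau> \<subseteq> Rep_ss Q \<beta> \<tau>'"
proof (rule Rep_ss_subset_if[OF \<sigma> \<delta>(1)])
  fix V assume V: "V \<in> Rep_ss Q \<beta> \<tau>" and nd: "\<And>d. d \<in> dims V \<Longrightarrow> weight \<tau> d = 0 \<Longrightarrow> weight \<sigma> d \<le> 0"
  have "\<exists>\<epsilon>>0. \<epsilon> < 1 \<and> (\<forall>d\<in>dims V. weight \<tau> d + \<epsilon> * (weight \<sigma> d - weight \<tau> d) \<le> 0)"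
    using V nd by (intro small_perturbation finite_dims) (auto simp: Rep_ss_iff)
  then obtain \<epsilon> where \<epsilon>: "\<epsilon> > 0" "\<epsilon> < 1" "\<forall>d\<in>dims V. weight \<tau> d + \<epsilon> * (weight \<sigma> d - weight \<tau> d) \<le> 0" by blast
  let ?\<sigma>0 = "\<tau> - \<epsilon> *\<^sub>R (\<tau> - \<sigma>)"
  have "?\<sigma>0 \<in> rel_interior (git_cone Q \<beta> \<sigma>)"
    using rel_interior_convex_shrink[OF git_cone_convex[OF \<sigma>] git_cone_self_rel_interior[OF \<sigma>] \<tau>] \<epsilon> by simp
  moreover have "V \<in> Rep_ss Q \<beta> ?\<sigma>0"
    using V \<epsilon>(3) \<sigma> unfolding effective_cone_def by (auto simp: Rep_ss_iff weight_linear algebra_simps)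
  ultimately have "V \<in> Rep_ss Q \<beta> \<sigma>" using rel_interior_Rep_ss[OF \<sigma>] by blast
  then show "V \<in> Rep_ss Q \<beta> \<tau>' \<and> V \<in> Rep_ss Q \<beta> (\<tau> + \<delta> *\<^sub>R (\<tau> - \<tau>'))"
    using git_cone_Rep_ss[OF \<tau>'] git_cone_Rep_ss[OF \<delta>(2)] by blast
qed

lemma git_cone_inside:
  assumes \<sigma>: "\<sigma> \<in> effective_cone Q \<beta>" and \<tau>: "\<tau> \<in> git_cone Q \<beta> \<sigma>"
  shows "git_cone Q \<beta> \<tau> = {\<tau>' \<in> git_cone Q \<beta> \<sigma>. \<forall>d\<in>ss_dims \<sigma>. weight \<tau> d = 0 \<longrightarrow> weight \<tau>' d = 0}"
proof (intro Set.set_eqI iffI)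
  fix \<tau>' assume \<tau>': "\<tau>' \<in> git_cone Q \<beta> \<tau>"
  have "ss_dims \<sigma> \<subseteq> ss_dims \<tau>" using \<tau> unfolding ss_dims_def git_cone_def by auto
  then show "\<tau>' \<in> {\<tau>' \<in> git_cone Q \<beta> \<sigma>. \<forall>d\<in>ss_dims \<sigma>. weight \<tau> d = 0 \<longrightarrow> weight \<tau>' d = 0}"
    using git_cone_mono[OF \<tau>] \<tau>' git_cone_vanishing[OF \<tau>'] by blast
next
  fix \<tau>' assume "\<tau>' \<in> {\<tau>' \<in> git_cone Q \<beta> \<sigma>. \<forall>d\<in>ss_dims \<sigma>. weight \<tau> d = 0 \<longrightarrow> weight \<tau>' d = 0}"
  then have \<tau>': "\<tau>' \<in> git_cone Q \<beta> \<sigma>" and van: "\<And>d. d \<in> ss_dims \<sigma> \<Longrightarrow> weight \<tau> d = 0 \<Longrightarrow> weight \<tau>' d = 0" by auto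
  obtain \<delta> where \<delta>: "\<delta> > 0" "\<tau> + \<delta> *\<^sub>R (\<tau> - \<tau>') \<in> git_cone Q \<beta> \<sigma>"
    using git_cone_extend[OF \<sigma> \<tau> \<tau>' van] by blast
  show "\<tau>' \<in> git_cone Q \<beta> \<tau>"
    using Rep_ss_subset_in_cone[OF \<sigma> \<tau> \<tau>' \<delta>] git_cone_effective[OF \<tau>'] unfolding git_cone_def by simp
qed

lemma git_cone_face:
  assumes \<sigma>: "\<sigma> \<in> effective_cone Q \<beta>" and \<tau>: "\<tau> \<in> git_cone Q \<beta> \<sigma>"
  shows "git_cone Q \<beta> \<tau> face_of git_cone Q \<beta> \<sigma>"
  unfolding face_of_def
proof (intro conjI ballI impI)
  show "git_cone Q \<beta> \<tau> \<subseteq> git_cone Q \<beta> \<sigma>" using git_cone_mono[OF \<tau>] .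
  show "convex (git_cone Q \<beta> \<tau>)" using git_cone_convex[OF git_cone_effective[OF \<tau>]] .
  fix a b x assume ab: "a \<in> git_cone Q \<beta> \<sigma>" "b \<in> git_cone Q \<beta> \<sigma>" and x: "x \<in> git_cone Q \<beta> \<tau>" "x \<in> open_segment a b"
  obtain u where u: "0 < u" "u < 1" "x = (1 - u) *\<^sub>R a + u *\<^sub>R b" using x(2) by (auto simp: in_segment)
  have "weight a d = 0 \<and> weight b d = 0" if d: "d \<in> ss_dims \<sigma>" "weight \<tau> d = 0" for d
  proof -
    have "weight x d = 0" using x(1) d unfolding git_cone_inside[OF \<sigma> \<tau>] by blast
    then have eq: "(1 - u) * weight a d + u * weight b d = 0" unfolding u(3) by (simp add: weight_linear)
    have "weight a d \<le> 0" "weight b d \<le> 0" using ab d(1) unfolding git_cone_iff[OF \<sigma>] by auto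
    then have "(1 - u) * weight a d \<le> 0" "u * weight b d \<le> 0" using u by (auto intro: mult_nonneg_nonpos)
    then have "(1 - u) * weight a d = 0" "u * weight b d = 0" using eq by linarith+
    then show ?thesis using u by simp
  qed
  then show "a \<in> git_cone Q \<beta> \<tau>" "b \<in> git_cone Q \<beta> \<tau>" using ab unfolding git_cone_inside[OF \<sigma> \<tau>] by auto
qed

lemma finite_Rep_ss: "finite {Rep_ss Q \<beta> \<sigma> |\<sigma>. \<sigma> \<in> effective_cone Q \<beta>}"
proof (rule finite_subset)
  let ?D = "{d. \<forall>x. d x \<le> \<beta> x}"
  show "{Rep_ss Q \<beta> \<sigma> |\<sigma>. \<sigma> \<in> effective_cone Q \<beta>} \<subseteq> (\<lambda>N. {W \<in> Rep Q \<beta>. dims W \<subseteq> N}) ` Pow ?D"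
  proof
    fix X assume "X \<in> {Rep_ss Q \<beta> \<sigma> |\<sigma>. \<sigma> \<in> effective_cone Q \<beta>}"
    then obtain \<sigma> where \<sigma>: "\<sigma> \<in> effective_cone Q \<beta>" "X = Rep_ss Q \<beta> \<sigma>" by blast
    have "X = {W \<in> Rep Q \<beta>. dims W \<subseteq> {d \<in> ?D. weight \<sigma> d \<le> 0}}"
      using \<sigma> dims_le unfolding effective_cone_def by (auto simp: Rep_ss_iff)
    then show "X \<in> (\<lambda>N. {W \<in> Rep Q \<beta>. dims W \<subseteq> N}) ` Pow ?D" by (intro image_eqI) auto
  qed
qed (use finite_bounded in simp)

lemma finite_git_cones: "finite {git_cone Q \<beta> \<sigma> |\<sigma>. \<sigma> \<in> effective_cone Q \<beta>}"
proof (rule finite_subset)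
  show "{git_cone Q \<beta> \<sigma> |\<sigma>. \<sigma> \<in> effective_cone Q \<beta>} \<subseteq>
      (\<lambda>X. {\<tau> \<in> effective_cone Q \<beta>. X \<subseteq> Rep_ss Q \<beta> \<tau>}) ` {Rep_ss Q \<beta> \<sigma> |\<sigma>. \<sigma> \<in> effective_cone Q \<beta>}"
    unfolding git_cone_def by auto
qed (use finite_Rep_ss in simp)

text \<open>
  A nonempty face \<open>T\<close> and \<open>C(\<tau>)\<close> for \<open>\<tau>\<close> in the relative interior of \<open>T\<close> are faces with intersecting relative
  interiors, hence equal. Likewise \<open>K \<inter> L = C(\<tau>)\<close> for \<open>\<tau>\<close> in the relative interior of \<open>K \<inter> L\<close>.
\<close>
lemma git_fan:
  "finite_fan_covering {git_cone Q \<beta> \<sigma> |\<sigma>. \<sigma> \<in> effective_cone Q \<beta>} (effective_cone Q \<beta>)"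
  (is "finite_fan_covering ?F ?C")
  unfolding finite_fan_covering_def
proof (intro conjI ballI allI impI)
  show "finite ?F" by (rule finite_git_cones)
  show "rational_polyhedral_cone K" if "K \<in> ?F" for K using that git_cone_polyhedral by auto
  show "\<Union>?F = ?C" using git_cone_refl git_cone_effective by blast
  fix K assume "K \<in> ?F"
  then obtain \<sigma> where \<sigma>: "\<sigma> \<in> ?C" and K: "K = git_cone Q \<beta> \<sigma>" by blast
  show "T \<in> ?F" if T: "cone_face T K" for T
  proof -
    have TK: "T face_of K" "T \<noteq> {}" using T unfolding cone_face_def by auto
    then have "rel_interior T \<noteq> {}" using rel_interior_eq_empty face_of_imp_convex by blast
    then obtain \<tau> where \<tau>: "\<tau> \<in> rel_interior T" by blast
    then have \<tau>K: "\<tau> \<in> git_cone Q \<beta> \<sigma>" using rel_interior_subset face_of_imp_subset[OF TK(1)] K by blast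
    then have \<tau>C: "\<tau> \<in> ?C" by (rule git_cone_effective)
    have "T = git_cone Q \<beta> \<tau>"
      using face_of_eq[OF TK(1)[unfolded K] git_cone_face[OF \<sigma> \<tau>K]] \<tau> git_cone_self_rel_interior[OF \<tau>C] by blast
    then show ?thesis using \<tau>C by blast
  qed
  fix L assume "L \<in> ?F"
  then obtain \<sigma>' where \<sigma>': "\<sigma>' \<in> ?C" and L: "L = git_cone Q \<beta> \<sigma>'" by blast
  have "convex (K \<inter> L)" unfolding K L using git_cone_convex \<sigma> \<sigma>' by (intro convex_Int) auto
  moreover have ne: "K \<inter> L \<noteq> {}" unfolding K L using zero_in_git_cone \<sigma> \<sigma>' by blast
  ultimately obtain \<tau> where \<tau>: "\<tau> \<in> rel_interior (K \<inter> L)" using rel_interior_eq_empty by blast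
  then have \<tau>KL: "\<tau> \<in> git_cone Q \<beta> \<sigma>" "\<tau> \<in> git_cone Q \<beta> \<sigma>'" using rel_interior_subset K L by blast+
  have \<tau>self: "\<tau> \<in> git_cone Q \<beta> \<tau>" using git_cone_refl[OF git_cone_effective[OF \<tau>KL(1)]] .
  note faces = git_cone_face[OF \<sigma> \<tau>KL(1)] git_cone_face[OF \<sigma>' \<tau>KL(2)]
  have "K \<inter> L \<subseteq> git_cone Q \<beta> \<tau>"
    by (rule subset_of_face_of[OF faces(1)]) (use K \<tau> \<tau>self in auto)
  moreover have "git_cone Q \<beta> \<tau> \<subseteq> K \<inter> L" unfolding K L using git_cone_mono \<tau>KL by blast
  ultimately have eq: "K \<inter> L = git_cone Q \<beta> \<tau>" by blast
  have "K \<inter> L face_of K" unfolding eq unfolding K by (rule faces(1))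
  then show "cone_face (K \<inter> L) K" using ne unfolding cone_face_def by blast
  have "K \<inter> L face_of L" unfolding eq unfolding L by (rule faces(2))
  then show "cone_face (K \<inter> L) L" using ne unfolding cone_face_def by blast
qed

end

theorem theorem1p1:
  fixes Q :: "('v::finite, 'a) pre_digraph" and \<beta> :: "'v \<Rightarrow> nat"
  assumes "fin_digraph Q" and "verts Q = UNIV"
    and "\<not> (\<exists>p. pre_digraph.cycle Q p)"
  shows "(\<forall>\<sigma>\<in>effective_cone Q \<beta>.
            rational_polyhedral_cone (git_cone Q \<beta> \<sigma>) \<and>
            rel_interior (git_cone Q \<beta> \<sigma>) = git_class Q \<beta> \<sigma>) \<and>
         finite_fan_covering {git_cone Q \<beta> \<sigma> |\<sigma>. \<sigma> \<in> effective_cone Q \<beta>} (effective_cone Q \<beta>) \<and>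
         (\<forall>\<sigma>\<in>effective_cone Q \<beta>. zariski_open Q \<beta> (Rep_ss Q \<beta> \<sigma>)) \<and>
         finite {Rep_ss Q \<beta> \<sigma> |\<sigma>. \<sigma> \<in> effective_cone Q \<beta>}"
proof -
  interpret quiver Q \<beta> using assms(2) by unfold_locales
  show ?thesis
    using git_cone_polyhedral rel_interior_git_cone git_fan Rep_ss_open finite_Rep_ss
    unfolding effective_cone_def by (intro conjI ballI) auto
qed

end
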